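(* There exists $\kappa>0$ such that $N(T_\alpha,-1)\ge\kappa/\alpha$ for all sufficiently small $\alpha>0$. In particular, $N(T_\alpha,-1)\to+\infty$ as $\alpha\to0$.
   Context: For $\alpha\in(0,\frac{\pi}{2})$ let $U_\alpha=\{(x_1,x_2)\in\mathbb R^2: |\arg(x_1+ix_2)|<\alpha\}$. $T_\alpha$ denotes the self-adjoint operator in $L^2(U_\alpha)$ associated with the closed, lower semibounded sesquilinear form $$t_\alpha(u,u)=\int_{U_\alpha}|\nabla u|^2\,dx-\int_{\partial U_\alpha}|u|^2\,ds,\qquad u\in H^1(U_\alpha),$$ where $ds$ is the one-dimensional Hausdorff measure (the Laplacian with the Robin condition $\partial_\nu u=u$). Its essential spectrum is $[-1,+\infty)$. $N(T_\alpha,-1)$ denotes the number of eigenvalues of $T_\alpha$ in $(-\infty,-1)$, counted with multiplicities, i.e. the number of discrete eigenvalues of $T_\alpha$ (it is finite for each $\alpha$). *)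

theory Defs
  imports "HOL-Analysis.Analysis"
begin

section \<open>Square integrable functions\<close>

text \<open>
  All function spaces are complex. An element of \<open>L\<^sup>2(M)\<close> is represented by a function; two
  functions that agree almost everywhere represent the same element, and every notion below
  respects this identification.
\<close>

definition L2 :: "'a measure \<Rightarrow> ('a \<Rightarrow> complex) set" where
  "L2 M = {f \<in> borel_measurable M. integrable M (\<lambda>x. (cmod (f x))\<^sup>2)}"

definition L2_inner :: "'a measure \<Rightarrow> ('a \<Rightarrow> complex) \<Rightarrow> ('a \<Rightarrow> complex) \<Rightarrow> complex" where
  "L2_inner M f g = (\<integral>x. f x * cnj (g x) \<partial>M)"

definition L2_normsq :: "'a measure \<Rightarrow> ('a \<Rightarrow> complex) \<Rightarrow> real" where
  "L2_normsq M f = (\<integral>x. (cmod (f x))\<^sup>2 \<partial>M)"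

section \<open>Smooth functions, weak gradients and \<open>H\<^sup>1\<close>\<close>

definition partial_deriv :: "2 \<Rightarrow> (real^2 \<Rightarrow> complex) \<Rightarrow> real^2 \<Rightarrow> complex" where
  "partial_deriv i f x = frechet_derivative f (at x) (axis i 1)"

primrec C_k :: "nat \<Rightarrow> (real^2 \<Rightarrow> complex) \<Rightarrow> bool" where
  "C_k 0 f \<longleftrightarrow> continuous_on UNIV f"
| "C_k (Suc k) f \<longleftrightarrow> (\<forall>x. f differentiable (at x)) \<and> (\<forall>i. C_k k (partial_deriv i f))"

definition Cc_smooth :: "(real^2) set \<Rightarrow> (real^2 \<Rightarrow> complex) set" where
  "Cc_smooth U = {\<phi>. (\<forall>k. C_k k \<phi>) \<and>
     compact (closure {x. \<phi> x \<noteq> 0}) \<and> closure {x. \<phi> x \<noteq> 0} \<subseteq> U}"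

definition is_weak_grad ::
  "(real^2) set \<Rightarrow> (real^2 \<Rightarrow> complex) \<Rightarrow> (real^2 \<Rightarrow> complex^2) \<Rightarrow> bool" where
  "is_weak_grad U u G \<longleftrightarrow>
     (\<forall>i. (\<lambda>x. G x $ i) \<in> L2 (lebesgue_on U) \<and>
       (\<forall>\<phi>\<in>Cc_smooth U.
          (\<integral>x. u x * partial_deriv i \<phi> x \<partial>lebesgue_on U) =
          - (\<integral>x. G x $ i * \<phi> x \<partial>lebesgue_on U)))"

definition H1 :: "(real^2) set \<Rightarrow> (real^2 \<Rightarrow> complex) set" where
  "H1 U = {u \<in> L2 (lebesgue_on U). \<exists>G. is_weak_grad U u G}"

text \<open>The weak gradient of \<open>u \<in> H\<^sup>1(U)\<close> is unique up to null sets; any representative is chosen.\<close>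

definition weak_grad :: "(real^2) set \<Rightarrow> (real^2 \<Rightarrow> complex) \<Rightarrow> real^2 \<Rightarrow> complex^2" where
  "weak_grad U u = (SOME G. is_weak_grad U u G)"

definition H1_normsq :: "(real^2) set \<Rightarrow> (real^2 \<Rightarrow> complex) \<Rightarrow> real" where
  "H1_normsq U u = L2_normsq (lebesgue_on U) u +
     (\<Sum>i\<in>UNIV. L2_normsq (lebesgue_on U) (\<lambda>x. weak_grad U u x $ i))"

section \<open>One-dimensional Hausdorff measure\<close>

text \<open>
  The covering sets are required to be bounded because \<^const>\<open>diameter\<close> is real-valued and
  carries no information on unbounded sets.
\<close>

definition hausdorff1_pre :: "real \<Rightarrow> 'a::metric_space set \<Rightarrow> ennreal" where
  "hausdorff1_pre \<delta> A =
     (INF C \<in> {C :: nat \<Rightarrow> 'a set. A \<subseteq> (\<Union>j. C j) \<and> (\<forall>j. bounded (C j) \<and> diameter (C j) \<le> \<delta>)}.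
        \<Sum>j. ennreal (diameter (C j)))"

definition hausdorff1 :: "'a::metric_space measure" where
  "hausdorff1 = measure_of UNIV (sets borel) (\<lambda>A. SUP \<delta>\<in>{0<..}. hausdorff1_pre \<delta> A)"

definition bdry_measure :: "(real^2) set \<Rightarrow> (real^2) measure" where
  "bdry_measure U = restrict_space hausdorff1 (frontier U)"

section \<open>Boundary traces\<close>

text \<open>
  On a Lipschitz domain the trace is the continuous extension to \<open>H\<^sup>1(U)\<close> of the restriction
  map \<open>\<phi> \<mapsto> \<phi>|\<^bsub>\<partial>U\<^esub>\<close>, defined on the dense subspace of restrictions to \<open>U\<close> of functions
  in \<open>C\<^sub>c\<^sup>\<infinity>(\<real>\<^sup>2)\<close>. It is determined up to null sets of the boundary measure.
\<close>

definition is_trace ::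
  "(real^2) set \<Rightarrow> (real^2 \<Rightarrow> complex) \<Rightarrow> (real^2 \<Rightarrow> complex) \<Rightarrow> bool" where
  "is_trace U u g \<longleftrightarrow> g \<in> L2 (bdry_measure U) \<and>
     (\<exists>\<phi>. (\<forall>n::nat. \<phi> n \<in> Cc_smooth UNIV) \<and>
       (\<lambda>n. H1_normsq U (\<lambda>x. \<phi> n x - u x)) \<longlonglongrightarrow> 0 \<and>
       (\<lambda>n. L2_normsq (bdry_measure U) (\<lambda>x. \<phi> n x - g x)) \<longlonglongrightarrow> 0)"

definition trace_bd :: "(real^2) set \<Rightarrow> (real^2 \<Rightarrow> complex) \<Rightarrow> real^2 \<Rightarrow> complex" where
  "trace_bd U u = (SOME g. is_trace U u g)"

section \<open>Operators associated with sesquilinear forms\<close>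

text \<open>
  The operator in \<open>L\<^sup>2(M)\<close> associated with a form \<open>t\<close> with domain \<open>D\<close>, given by its graph:
  \<open>u\<close> lies in the domain and \<open>T u = f\<close> iff \<open>t(u,v) = \<langle>f,v\<rangle>\<close> for all \<open>v \<in> D\<close>.
\<close>

definition form_operator ::
  "'a measure \<Rightarrow> ('a \<Rightarrow> complex) set \<Rightarrow> (('a \<Rightarrow> complex) \<Rightarrow> ('a \<Rightarrow> complex) \<Rightarrow> complex)
     \<Rightarrow> (('a \<Rightarrow> complex) \<times> ('a \<Rightarrow> complex)) set" where
  "form_operator M D t = {(u, f). u \<in> D \<and> f \<in> L2 M \<and> (\<forall>v\<in>D. t u v = L2_inner M f v)}"

definition eigenspace ::
  "(('a \<Rightarrow> complex) \<times> ('a \<Rightarrow> complex)) set \<Rightarrow> real \<Rightarrow> ('a \<Rightarrow> complex) set" where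
  "eigenspace T \<mu> = {u. (u, \<lambda>x. complex_of_real \<mu> * u x) \<in> T}"

text \<open>Linear independence over the complex numbers, of the classes modulo null functions.\<close>

definition ae_independent :: "'a measure \<Rightarrow> nat \<Rightarrow> (nat \<Rightarrow> 'a \<Rightarrow> complex) \<Rightarrow> bool" where
  "ae_independent M n u \<longleftrightarrow>
     (\<forall>c :: nat \<Rightarrow> complex. (AE x in M. (\<Sum>i<n. c i * u i x) = 0) \<longrightarrow> (\<forall>i<n. c i = 0))"

definition ae_dim :: "'a measure \<Rightarrow> ('a \<Rightarrow> complex) set \<Rightarrow> enat" where
  "ae_dim M E = Sup {enat n | n. \<exists>u. (\<forall>i<n. u i \<in> E) \<and> ae_independent M n u}"

text \<open>
  The number of eigenvalues in \<open>(-\<infinity>,c)\<close> counted with multiplicities. Real numbers that are not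
  eigenvalues contribute \<open>0\<close>; the value is \<open>\<infinity>\<close> if the total multiplicity is infinite.
\<close>

definition eigenvalue_count ::
  "'a measure \<Rightarrow> (('a \<Rightarrow> complex) \<times> ('a \<Rightarrow> complex)) set \<Rightarrow> real \<Rightarrow> enat" where
  "eigenvalue_count M T c = (\<Sum>\<^sub>\<infinity>\<mu>\<in>{..<c}. ae_dim M (eigenspace T \<mu>))"

section \<open>The Robin Laplacian in an infinite sector\<close>

text \<open>The origin is excluded explicitly since \<^const>\<open>Arg\<close> takes the value \<open>0\<close> there.\<close>

definition sector :: "real \<Rightarrow> (real^2) set" where
  "sector \<alpha> = {x. x \<noteq> 0 \<and> \<bar>Arg (Complex (x $ 1) (x $ 2))\<bar> < \<alpha>}"

definition robin_form ::
  "(real^2) set \<Rightarrow> (real^2 \<Rightarrow> complex) \<Rightarrow> (real^2 \<Rightarrow> complex) \<Rightarrow> complex" where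
  "robin_form U u v =
     (\<integral>x. (\<Sum>i\<in>UNIV. weak_grad U u x $ i * cnj (weak_grad U v x $ i)) \<partial>lebesgue_on U)
     - (\<integral>x. trace_bd U u x * cnj (trace_bd U v x) \<partial>bdry_measure U)"

definition T_op :: "real \<Rightarrow> ((real^2 \<Rightarrow> complex) \<times> (real^2 \<Rightarrow> complex)) set" where
  "T_op \<alpha> = form_operator (lebesgue_on (sector \<alpha>)) (H1 (sector \<alpha>)) (robin_form (sector \<alpha>))"

definition N_op :: "real \<Rightarrow> real \<Rightarrow> enat" where
  "N_op \<alpha> c = eigenvalue_count (lebesgue_on (sector \<alpha>)) (T_op \<alpha>) c"

end

theory Submission
  imports Defs
begin

text \<open>
  The eigenfunctions can be written down. An eigenfunction for \<open>-k\<^sup>2\<close> that is even in \<open>x\<^sub>2\<close> satisfies, on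
  the upper half of the sector, \<open>\<Delta>u = k\<^sup>2u\<close> with \<open>\<partial>\<^sub>\<nu>u = u\<close> on the edge and \<open>\<partial>\<^sub>\<nu>u = 0\<close> on the axis.
  This is the boundary value problem of water waves that travel along a sloping beach of
  angle \<open>\<alpha>\<close>, the edge being the water surface and the axis the bottom, and Ursell solved it by finite
  sums of exponentials. With \<open>E\<^sub>\<theta>(x) = exp (- k (x\<^sub>1 cos \<theta> + x\<^sub>2 sin \<theta>))\<close> one takes

    \<open>u = \<Sum>\<^bsub>|j| \<le> n\<^esub> c\<^bsub>|j|\<^esub> E\<^bsub>2j\<alpha>\<^esub>\<close>, \<open>k = 1 / sin ((2n+1)\<alpha>)\<close>, whenever \<open>(2n+1)\<alpha> < \<pi>/2\<close>.

  On the upper edge \<open>E\<^bsub>\<alpha>+\<eta>\<^esub>\<close> and \<open>E\<^bsub>\<alpha>-\<eta>\<^esub>\<close> coincide, so the directions \<open>2j\<alpha>\<close> and \<open>2(1-j)\<alpha>\<close> form a pair, and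
  the quotient \<open>c\<^sub>j / c\<^bsub>j-1\<^esub>\<close> is chosen such that the two contributions to \<open>\<partial>\<^sub>\<nu>u - u\<close> cancel. Only
  \<open>j = -n\<close> has no partner, and its contribution is zero because of the choice of \<open>k\<close>. The lower edge
  follows by symmetry. All directions \<open>2j\<alpha>\<close> make an angle less than \<open>\<pi>/2\<close> with every point of the sector,
  so \<open>u\<close> decays exponentially. Thus \<open>- 1 / sin\<^sup>2 ((2n+1)\<alpha>)\<close> is an eigenvalue below \<open>-1\<close> for each such
  \<open>n\<close>; these numbers are distinct, and there are about \<open>\<pi>/(4\<alpha>)\<close> of them.

  What remains is to test the eigenvalue equation against every \<open>v \<in> H\<^sup>1(U)\<close>. For smooth \<open>v\<close> of compact
  support it is Green's formula (\<open>directional_Green\<close>, \<open>plane_wave_weak\<close>, \<open>edge_coeff_telescope\<close>). The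
  passage to general \<open>v\<close> needs the elementary theory of \<open>H\<^sup>1(U)\<close>: weak gradients are unique
  (\<open>weak_grad_unique\<close>), smooth functions are dense (\<open>Cc_smooth_dense_H1\<close>), and the trace inequality
  together with the completeness of \<open>L\<^sup>2\<close> gives existence and uniqueness of traces (\<open>trace_exists\<close>,
  \<open>trace_unique\<close>). Density and uniqueness both come from mollifiers supported in \<open>-U\<close>: since
  \<open>U + U \<subseteq> U\<close>, a convolution with them at a point of \<open>U\<close> only uses values inside \<open>U\<close>. Finally the Hausdorff measure on the two edges has to be identified with arc length
  (\<open>bdry_measure_eq\<close>), for which Caratheodory's criterion is verified for closed sets.
\<close>

section \<open>The space of square integrable functions\<close>

lemma L2_measurable: "f \<in> L2 M \<Longrightarrow> f \<in> borel_measurable M"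
  and L2_integrable_sq: "f \<in> L2 M \<Longrightarrow> integrable M (\<lambda>x. (cmod (f x))\<^sup>2)"
  by (auto simp: L2_def)

lemma L2_normsq_nonneg: "0 \<le> L2_normsq M f"
  by (auto simp: L2_normsq_def)

lemma L2_bound:
  assumes "f \<in> borel_measurable M" "integrable M g" "\<And>x. x \<in> space M \<Longrightarrow> (cmod (f x))\<^sup>2 \<le> g x"
  shows "f \<in> L2 M"
  unfolding L2_def using assms
  by (auto intro!: Bochner_Integration.integrable_bound[OF assms(2)] AE_I2 simp: order_trans[OF _ abs_ge_self])

lemma cmod_add_sq_le: "(cmod (a + b))\<^sup>2 \<le> 2 * (cmod a)\<^sup>2 + 2 * (cmod b)\<^sup>2"
proof -
  have "(cmod (a + b))\<^sup>2 \<le> (cmod a + cmod b)\<^sup>2"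
    by (intro power_mono norm_triangle_ineq) auto
  also have "\<dots> \<le> 2 * (cmod a)\<^sup>2 + 2 * (cmod b)\<^sup>2"
    using zero_le_power2[of "cmod a - cmod b"] by (simp add: power2_eq_square algebra_simps)
  finally show ?thesis .
qed

lemma L2_add: "f \<in> L2 M \<Longrightarrow> g \<in> L2 M \<Longrightarrow> (\<lambda>x. f x + g x) \<in> L2 M"
  by (rule L2_bound[where g="\<lambda>x. 2 * (cmod (f x))\<^sup>2 + 2 * (cmod (g x))\<^sup>2"])
     (auto simp: L2_def intro!: cmod_add_sq_le)

lemma L2_cmult: "f \<in> L2 M \<Longrightarrow> (\<lambda>x. c * f x) \<in> L2 M"
  by (auto simp: L2_def norm_mult power_mult_distrib)

lemma L2_uminus: "f \<in> L2 M \<Longrightarrow> (\<lambda>x. - f x) \<in> L2 M"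
  using L2_cmult[of f M "-1"] by simp

lemma L2_diff: "f \<in> L2 M \<Longrightarrow> g \<in> L2 M \<Longrightarrow> (\<lambda>x. f x - g x) \<in> L2 M"
  using L2_add[of f M "\<lambda>x. - g x"] L2_uminus[of g M] by simp

lemma L2_zero: "(\<lambda>x. 0) \<in> L2 M"
  by (auto simp: L2_def)

lemma L2_cnj: "f \<in> L2 M \<Longrightarrow> (\<lambda>x. cnj (f x)) \<in> L2 M"
  by (auto simp: L2_def intro!: borel_measurable_continuous_on[where f=cnj] continuous_intros)

lemma L2_sum: "(\<And>i. i \<in> I \<Longrightarrow> f i \<in> L2 M) \<Longrightarrow> (\<lambda>x. \<Sum>i\<in>I. f i x) \<in> L2 M"
  by (induction I rule: infinite_finite_induct) (auto intro: L2_add L2_zero)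

lemma L2_bounded_mult:
  assumes "f \<in> L2 M" "h \<in> borel_measurable M" "\<And>x. x \<in> space M \<Longrightarrow> cmod (h x) \<le> B"
  shows "(\<lambda>x. h x * f x) \<in> L2 M"
proof (rule L2_bound[where g="\<lambda>x. B\<^sup>2 * (cmod (f x))\<^sup>2"])
  fix x assume "x \<in> space M"
  then have "(cmod (h x))\<^sup>2 \<le> B\<^sup>2" using assms(3) by (intro power_mono) auto
  then show "(cmod (h x * f x))\<^sup>2 \<le> B\<^sup>2 * (cmod (f x))\<^sup>2"
    by (simp add: norm_mult power_mult_distrib mult_right_mono)
qed (use assms in \<open>auto simp: L2_def\<close>)

lemma L2_normsq_bounded_mult:
  assumes "f \<in> L2 M" "h \<in> borel_measurable M" "\<And>x. x \<in> space M \<Longrightarrow> cmod (h x) \<le> B"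
  shows "L2_normsq M (\<lambda>x. h x * f x) \<le> B\<^sup>2 * L2_normsq M f"
proof -
  have "L2_normsq M (\<lambda>x. h x * f x) \<le> (\<integral>x. B\<^sup>2 * (cmod (f x))\<^sup>2 \<partial>M)"
    unfolding L2_normsq_def
  proof (rule integral_mono)
    fix x assume "x \<in> space M"
    then have "(cmod (h x))\<^sup>2 \<le> B\<^sup>2" using assms(3) by (intro power_mono) auto
    then show "(cmod (h x * f x))\<^sup>2 \<le> B\<^sup>2 * (cmod (f x))\<^sup>2"
      by (simp add: norm_mult power_mult_distrib mult_right_mono)
  qed (use assms L2_bounded_mult[OF assms] in \<open>auto simp: L2_def\<close>)
  then show ?thesis by (simp add: L2_normsq_def)
qed

lemma L2_normsq_cong_AE:
  assumes "f \<in> L2 M" "g \<in> borel_measurable M" "AE x in M. f x = g x"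
  shows "g \<in> L2 M" "L2_normsq M g = L2_normsq M f"
proof -
  have [measurable]: "f \<in> borel_measurable M" "g \<in> borel_measurable M"
    using assms by (auto simp: L2_def)
  have "integrable M (\<lambda>x. (cmod (g x))\<^sup>2) \<longleftrightarrow> integrable M (\<lambda>x. (cmod (f x))\<^sup>2)"
    by (rule integrable_cong_AE) (use assms(3) in auto)
  then show "g \<in> L2 M" using assms by (auto simp: L2_def)
  show "L2_normsq M g = L2_normsq M f" unfolding L2_normsq_def
    by (rule integral_cong_AE) (use assms(3) in auto)
qed

text \<open>All limits below are taken in squared norms. The factor 2 is harmless there, and it avoids the square
  roots of the triangle inequality.\<close>
lemma L2_normsq_add_le:
  assumes "f \<in> L2 M" "g \<in> L2 M"
  shows "L2_normsq M (\<lambda>x. f x + g x) \<le> 2 * L2_normsq M f + 2 * L2_normsq M g"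
proof -
  have "L2_normsq M (\<lambda>x. f x + g x) \<le> (\<integral>x. 2 * (cmod (f x))\<^sup>2 + 2 * (cmod (g x))\<^sup>2 \<partial>M)"
    unfolding L2_normsq_def
    by (rule integral_mono) (use assms L2_add[OF assms] in \<open>auto simp: L2_def intro: cmod_add_sq_le\<close>)
  also have "\<dots> = 2 * L2_normsq M f + 2 * L2_normsq M g"
    using assms by (simp add: L2_normsq_def L2_def)
  finally show ?thesis .
qed

lemma L2_normsq_uminus: "L2_normsq M (\<lambda>x. - f x) = L2_normsq M f"
  by (simp add: L2_normsq_def)

lemma L2_normsq_minus_commute: "L2_normsq M (\<lambda>x. f x - g x) = L2_normsq M (\<lambda>x. g x - f x)"
  by (simp add: L2_normsq_def norm_minus_commute)

lemma L2_normsq_diff_triangle: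
  assumes "f \<in> L2 M" "g \<in> L2 M" "h \<in> L2 M"
  shows "L2_normsq M (\<lambda>x. f x - h x) \<le> 2 * L2_normsq M (\<lambda>x. f x - g x) + 2 * L2_normsq M (\<lambda>x. g x - h x)"
  using L2_normsq_add_le[OF L2_diff[OF assms(1,2)] L2_diff[OF assms(2,3)]] by simp

lemma L2_normsq_eq_0:
  assumes "f \<in> L2 M" "L2_normsq M f = 0"
  shows "AE x in M. f x = 0"
  using assms integral_nonneg_eq_0_iff_AE[of M "\<lambda>x. (cmod (f x))\<^sup>2"]
  by (auto simp: L2_def L2_normsq_def)

lemma L2_mult_integrable:
  assumes "f \<in> L2 M" "g \<in> L2 M"
  shows "integrable M (\<lambda>x. f x * g x)"
proof (rule Bochner_Integration.integrable_bound[where f="\<lambda>x. (cmod (f x))\<^sup>2 + (cmod (g x))\<^sup>2"])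
  show "AE x in M. norm (f x * g x) \<le> norm ((cmod (f x))\<^sup>2 + (cmod (g x))\<^sup>2)"
  proof (rule AE_I2)
    fix x
    have "2 * (cmod (f x) * cmod (g x)) \<le> (cmod (f x))\<^sup>2 + (cmod (g x))\<^sup>2"
      using zero_le_power2[of "cmod (f x) - cmod (g x)"] by (simp add: power2_eq_square algebra_simps)
    moreover have "0 \<le> cmod (f x) * cmod (g x)" by simp
    ultimately show "norm (f x * g x) \<le> norm ((cmod (f x))\<^sup>2 + (cmod (g x))\<^sup>2)"
      unfolding norm_mult real_norm_def by linarith
  qed
qed (use assms in \<open>auto simp: L2_def\<close>)

lemma L2_Cauchy_Schwarz:
  assumes "f \<in> L2 M" "g \<in> L2 M"
  shows "(cmod (\<integral>x. f x * g x \<partial>M))\<^sup>2 \<le> L2_normsq M f * L2_normsq M g"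
proof -
  have [measurable]: "f \<in> borel_measurable M" "g \<in> borel_measurable M"
    using assms by (auto simp: L2_def)
  have i: "integrable M (\<lambda>x. cmod (f x) * cmod (g x))"
    using L2_mult_integrable[OF assms, THEN integrable_norm] by (simp add: norm_mult)
  have n: "cmod (\<integral>x. f x * g x \<partial>M) \<le> (\<integral>x. cmod (f x) * cmod (g x) \<partial>M)"
    using integral_norm_bound[of M "\<lambda>x. f x * g x"] by (simp add: norm_mult)
  have pos: "0 \<le> (\<integral>x. cmod (f x) * cmod (g x) \<partial>M)" by simp
  have "ennreal ((\<integral>x. cmod (f x) * cmod (g x) \<partial>M)\<^sup>2)
      = (\<integral>\<^sup>+x. ennreal (cmod (f x)) * ennreal (cmod (g x)) \<partial>M)\<^sup>2"
    using i pos by (simp add: ennreal_power[symmetric] nn_integral_eq_integral[symmetric] ennreal_mult')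
  also have "\<dots> \<le> (\<integral>\<^sup>+x. (ennreal (cmod (f x)))\<^sup>2 \<partial>M) * (\<integral>\<^sup>+x. (ennreal (cmod (g x)))\<^sup>2 \<partial>M)"
    by (rule Cauchy_Schwarz_nn_integral) auto
  also have "\<dots> = ennreal (L2_normsq M f * L2_normsq M g)"
    using assms by (simp add: L2_normsq_def L2_def ennreal_power nn_integral_eq_integral ennreal_mult)
  finally have "(\<integral>x. cmod (f x) * cmod (g x) \<partial>M)\<^sup>2 \<le> L2_normsq M f * L2_normsq M g"
    by (subst (asm) ennreal_le_iff) (auto intro: L2_normsq_nonneg mult_nonneg_nonneg)
  moreover have "(cmod (\<integral>x. f x * g x \<partial>M))\<^sup>2 \<le> (\<integral>x. cmod (f x) * cmod (g x) \<partial>M)\<^sup>2"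
    using n by (intro power_mono) auto
  ultimately show ?thesis by linarith
qed

lemma L2_tendsto_mult_integral:
  assumes f: "\<And>n::nat. f n \<in> L2 M" "f' \<in> L2 M" and lim: "(\<lambda>n. L2_normsq M (\<lambda>x. f n x - f' x)) \<longlonglongrightarrow> 0"
    and g: "g \<in> L2 M"
  shows "(\<lambda>n. \<integral>x. g x * f n x \<partial>M) \<longlonglongrightarrow> (\<integral>x. g x * f' x \<partial>M)"
proof -
  have "(\<lambda>n. (cmod ((\<integral>x. g x * f n x \<partial>M) - (\<integral>x. g x * f' x \<partial>M)))\<^sup>2) \<longlonglongrightarrow> 0"
  proof (rule tendsto_sandwich[OF _ _ tendsto_const])
    show "(\<lambda>n. L2_normsq M g * L2_normsq M (\<lambda>x. f n x - f' x)) \<longlonglongrightarrow> 0"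
      using tendsto_mult_left[OF lim, of "L2_normsq M g"] by simp
    show "\<forall>\<^sub>F n in sequentially. (cmod ((\<integral>x. g x * f n x \<partial>M) - (\<integral>x. g x * f' x \<partial>M)))\<^sup>2
       \<le> L2_normsq M g * L2_normsq M (\<lambda>x. f n x - f' x)"
    proof (rule always_eventually, rule allI)
      fix n
      have "(\<integral>x. g x * f n x \<partial>M) - (\<integral>x. g x * f' x \<partial>M) = (\<integral>x. g x * (f n x - f' x) \<partial>M)"
        using L2_mult_integrable[OF g f(1)[of n]] L2_mult_integrable[OF g f(2)]
        by (simp add: right_diff_distrib)
      then show "(cmod ((\<integral>x. g x * f n x \<partial>M) - (\<integral>x. g x * f' x \<partial>M)))\<^sup>2
          \<le> L2_normsq M g * L2_normsq M (\<lambda>x. f n x - f' x)"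
        using L2_Cauchy_Schwarz[OF g L2_diff[OF f(1)[of n] f(2)]] by simp
    qed
  qed auto
  then have "(\<lambda>n. cmod ((\<integral>x. g x * f n x \<partial>M) - (\<integral>x. g x * f' x \<partial>M))) \<longlonglongrightarrow> 0"
    using tendsto_real_sqrt[of "\<lambda>n. (cmod ((\<integral>x. g x * f n x \<partial>M) - (\<integral>x. g x * f' x \<partial>M)))\<^sup>2" 0 sequentially]
    by simp
  then show ?thesis
    by (simp add: LIM_zero_iff tendsto_norm_zero_iff)
qed

lemma L2_dominated_convergence:
  assumes f: "f \<in> L2 M" and m: "\<And>n::nat. h n \<in> borel_measurable M"
    and b: "\<And>n x. x \<in> space M \<Longrightarrow> cmod (h n x) \<le> C * cmod (f x)"
    and lim: "AE x in M. (\<lambda>n. h n x) \<longlonglongrightarrow> 0"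
  shows "(\<lambda>n. L2_normsq M (h n)) \<longlonglongrightarrow> 0"
proof -
  have [measurable]: "f \<in> borel_measurable M" "\<And>n. h n \<in> borel_measurable M"
    using f m by (auto simp: L2_def)
  have "(\<lambda>n. \<integral>x. (cmod (h n x))\<^sup>2 \<partial>M) \<longlonglongrightarrow> (\<integral>x. 0 \<partial>M)"
  proof (rule integral_dominated_convergence[where w="\<lambda>x. C\<^sup>2 * (cmod (f x))\<^sup>2"])
    show "integrable M (\<lambda>x. C\<^sup>2 * (cmod (f x))\<^sup>2)" using f by (auto simp: L2_def)
    show "AE x in M. norm ((cmod (h n x))\<^sup>2) \<le> C\<^sup>2 * (cmod (f x))\<^sup>2" for n
    proof (rule AE_I2)
      fix x assume "x \<in> space M"
      then have "(cmod (h n x))\<^sup>2 \<le> (C * cmod (f x))\<^sup>2" using b by (intro power_mono) auto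
      then show "norm ((cmod (h n x))\<^sup>2) \<le> C\<^sup>2 * (cmod (f x))\<^sup>2" by (simp add: power_mult_distrib)
    qed
    show "AE x in M. (\<lambda>n. (cmod (h n x))\<^sup>2) \<longlonglongrightarrow> 0"
      using lim by eventually_elim (auto intro!: tendsto_eq_intros tendsto_norm_zero)
  qed auto
  then show ?thesis by (simp add: L2_normsq_def)
qed

text \<open>Riesz--Fischer. Along a subsequence whose consecutive squared distances decay like \<open>8\<^sup>-\<^sup>k\<close>, the series
  \<open>\<Sum>4\<^sup>k|f\<^sub>k\<^sub>+\<^sub>1 - f\<^sub>k|\<^sup>2\<close> has a finite integral, hence finite almost everywhere, so the subsequence converges
  pointwise; Fatou's lemma turns this into convergence in mean.\<close>
lemma L2_complete:
  assumes f: "\<And>n::nat. f n \<in> L2 M"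
    and cauchy: "\<And>e. e > 0 \<Longrightarrow> \<exists>N. \<forall>m\<ge>N. \<forall>n\<ge>N. L2_normsq M (\<lambda>x. f m x - f n x) < e"
  shows "\<exists>g\<in>L2 M. (\<lambda>n. L2_normsq M (\<lambda>x. f n x - g x)) \<longlonglongrightarrow> 0"
proof -
  have [measurable]: "\<And>n. f n \<in> borel_measurable M" using f by (auto simp: L2_def)
  have "\<exists>s. strict_mono s \<and> (\<forall>k m. m \<ge> s k \<longrightarrow> L2_normsq M (\<lambda>x. f m x - f (s k) x) < (1/8)^k)"
  proof -
    have "\<exists>s. \<forall>k. (\<forall>m\<ge>s k. L2_normsq M (\<lambda>x. f m x - f (s k) x) < (1/8)^k) \<and> s k < s (Suc k)"
    proof (rule dependent_nat_choice[where
          P="\<lambda>k s. \<forall>m\<ge>s. L2_normsq M (\<lambda>x. f m x - f s x) < (1/8)^k" and Q="\<lambda>k s t. s < t"])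
      show "\<exists>x. \<forall>m\<ge>x. L2_normsq M (\<lambda>y. f m y - f x y) < (1/8)^0"
        using cauchy[of 1] by auto
      fix s k
      obtain N where N: "\<forall>m\<ge>N. \<forall>n\<ge>N. L2_normsq M (\<lambda>x. f m x - f n x) < (1/8)^Suc k"
        using cauchy[of "(1/8)^Suc k"] by auto
      show "\<exists>y. (\<forall>m\<ge>y. L2_normsq M (\<lambda>x. f m x - f y x) < (1/8)^Suc k) \<and> s < y"
        by (rule exI[of _ "max N (Suc s)"]) (use N in auto)
    qed
    then show ?thesis by (auto simp: strict_mono_Suc_iff)
  qed
  then obtain s where s: "strict_mono s"
    and sk: "\<And>k m. m \<ge> s k \<Longrightarrow> L2_normsq M (\<lambda>x. f m x - f (s k) x) < (1/8)^k" by blast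
  define d where "d k x = f (s (Suc k)) x - f (s k) x" for k x
  have dL: "d k \<in> L2 M" for k unfolding d_def using f by (intro L2_diff) auto
  have [measurable]: "d k \<in> borel_measurable M" for k using dL by (auto simp: L2_def)
  have dn: "L2_normsq M (d k) < (1/8)^k" for k
    unfolding d_def using sk[of k "s (Suc k)"] s by (simp add: strict_mono_less_eq)
  have "(\<integral>\<^sup>+x. (\<Sum>k. ennreal (4^k * (cmod (d k x))\<^sup>2)) \<partial>M) = (\<Sum>k. \<integral>\<^sup>+x. ennreal (4^k * (cmod (d k x))\<^sup>2) \<partial>M)"
    by (rule nn_integral_suminf) auto
  also have "\<dots> \<le> (\<Sum>k. ennreal ((1/2)^k))"
  proof (rule suminf_le)
    fix k
    have "(\<integral>\<^sup>+x. ennreal (4^k * (cmod (d k x))\<^sup>2) \<partial>M) = ennreal (4^k * L2_normsq M (d k))"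
      using dL[of k] by (subst nn_integral_eq_integral) (auto simp: L2_def L2_normsq_def)
    also have "\<dots> \<le> ennreal (4^k * (1/8)^k)"
      using dn[of k] by (intro ennreal_leI mult_left_mono) auto
    also have "(4::real)^k * (1/8)^k = (1/2)^k" by (simp add: power_mult_distrib[symmetric])
    finally show "(\<integral>\<^sup>+x. ennreal (4^k * (cmod (d k x))\<^sup>2) \<partial>M) \<le> ennreal ((1/2)^k)" .
  qed auto
  also have "\<dots> = ennreal (\<Sum>k. (1/2)^k)" by (rule suminf_ennreal2) auto
  finally have "(\<integral>\<^sup>+x. (\<Sum>k. ennreal (4^k * (cmod (d k x))\<^sup>2)) \<partial>M) < \<infinity>"
    by (simp add: le_less_trans)
  then have fin: "(\<integral>\<^sup>+x. (\<Sum>k. ennreal (4^k * (cmod (d k x))\<^sup>2)) \<partial>M) \<noteq> \<infinity>" by simp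
  have "(\<lambda>x. \<Sum>k. ennreal (4^k * (cmod (d k x))\<^sup>2)) \<in> borel_measurable M" by measurable
  from nn_integral_PInf_AE[OF this fin]
  have ae: "AE x in M. (\<Sum>k. ennreal (4^k * (cmod (d k x))\<^sup>2)) \<noteq> \<infinity>" .
  define g where "g x = lim (\<lambda>k. f (s k) x)" for x
  have [measurable]: "g \<in> borel_measurable M" unfolding g_def by measurable
  have conv: "AE x in M. (\<lambda>k. f (s k) x) \<longlonglongrightarrow> g x"
    using ae
  proof eventually_elim
    fix x assume fin: "(\<Sum>k. ennreal (4^k * (cmod (d k x))\<^sup>2)) \<noteq> \<infinity>"
    define S where "S = (\<Sum>k. ennreal (4^k * (cmod (d k x))\<^sup>2))"
    have "S \<noteq> \<infinity>" using fin by (simp only: S_def not_False_eq_True)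
    then obtain C where "S = ennreal C" and C2: "C \<ge> 0" by (cases S) auto
    then have C: "S = ennreal C" "C \<ge> 0" by auto
    have le: "norm (d k x) \<le> sqrt C * (1/2)^k" for k
    proof -
      define a where "a k = ennreal (4^k * (cmod (d k x))\<^sup>2)" for k
      have "sum a {k} \<le> suminf a" by (rule sum_le_suminf) auto
      then have "a k \<le> ennreal C" unfolding C(1)[symmetric] S_def a_def[abs_def] by (simp only: sum.insert sum.empty finite.emptyI empty_iff not_False_eq_True add_0_right)
      then have "ennreal (4^k * (cmod (d k x))\<^sup>2) \<le> ennreal C" by (simp only: a_def)
      then have "4^k * (cmod (d k x))\<^sup>2 \<le> C" using C(2) by (simp only: ennreal_le_iff)
      moreover have "(4::real)^k = (2^k)\<^sup>2" by (simp add: power2_eq_square flip: power_mult_distrib)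
      ultimately have "(2^k * cmod (d k x))\<^sup>2 \<le> C" by (simp add: power_mult_distrib)
      then have "2^k * cmod (d k x) \<le> sqrt C" by (rule real_le_rsqrt)
      then show ?thesis by (simp add: power_one_over pos_le_divide_eq mult.commute)
    qed
    have "summable (\<lambda>k. sqrt C * (1/2)^k)" by (intro summable_mult summable_geometric) simp
    from summable_comparison_test'[OF this le] have "summable (\<lambda>k. d k x)" .
    then have "(\<lambda>n. \<Sum>k<n. d k x) \<longlonglongrightarrow> (\<Sum>k. d k x)" by (rule summable_LIMSEQ)
    moreover have "(\<Sum>k<n. d k x) = f (s n) x - f (s 0) x" for n
      unfolding d_def by (rule sum_lessThan_telescope)
    ultimately have "(\<lambda>n. f (s n) x - f (s 0) x) \<longlonglongrightarrow> (\<Sum>k. d k x)" by (simp only:)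
    from tendsto_add[OF this tendsto_const[of "f (s 0) x"]]
    have "(\<lambda>n. f (s n) x) \<longlonglongrightarrow> (\<Sum>k. d k x) + f (s 0) x" by simp
    then have "convergent (\<lambda>n. f (s n) x)" unfolding convergent_def by blast
    then show "(\<lambda>k. f (s k) x) \<longlonglongrightarrow> g x" unfolding g_def by (simp add: convergent_LIMSEQ_iff)
  qed
  have fatou: "(\<integral>\<^sup>+x. ennreal ((cmod (f n x - g x))\<^sup>2) \<partial>M) \<le> ennreal e"
    if "e > 0" and N: "\<forall>m\<ge>N. \<forall>n\<ge>N. L2_normsq M (\<lambda>x. f m x - f n x) < e" and "n \<ge> N" for e N n
  proof -
    have "(\<integral>\<^sup>+x. ennreal ((cmod (f n x - g x))\<^sup>2) \<partial>M)
        = (\<integral>\<^sup>+x. liminf (\<lambda>k. ennreal ((cmod (f n x - f (s k) x))\<^sup>2)) \<partial>M)"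
    proof (rule nn_integral_cong_AE)
      show "AE x in M. ennreal ((cmod (f n x - g x))\<^sup>2) = liminf (\<lambda>k. ennreal ((cmod (f n x - f (s k) x))\<^sup>2))"
        using conv
      proof eventually_elim
        fix x assume "(\<lambda>k. f (s k) x) \<longlonglongrightarrow> g x"
        then have "(\<lambda>k. ennreal ((cmod (f n x - f (s k) x))\<^sup>2)) \<longlonglongrightarrow> ennreal ((cmod (f n x - g x))\<^sup>2)"
          by (intro tendsto_ennrealI tendsto_intros)
        then show "ennreal ((cmod (f n x - g x))\<^sup>2) = liminf (\<lambda>k. ennreal ((cmod (f n x - f (s k) x))\<^sup>2))"
          by (metis lim_imp_Liminf sequentially_bot)
      qed
    qed
    also have "\<dots> \<le> liminf (\<lambda>k. \<integral>\<^sup>+x. ennreal ((cmod (f n x - f (s k) x))\<^sup>2) \<partial>M)"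
      by (rule nn_integral_liminf) auto
    also have "\<dots> \<le> ennreal e"
    proof (rule order_trans[OF Liminf_le_Limsup Limsup_bounded])
      show "\<forall>\<^sub>F k in sequentially. (\<integral>\<^sup>+x. ennreal ((cmod (f n x - f (s k) x))\<^sup>2) \<partial>M) \<le> ennreal e"
      proof (rule eventually_sequentiallyI[of N])
        fix k assume "k \<ge> N"
        then have "s k \<ge> N" using seq_suble[OF s, of k] by linarith
        then have "L2_normsq M (\<lambda>x. f n x - f (s k) x) < e" using N \<open>n \<ge> N\<close> by auto
        then show "(\<integral>\<^sup>+x. ennreal ((cmod (f n x - f (s k) x))\<^sup>2) \<partial>M) \<le> ennreal e"
          using L2_diff[OF f[of n] f[of "s k"]]
          by (subst nn_integral_eq_integral) (auto simp: L2_def L2_normsq_def intro!: ennreal_leI)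
      qed
    qed auto
    finally show ?thesis .
  qed
  have diffL: "(\<lambda>x. f n x - g x) \<in> L2 M"
    if "e > 0" and N: "\<forall>m\<ge>N. \<forall>n\<ge>N. L2_normsq M (\<lambda>x. f m x - f n x) < e" and "n \<ge> N" for e N n
    using fatou[OF that] unfolding L2_def
    by (auto simp: integrable_iff_bounded intro: le_less_trans)
  have gL: "g \<in> L2 M"
  proof -
    obtain N where "\<forall>m\<ge>N. \<forall>n\<ge>N. L2_normsq M (\<lambda>x. f m x - f n x) < 1" using cauchy[of 1] by auto
    from diffL[OF _ this] have "(\<lambda>x. f N x - g x) \<in> L2 M" by simp
    from L2_diff[OF f[of N] this] show ?thesis by simp
  qed
  have "(\<lambda>n. L2_normsq M (\<lambda>x. f n x - g x)) \<longlonglongrightarrow> 0"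
  proof (rule LIMSEQ_I)
    fix e :: real assume "e > 0"
    then obtain N where N: "\<forall>m\<ge>N. \<forall>n\<ge>N. L2_normsq M (\<lambda>x. f m x - f n x) < e/2" using cauchy[of "e/2"] by auto
    have "norm (L2_normsq M (\<lambda>x. f n x - g x) - 0) < e" if "n \<ge> N" for n
    proof -
      have "e/2 > 0" using \<open>e > 0\<close> by simp
      from fatou[OF this N that] have "ennreal (L2_normsq M (\<lambda>x. f n x - g x)) \<le> ennreal (e/2)"
        using L2_diff[OF f[of n] gL]
        by (subst (asm) nn_integral_eq_integral) (auto simp: L2_def L2_normsq_def)
      then show ?thesis using \<open>e > 0\<close> L2_normsq_nonneg[of M "\<lambda>x. f n x - g x"]
        by (subst (asm) ennreal_le_iff) auto
    qed
    then show "\<exists>no. \<forall>n\<ge>no. norm (L2_normsq M (\<lambda>x. f n x - g x) - 0) < e" by blast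
  qed
  with gL show ?thesis by blast
qed

section \<open>Smooth functions\<close>

lemma partial_deriv_eqI:
  assumes "(f has_derivative f') (at x)"
  shows "partial_deriv i f x = f' (axis i 1)"
  using frechet_derivative_at[OF assms] by (simp add: partial_deriv_def)

lemma C_k_imp_continuous: "C_k k f \<Longrightarrow> continuous_on UNIV f"
  by (cases k) (auto intro!: continuous_at_imp_continuous_on differentiable_imp_continuous_within)

lemma C_k_Suc_imp: "C_k (Suc k) f \<Longrightarrow> C_k k f"
proof (induction k arbitrary: f)
  case 0 then show ?case by (metis C_k.simps(1) C_k_imp_continuous)
next
  case (Suc k)
  then show ?case by (metis C_k.simps(2))
qed

lemma has_derivative_frechet:
  "f differentiable at x \<Longrightarrow> (f has_derivative frechet_derivative f (at x)) (at x)"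
  by (simp add: frechet_derivative_works)

lemma C_k_const: "C_k k (\<lambda>x. c)"
proof (induction k arbitrary: c)
  case (Suc k)
  have "partial_deriv i (\<lambda>x. c) = (\<lambda>x. 0)" for i
    by (rule ext, rule partial_deriv_eqI[where f'="\<lambda>x. 0"]) (auto intro!: derivative_eq_intros)
  then show ?case using Suc by simp
qed simp

lemma C_k_add: "C_k k f \<Longrightarrow> C_k k g \<Longrightarrow> C_k k (\<lambda>x. f x + g x)"
proof (induction k arbitrary: f g)
  case (Suc k)
  have "partial_deriv i (\<lambda>x. f x + g x) = (\<lambda>x. partial_deriv i f x + partial_deriv i g x)" for i
    using Suc.prems by (intro ext, subst partial_deriv_eqI[OF has_derivative_add])
      (auto intro: has_derivative_frechet simp: partial_deriv_def)
  then show ?case using Suc by (auto intro: differentiable_add)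
qed (auto intro!: continuous_intros)

lemma partial_deriv_mult:
  assumes "f differentiable at x" "g differentiable at x"
  shows "partial_deriv i (\<lambda>x. f x * g x) x = partial_deriv i f x * g x + f x * partial_deriv i g x"
  using assms by (subst partial_deriv_eqI[OF has_derivative_mult])
      (auto intro: has_derivative_frechet simp: partial_deriv_def)

lemma C_k_mult: "C_k k f \<Longrightarrow> C_k k g \<Longrightarrow> C_k k (\<lambda>x. f x * g x)"
proof (induction k arbitrary: f g)
  case (Suc k)
  have "partial_deriv i (\<lambda>x. f x * g x) = (\<lambda>x. partial_deriv i f x * g x + f x * partial_deriv i g x)" for i
    using Suc.prems by (intro ext partial_deriv_mult) auto
  moreover have "C_k k f" "C_k k g" using Suc.prems C_k_Suc_imp by auto
  ultimately show ?case using Suc by (auto intro!: differentiable_mult C_k_add)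
qed (auto intro!: continuous_intros)

lemma C_k_uminus: "C_k k f \<Longrightarrow> C_k k (\<lambda>x. - f x)"
  using C_k_mult[OF C_k_const[of _ "-1"]] by simp

lemma C_k_diff: "C_k k f \<Longrightarrow> C_k k g \<Longrightarrow> C_k k (\<lambda>x. f x - g x)"
  using C_k_add[OF _ C_k_uminus] by force

lemma C_k_sum: "(\<And>i. i \<in> I \<Longrightarrow> C_k k (f i)) \<Longrightarrow> C_k k (\<lambda>x. \<Sum>i\<in>I. f i x)"
  by (induction I rule: infinite_finite_induct) (auto intro: C_k_add C_k_const)

lemma has_derivative_coordinate: "((\<lambda>x::real^2. complex_of_real (x $ j)) has_derivative (\<lambda>h. complex_of_real (h $ j))) (at x)"
  by (rule has_derivative_of_real, rule bounded_linear_imp_has_derivative, rule bounded_linear_vec_nth)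

lemma C_k_coordinate: "C_k k (\<lambda>x. complex_of_real (x $ j))"
proof (cases k)
  case (Suc k)
  have "partial_deriv i (\<lambda>x. complex_of_real (x $ j)) = (\<lambda>x. complex_of_real (axis i 1 $ j))" for i
    by (rule ext, rule partial_deriv_eqI[OF has_derivative_coordinate])
  with Suc show ?thesis using has_derivative_coordinate
    by (auto simp: C_k_const differentiable_def)
qed (auto intro!: continuous_intros)

lemma has_derivative_affine_comp:
  assumes "f differentiable at (c *\<^sub>R x + b)"
  shows "((\<lambda>x. f (c *\<^sub>R x + b)) has_derivative (\<lambda>h. frechet_derivative f (at (c *\<^sub>R x + b)) (c *\<^sub>R h))) (at x)"
  by (rule has_derivative_compose[of "\<lambda>x. c *\<^sub>R x + b" _ x UNIV f])
     (auto intro!: derivative_eq_intros has_derivative_frechet assms)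

lemma partial_deriv_affine_comp:
  assumes "f differentiable at (c *\<^sub>R x + b)"
  shows "partial_deriv i (\<lambda>x. f (c *\<^sub>R x + b)) x = complex_of_real c * partial_deriv i f (c *\<^sub>R x + b)"
proof -
  have "linear (frechet_derivative f (at (c *\<^sub>R x + b)))"
    using assms by (rule linear_frechet_derivative)
  then show ?thesis
    using partial_deriv_eqI[OF has_derivative_affine_comp[OF assms], of i]
    by (simp add: partial_deriv_def linear_cmul scaleR_conv_of_real[where 'a=complex])
qed

lemma C_k_affine_comp: "C_k k f \<Longrightarrow> C_k k (\<lambda>x. f (c *\<^sub>R x + b))"
proof (induction k arbitrary: f)
  case 0
  then show ?case by (auto intro!: continuous_on_compose2[of UNIV f] continuous_intros)
next
  case (Suc k)
  have d: "f differentiable at x" for x using Suc.prems by auto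
  have "partial_deriv i (\<lambda>x. f (c *\<^sub>R x + b)) = (\<lambda>x. complex_of_real c * partial_deriv i f (c *\<^sub>R x + b))" for i
    by (intro ext partial_deriv_affine_comp d)
  moreover have "(\<lambda>x. f (c *\<^sub>R x + b)) differentiable (at x)" for x
    using has_derivative_affine_comp[OF d, of c b x] unfolding differentiable_def by blast
  ultimately show ?case using Suc by (auto intro!: C_k_mult C_k_const)
qed

lemma partial_deriv_cnj:
  assumes "f differentiable at x"
  shows "partial_deriv i (\<lambda>x. cnj (f x)) x = cnj (partial_deriv i f x)"
    and "(\<lambda>x. cnj (f x)) differentiable at x"
proof -
  have "((\<lambda>x. cnj (f x)) has_derivative (\<lambda>h. cnj (frechet_derivative f (at x) h))) (at x)"
    by (intro has_derivative_cnj has_derivative_frechet assms)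
  then show "partial_deriv i (\<lambda>x. cnj (f x)) x = cnj (partial_deriv i f x)"
    and "(\<lambda>x. cnj (f x)) differentiable at x"
    using partial_deriv_eqI[of "\<lambda>x. cnj (f x)"] by (auto simp: partial_deriv_def[of i f] differentiable_def)
qed

lemma C_k_cnj: "C_k k f \<Longrightarrow> C_k k (\<lambda>x. cnj (f x))"
proof (induction k arbitrary: f)
  case (Suc k)
  have "partial_deriv i (\<lambda>x. cnj (f x)) = (\<lambda>x. cnj (partial_deriv i f x))" for i
    using Suc.prems by (intro ext partial_deriv_cnj) auto
  then show ?case using Suc by (auto intro: partial_deriv_cnj)
qed (auto intro!: continuous_intros)

text \<open>The derivatives of the flat function \<open>exp (- 1/t)\<close> are combinations of these functions, so the
  family is closed under differentiation; at \<open>0\<close> this rests on \<open>flat (Suc n)\<close> tending to \<open>0\<close>.\<close>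
definition flat :: "nat \<Rightarrow> real \<Rightarrow> real" where
  "flat n t = (if t > 0 then (1/t)^n * exp (- (1/t)) else 0)"

lemma flat_nonneg: "0 \<le> flat n t" by (simp add: flat_def)

lemma flat_tendsto_0: "(flat n \<longlongrightarrow> 0) (at 0)"
proof (rule filterlim_split_at)
  show "(flat n \<longlongrightarrow> 0) (at_left 0)"
    by (rule tendsto_eventually) (auto simp: flat_def eventually_at_filter)
  have "((\<lambda>s::real. s^n / exp s) \<longlongrightarrow> 0) at_top" by (rule tendsto_power_div_exp_0)
  then have "((\<lambda>t::real. (inverse t)^n / exp (inverse t)) \<longlongrightarrow> 0) (at_right 0)"
    by (rule filterlim_compose[OF _ filterlim_inverse_at_top_right])
  then show "(flat n \<longlongrightarrow> 0) (at_right 0)"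
    by (rule Lim_transform_eventually)
       (auto simp: flat_def eventually_at_filter exp_minus inverse_eq_divide)
qed

lemma flat_DERIV: "(flat n has_real_derivative flat (n+2) t - n * flat (n+1) t) (at t)"
proof -
  consider "t > 0" | "t < 0" | "t = 0" by linarith
  then show ?thesis
  proof cases
    case 1
    have i: "((\<lambda>t. 1/t) has_real_derivative - ((1/t)\<^sup>2)) (at t)"
      using 1 by (auto intro!: derivative_eq_intros simp: power2_eq_square)
    have "((\<lambda>t. (1/t)^n * exp (- (1/t))) has_real_derivative
      (of_nat n * ((1/t)^(n - 1) * (- ((1/t)\<^sup>2)))) * exp (- (1/t)) + (exp (- (1/t)) * (1/t)\<^sup>2) * (1/t)^n) (at t)"
      using DERIV_mult[OF DERIV_power[OF i, of n] DERIV_fun_exp[OF DERIV_minus[OF i]]] by (simp add: mult_ac)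
    also have "(of_nat n * ((1/t)^(n - 1) * (- ((1/t)\<^sup>2)))) * exp (- (1/t)) + (exp (- (1/t)) * (1/t)\<^sup>2) * (1/t)^n
        = flat (n+2) t - n * flat (n+1) t"
      using 1 by (cases n) (simp_all add: flat_def power2_eq_square power_add algebra_simps)
    finally have "((\<lambda>t. (1/t)^n * exp (- (1/t))) has_real_derivative flat (n+2) t - n * flat (n+1) t) (at t)" .
    then show ?thesis
      by (rule has_field_derivative_transform_within_open[of _ _ _ "{0<..}"]) (use 1 in \<open>auto simp: flat_def\<close>)
  next
    case 2
    have "((\<lambda>t. 0) has_real_derivative flat (n+2) t - n * flat (n+1) t) (at t)"
      using 2 by (simp add: flat_def)
    then show ?thesis
      by (rule has_field_derivative_transform_within_open[of _ _ _ "{..<0}"]) (use 2 in \<open>auto simp: flat_def\<close>)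
  next
    case 3
    have "((\<lambda>y. (flat n y - flat n 0) / (y - 0)) \<longlongrightarrow> 0) (at 0)"
      by (rule Lim_transform_eventually[OF flat_tendsto_0[of "Suc n"]])
         (auto simp: flat_def eventually_at_filter)
    then show ?thesis using 3 by (simp add: has_field_derivative_iff flat_def)
  qed
qed

text \<open>The induction on the order of differentiation is for all \<open>n\<close> at once, because the derivative of \<open>flat n\<close>
  involves \<open>flat (n+1)\<close> and \<open>flat (n+2)\<close>.\<close>
lemma C_k_flat_comp:
  assumes "\<And>k. C_k k (\<lambda>x. complex_of_real (g x))" 
  shows "C_k k (\<lambda>x. complex_of_real (flat n (g x)))"
proof (induction k arbitrary: n)
  case 0
  have "continuous_on UNIV (\<lambda>x. complex_of_real (g x))" using assms[of 0] by simp
  then have "continuous_on UNIV (\<lambda>x. Re (complex_of_real (g x)))" by (rule continuous_on_Re)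
  moreover have "continuous_on UNIV (flat n)"
    using flat_DERIV by (auto intro!: continuous_at_imp_continuous_on DERIV_isCont)
  ultimately show ?case
    by (auto intro!: continuous_on_of_real continuous_on_compose2[of UNIV "flat n"])
next
  case (Suc k)
  have d: "(\<lambda>x. complex_of_real (g x)) differentiable at x" for x using assms[of 1] by simp
  have gd: "(g has_derivative (\<lambda>h. Re (frechet_derivative (\<lambda>x. complex_of_real (g x)) (at x) h))) (at x)" for x
    using has_derivative_Re[OF has_derivative_frechet[OF d]] by simp
  have D: "((\<lambda>x. complex_of_real (flat n (g x))) has_derivative
     (\<lambda>h. complex_of_real ((flat (n+2) (g x) - n * flat (n+1) (g x)) * 
        Re (frechet_derivative (\<lambda>x. complex_of_real (g x)) (at x) h)))) (at x)" for x
    by (intro has_derivative_of_real has_derivative_compose[OF gd, of "flat n", simplified])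
       (use flat_DERIV[of n "g x"] in \<open>simp add: has_field_derivative_def\<close>)
  have im: "Im (partial_deriv i (\<lambda>x. complex_of_real (g x)) x) = 0" for i x
  proof -
    have "((\<lambda>x. Im (complex_of_real (g x))) has_derivative 
       (\<lambda>h. Im (frechet_derivative (\<lambda>x. complex_of_real (g x)) (at x) h))) (at x)"
      by (intro has_derivative_Im has_derivative_frechet d)
    moreover have "((\<lambda>x. Im (complex_of_real (g x))) has_derivative (\<lambda>h. 0)) (at x)" by simp
    ultimately show ?thesis unfolding partial_deriv_def using has_derivative_unique by metis
  qed
  have "partial_deriv i (\<lambda>x. complex_of_real (flat n (g x))) = 
    (\<lambda>x. (complex_of_real (flat (n+2) (g x)) - complex_of_real n * complex_of_real (flat (n+1) (g x)))
        * partial_deriv i (\<lambda>x. complex_of_real (g x)) x)" for i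
    using im by (intro ext, subst partial_deriv_eqI[OF D]) (auto simp: complex_eq_iff partial_deriv_def)
  moreover have "C_k k (partial_deriv i (\<lambda>x. complex_of_real (g x)))" for i using assms[of "Suc k"] by auto
  moreover note Suc.IH[of "n+2"] Suc.IH[of "n+1"]
  ultimately show ?case using D
    by (auto simp: differentiable_def intro!: C_k_mult C_k_diff C_k_const)
qed

definition bump :: "real^2 \<Rightarrow> real \<Rightarrow> real^2 \<Rightarrow> real" where
  "bump c r x = flat 0 (r\<^sup>2 - ((x$1 - c$1)\<^sup>2 + (x$2 - c$2)\<^sup>2))"

lemma norm_vec2: "(norm (x::real^2))\<^sup>2 = (x$1)\<^sup>2 + (x$2)\<^sup>2"
  unfolding norm_vec_def L2_set_def by (simp add: sum_2)

lemma bump_nonneg: "0 \<le> bump c r x" by (simp add: bump_def flat_nonneg)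

lemma bump_pos_iff: "r > 0 \<Longrightarrow> bump c r x \<noteq> 0 \<longleftrightarrow> x \<in> ball c r"
proof -
  assume "r > 0"
  have "(x$1 - c$1)\<^sup>2 + (x$2 - c$2)\<^sup>2 = (dist c x)\<^sup>2"
    using norm_vec2[of "x - c"] by (simp add: dist_norm norm_minus_commute)
  moreover have "(dist c x)\<^sup>2 < r\<^sup>2 \<longleftrightarrow> dist c x < r"
    using \<open>r > 0\<close> by (metis less_imp_le pos2 power_less_imp_less_base power_strict_mono zero_le_dist)
  ultimately show ?thesis by (auto simp: bump_def flat_def)
qed

lemma C_k_bump: "C_k k (\<lambda>x. complex_of_real (bump c r x))"
  unfolding bump_def by (rule C_k_flat_comp)
    (auto simp: power2_eq_square intro!: C_k_diff C_k_add C_k_mult C_k_const C_k_coordinate)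

lemma Cc_smoothI:
  assumes "\<And>k. C_k k \<phi>" "{x. \<phi> x \<noteq> 0} \<subseteq> K" "compact K" "K \<subseteq> U"
  shows "\<phi> \<in> Cc_smooth U"
proof -
  have "closure {x. \<phi> x \<noteq> 0} \<subseteq> K"
    using assms by (intro closure_minimal) (auto simp: compact_imp_closed)
  moreover from this have "compact (closure {x. \<phi> x \<noteq> 0})"
    using assms(3) by (metis closed_closure compact_Int_closed inf.absorb_iff2)
  ultimately show ?thesis using assms by (auto simp: Cc_smooth_def)
qed

lemma Cc_smooth_C_k: "\<phi> \<in> Cc_smooth U \<Longrightarrow> C_k k \<phi>"
  by (auto simp: Cc_smooth_def)

lemma Cc_smooth_differentiable: "\<phi> \<in> Cc_smooth U \<Longrightarrow> \<phi> differentiable at x"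
  using Cc_smooth_C_k[of \<phi> U 1] by simp

lemma Cc_smooth_compact_support:
  assumes "\<phi> \<in> Cc_smooth U"
  obtains K where "compact K" "K \<subseteq> U" "\<And>x. x \<notin> K \<Longrightarrow> \<phi> x = 0"
  using assms closure_subset[of "{x. \<phi> x \<noteq> 0}"] that[of "closure {x. \<phi> x \<noteq> 0}"]
  unfolding Cc_smooth_def by blast

lemma partial_deriv_zero_outside:
  assumes "closed K" "\<And>x. x \<notin> K \<Longrightarrow> \<phi> x = 0" "x \<notin> K"
  shows "partial_deriv i \<phi> x = 0"
proof -
  have "(\<phi> has_derivative (\<lambda>h. 0)) (at x)"
    by (rule has_derivative_transform_within_open[of "\<lambda>x. 0" _ _ _ "- K"])
       (use assms in \<open>auto simp: open_Compl\<close>)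
  then show ?thesis using partial_deriv_eqI by fastforce
qed

lemma Cc_smooth_partial_deriv:
  assumes "\<phi> \<in> Cc_smooth U" shows "partial_deriv i \<phi> \<in> Cc_smooth U"
proof -
  obtain K where K: "compact K" "K \<subseteq> U" "\<And>x. x \<notin> K \<Longrightarrow> \<phi> x = 0"
    by (rule Cc_smooth_compact_support[OF assms]) blast
  show ?thesis
  proof (rule Cc_smoothI[OF _ _ K(1,2)])
    show "C_k k (partial_deriv i \<phi>)" for k using Cc_smooth_C_k[OF assms, of "Suc k"] by simp
    show "{x. partial_deriv i \<phi> x \<noteq> 0} \<subseteq> K"
      using partial_deriv_zero_outside[of K \<phi> _ i] K compact_imp_closed by blast
  qed
qed

lemma Cc_smooth_mult:
  assumes "\<phi> \<in> Cc_smooth U" "\<And>k. C_k k f" shows "(\<lambda>x. f x * \<phi> x) \<in> Cc_smooth U"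
proof -
  obtain K where "compact K" "K \<subseteq> U" "\<And>x. x \<notin> K \<Longrightarrow> \<phi> x = 0"
    by (rule Cc_smooth_compact_support[OF assms(1)]) blast
  moreover have "C_k k (\<lambda>x. f x * \<phi> x)" for k
    by (rule C_k_mult[OF assms(2) Cc_smooth_C_k[OF assms(1)]])
  ultimately show ?thesis by (intro Cc_smoothI[of _ K]) auto
qed

lemma Cc_smooth_mono: "\<phi> \<in> Cc_smooth U \<Longrightarrow> U \<subseteq> V \<Longrightarrow> \<phi> \<in> Cc_smooth V"
  by (auto simp: Cc_smooth_def)

lemma Cc_smooth_cnj: "\<phi> \<in> Cc_smooth U \<Longrightarrow> (\<lambda>x. cnj (\<phi> x)) \<in> Cc_smooth U"
  by (auto simp: Cc_smooth_def C_k_cnj)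

lemma Cc_smooth_diff: 
  assumes "\<phi> \<in> Cc_smooth U" "\<psi> \<in> Cc_smooth U" shows "(\<lambda>x. \<phi> x - \<psi> x) \<in> Cc_smooth U"
proof -
  obtain K where "compact K" "K \<subseteq> U" "\<And>x. x \<notin> K \<Longrightarrow> \<phi> x = 0"
    by (rule Cc_smooth_compact_support[OF assms(1)]) blast
  moreover obtain L where "compact L" "L \<subseteq> U" "\<And>x. x \<notin> L \<Longrightarrow> \<psi> x = 0"
    by (rule Cc_smooth_compact_support[OF assms(2)]) blast
  moreover have "C_k k (\<lambda>x. \<phi> x - \<psi> x)" for k
    by (rule C_k_diff[OF Cc_smooth_C_k[OF assms(1)] Cc_smooth_C_k[OF assms(2)]])
  ultimately show ?thesis by (intro Cc_smoothI[of _ "K \<union> L"]) (auto, metis)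
qed

lemma Cc_smooth_bump: "r > 0 \<Longrightarrow> cball c r \<subseteq> U \<Longrightarrow> (\<lambda>x. complex_of_real (bump c r x)) \<in> Cc_smooth U"
  using bump_pos_iff[of r c] ball_subset_cball[of c r]
  by (intro Cc_smoothI[of _ "cball c r"] C_k_bump) auto

lemma frechet_derivative_partial:
  assumes "f differentiable at x"
  shows "frechet_derivative f (at x) h = (\<Sum>i\<in>UNIV. complex_of_real (h $ i) * partial_deriv i f x)"
proof -
  have l: "linear (frechet_derivative f (at x))" using assms by (rule linear_frechet_derivative)
  have "h = (\<Sum>i\<in>UNIV. (h $ i) *\<^sub>R axis i 1)"
    by (simp add: basis_expansion flip: scalar_mult_eq_scaleR)
  then have "frechet_derivative f (at x) h = frechet_derivative f (at x) (\<Sum>i\<in>UNIV. (h $ i) *\<^sub>R axis i 1)"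
    by simp
  also have "\<dots> = (\<Sum>i\<in>UNIV. complex_of_real (h $ i) * partial_deriv i f x)"
    using l by (simp add: linear_sum linear_cmul partial_deriv_def scaleR_conv_of_real[where 'a=complex])
  finally show ?thesis .
qed

section \<open>One-dimensional Hausdorff measure\<close>

definition hausdorff1_outer :: "'a::metric_space set \<Rightarrow> ennreal" where
  "hausdorff1_outer A = (SUP \<delta>\<in>{0<..}. hausdorff1_pre \<delta> A)"

definition fine_cover :: "real \<Rightarrow> 'a::metric_space set \<Rightarrow> (nat \<Rightarrow> 'a set) \<Rightarrow> bool" where
  "fine_cover \<delta> A C \<longleftrightarrow> A \<subseteq> (\<Union>j. C j) \<and> (\<forall>j. bounded (C j) \<and> diameter (C j) \<le> \<delta>)"

lemma hausdorff1_pre_eq: "hausdorff1_pre \<delta> A = (INF C \<in> Collect (fine_cover \<delta> A). \<Sum>j. ennreal (diameter (C j)))"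
  unfolding hausdorff1_pre_def fine_cover_def[abs_def] ..

lemma hausdorff1_pre_le: "fine_cover \<delta> A C \<Longrightarrow> hausdorff1_pre \<delta> A \<le> (\<Sum>j. ennreal (diameter (C j)))"
  unfolding hausdorff1_pre_eq by (intro INF_lower) simp

lemma hausdorff1_pre_mono: "A \<subseteq> B \<Longrightarrow> hausdorff1_pre \<delta> A \<le> hausdorff1_pre \<delta> B"
  unfolding hausdorff1_pre_eq by (intro INF_superset_mono) (auto simp: fine_cover_def subset_iff)

lemma hausdorff1_pre_antimono: "\<delta> \<le> \<delta>' \<Longrightarrow> hausdorff1_pre \<delta>' A \<le> hausdorff1_pre \<delta> A"
  unfolding hausdorff1_pre_eq
  by (intro INF_superset_mono subsetI CollectI order_refl) (auto simp: fine_cover_def intro: order_trans[of _ \<delta> \<delta>'])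

lemma hausdorff1_pre_le_outer: "\<delta> > 0 \<Longrightarrow> hausdorff1_pre \<delta> A \<le> hausdorff1_outer A"
  unfolding hausdorff1_outer_def by (intro SUP_upper) simp

lemma hausdorff1_outer_mono: "A \<subseteq> B \<Longrightarrow> hausdorff1_outer A \<le> hausdorff1_outer B"
  unfolding hausdorff1_outer_def by (intro SUP_mono) (auto intro: hausdorff1_pre_mono)

lemma hausdorff1_outer_empty: "hausdorff1_outer {} = 0"
proof -
  have "hausdorff1_pre \<delta> ({} :: 'a set) \<le> 0" if "\<delta> > 0" for \<delta>
    using hausdorff1_pre_le[of \<delta> "{}" "\<lambda>_. {}"] that by (simp add: fine_cover_def diameter_def)
  then show ?thesis unfolding hausdorff1_outer_def by (simp add: SUP_eq_const)
qed

lemma hausdorff1_pre_countable_subadditive: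
  "hausdorff1_pre \<delta> (\<Union>i. A i) \<le> (\<Sum>i. hausdorff1_pre \<delta> (A i))"
proof (rule ennreal_le_epsilon)
  fix e :: real assume "(\<Sum>i. hausdorff1_pre \<delta> (A i)) < top" and e: "0 < e"
  then have fin: "hausdorff1_pre \<delta> (A i) \<noteq> \<infinity>" for i
    using sum_le_suminf[of "\<lambda>i. hausdorff1_pre \<delta> (A i)" "{i}"] by (auto simp: top_unique)
  have "\<exists>C. fine_cover \<delta> (A i) C \<and> (\<Sum>j. ennreal (diameter (C j))) \<le> hausdorff1_pre \<delta> (A i) + ennreal (e * (1/2)^Suc i)" for i
  proof -
    have "e * (1/2)^Suc i > 0" using e by simp
    from INF_approx_ennreal[OF this hausdorff1_pre_eq fin[of i]] show ?thesis
      by (auto intro: less_imp_le)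
  qed
  then obtain C where C: "\<And>i. fine_cover \<delta> (A i) (C i)"
    and le: "\<And>i. (\<Sum>j. ennreal (diameter (C i j))) \<le> hausdorff1_pre \<delta> (A i) + ennreal (e * (1/2)^Suc i)" by metis
  define D where "D n = (case prod_decode n of (i, j) \<Rightarrow> C i j)" for n
  have "fine_cover \<delta> (\<Union>i. A i) D"
    unfolding fine_cover_def
  proof (intro conjI subsetI)
    fix x assume "x \<in> (\<Union>i. A i)"
    then obtain i j where "x \<in> C i j" using C by (fastforce simp: fine_cover_def)
    then have "x \<in> D (prod_encode (i, j))" by (simp add: D_def)
    then show "x \<in> (\<Union>j. D j)" by blast
  qed (use C in \<open>auto simp: D_def fine_cover_def split: prod.split\<close>)
  then have "hausdorff1_pre \<delta> (\<Union>i. A i) \<le> (\<Sum>n. ennreal (diameter (D n)))" by (rule hausdorff1_pre_le)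
  also have "\<dots> = (\<Sum>n. (\<lambda>(i, j). ennreal (diameter (C i j))) (prod_decode n))"
    by (simp add: D_def case_prod_unfold)
  also have "\<dots> = (\<Sum>i. \<Sum>j. ennreal (diameter (C i j)))"
    by (rule suminf_ennreal_2dimen) simp
  also have "\<dots> \<le> (\<Sum>i. hausdorff1_pre \<delta> (A i) + ennreal (e * (1/2)^Suc i))"
    by (intro suminf_le le summableI)
  also have "\<dots> = (\<Sum>i. hausdorff1_pre \<delta> (A i)) + (\<Sum>i. ennreal (e * (1/2)^Suc i))"
    by (rule suminf_add[symmetric]) auto
  also have "(\<Sum>i. ennreal (e * (1/2)^Suc i)) = ennreal e"
    using e sums_mult[OF power_half_series, of e] by (intro suminf_ennreal_eq) auto
  finally show "hausdorff1_pre \<delta> (\<Union>i. A i) \<le> (\<Sum>i. hausdorff1_pre \<delta> (A i)) + ennreal e" .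
qed

lemma hausdorff1_outer_countable_subadditive:
  "hausdorff1_outer (\<Union>i. A i) \<le> (\<Sum>i. hausdorff1_outer (A i))"
  unfolding hausdorff1_outer_def[of "\<Union>i. A i"]
proof (rule SUP_least)
  fix \<delta> :: real assume "\<delta> \<in> {0<..}"
  then show "hausdorff1_pre \<delta> (\<Union>i. A i) \<le> (\<Sum>i. hausdorff1_outer (A i))"
    by (intro order_trans[OF hausdorff1_pre_countable_subadditive] suminf_le summableI)
       (auto intro: hausdorff1_pre_le_outer)
qed

lemma hausdorff1_outer_space: "outer_measure_space (Pow UNIV) hausdorff1_outer"
  unfolding outer_measure_space_def positive_def increasing_def countably_subadditive_def
  by (auto simp: hausdorff1_outer_empty intro: hausdorff1_outer_mono hausdorff1_outer_countable_subadditive)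

lemma hausdorff1_outer_subadditive: "hausdorff1_outer (A \<union> B) \<le> hausdorff1_outer A + hausdorff1_outer B"
proof -
  have "hausdorff1_outer (\<Union>i. if i = 0 then A else if i = Suc 0 then B else {})
    \<le> (\<Sum>i. hausdorff1_outer (if i = 0 then A else if i = Suc 0 then B else {}))"
    by (rule hausdorff1_outer_countable_subadditive)
  also have "(\<Union>i::nat. if i = 0 then A else if i = Suc 0 then B else {}) = A \<union> B"
    by (auto split: if_splits intro: exI[of _ 0] exI[of _ "Suc 0"])
  also have "(\<Sum>i. hausdorff1_outer (if i = 0 then A else if i = Suc 0 then B else {}))
     = (\<Sum>i\<in>{0, Suc 0}. hausdorff1_outer (if i = 0 then A else if i = Suc 0 then B else {}))"
    by (rule suminf_finite) (auto simp: hausdorff1_outer_empty)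
  finally show ?thesis by simp
qed

text \<open>A set of diameter smaller than the distance of \<open>A\<close> and \<open>B\<close> meets at most one of the two.\<close>
lemma hausdorff1_outer_separated:
  assumes r: "r > 0" and sep: "\<And>x y. x \<in> A \<Longrightarrow> y \<in> B \<Longrightarrow> r \<le> dist x y"
  shows "hausdorff1_outer A + hausdorff1_outer B \<le> hausdorff1_outer (A \<union> B)"
proof -
  have pre: "hausdorff1_pre \<delta> A + hausdorff1_pre \<delta> B \<le> hausdorff1_pre \<delta> (A \<union> B)" if "0 < \<delta>" "\<delta> < r" for \<delta>
    unfolding hausdorff1_pre_eq[of \<delta> "A \<union> B"]
  proof (rule INF_greatest, drule CollectD)
    fix C assume C: "fine_cover \<delta> (A \<union> B) C"
    define CA where "CA j = (if C j \<inter> A = {} then {} else C j)" for j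
    define CB where "CB j = (if C j \<inter> B = {} then {} else C j)" for j
    have "fine_cover \<delta> A CA" "fine_cover \<delta> B CB"
      using C that by (fastforce simp: fine_cover_def CA_def CB_def)+
    then have "hausdorff1_pre \<delta> A + hausdorff1_pre \<delta> B
      \<le> (\<Sum>j. ennreal (diameter (CA j))) + (\<Sum>j. ennreal (diameter (CB j)))"
      by (intro add_mono hausdorff1_pre_le)
    also have "\<dots> = (\<Sum>j. ennreal (diameter (CA j)) + ennreal (diameter (CB j)))"
      by (rule suminf_add) auto
    also have "\<dots> \<le> (\<Sum>j. ennreal (diameter (C j)))"
    proof (intro suminf_le summableI)
      fix j
      have "C j \<inter> A = {} \<or> C j \<inter> B = {}"
      proof (rule ccontr)
        assume "\<not> ?thesis"
        then obtain x y where "x \<in> C j" "x \<in> A" "y \<in> C j" "y \<in> B" by blast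
        moreover have "bounded (C j)" "diameter (C j) \<le> \<delta>" using C by (auto simp: fine_cover_def)
        ultimately show False
          using sep[of x y] diameter_bounded_bound[of "C j" x y] that by simp
      qed
      then show "ennreal (diameter (CA j)) + ennreal (diameter (CB j)) \<le> ennreal (diameter (C j))"
        by (auto simp: CA_def CB_def diameter_def[of "{}"])
    qed
    finally show "hausdorff1_pre \<delta> A + hausdorff1_pre \<delta> B \<le> (\<Sum>j. ennreal (diameter (C j)))" .
  qed
  have ne: "{0::real<..} \<noteq> {}" by auto
  have "hausdorff1_outer A + hausdorff1_outer B = (SUP \<delta>\<in>{0<..}. hausdorff1_pre \<delta> A + hausdorff1_outer B)"
    unfolding hausdorff1_outer_def by (rule ennreal_SUP_add_left[OF ne, symmetric])
  also have "\<dots> = (SUP \<delta>\<in>{0<..}. SUP \<delta>'\<in>{0<..}. hausdorff1_pre \<delta> A + hausdorff1_pre \<delta>' B)"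
    unfolding hausdorff1_outer_def by (simp only: ennreal_SUP_add_right[OF ne])
  also have "\<dots> \<le> hausdorff1_outer (A \<union> B)"
  proof (intro SUP_least)
    fix \<delta> \<delta>' :: real assume d: "\<delta> \<in> {0<..}" "\<delta>' \<in> {0<..}"
    define m where "m = min (min \<delta> \<delta>') (r/2)"
    have m: "0 < m" "m < r" "m \<le> \<delta>" "m \<le> \<delta>'" using d r by (auto simp: m_def)
    have "hausdorff1_pre \<delta> A + hausdorff1_pre \<delta>' B \<le> hausdorff1_pre m A + hausdorff1_pre m B"
      using m by (intro add_mono hausdorff1_pre_antimono)
    also have "\<dots> \<le> hausdorff1_outer (A \<union> B)"
      using pre[OF m(1,2)] hausdorff1_pre_le_outer[OF m(1)] order_trans by blast
    finally show "hausdorff1_pre \<delta> A + hausdorff1_pre \<delta>' B \<le> hausdorff1_outer (A \<union> B)" .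
  qed
  finally show ?thesis .
qed

text \<open>The Caratheodory criterion for a closed set \<open>F\<close>. The part of \<open>S\<close> outside \<open>F\<close> is exhausted by
  the sets \<open>T n\<close> of points at distance at least \<open>1/(n+1)\<close> from \<open>F\<close>; what is missing is cut into shells
  \<open>R k\<close>. Shells of equal parity are separated, so the measures of all shells have a finite sum and
  the tails tend to zero.\<close>
lemma hausdorff1_outer_caratheodory_closed:
  fixes F S :: "'a::metric_space set"
  assumes F: "closed F"
  shows "hausdorff1_outer (S \<inter> F) + hausdorff1_outer (S - F) \<le> hausdorff1_outer S"
proof (cases "F = {} \<or> hausdorff1_outer S = \<infinity>")
  case True then show ?thesis by (auto simp: hausdorff1_outer_empty)
next
  case False
  then have ne: "F \<noteq> {}" and fin: "hausdorff1_outer S \<noteq> \<infinity>" by auto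
  let ?H = "hausdorff1_outer :: 'a set \<Rightarrow> ennreal"
  define T where "T n = {x\<in>S. 1 / real (n+1) \<le> infdist x F}" for n
  define R where "R n = {x\<in>S. 1 / real (n+2) \<le> infdist x F \<and> infdist x F < 1 / real (n+1)}" for n
  have Tn: "?H (S \<inter> F) + ?H (T n) \<le> ?H S" for n
  proof -
    have "?H (S \<inter> F) + ?H (T n) \<le> ?H (S \<inter> F \<union> T n)"
    proof (rule hausdorff1_outer_separated)
      show "1 / real (n+1) > 0" by simp
      fix x y assume "x \<in> S \<inter> F" "y \<in> T n"
      then show "1 / real (n+1) \<le> dist x y"
        using infdist_le[of x F y] by (auto simp: T_def dist_commute)
    qed
    also have "\<dots> \<le> ?H S" by (intro hausdorff1_outer_mono) (auto simp: T_def)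
    finally show ?thesis .
  qed
  have fin_sum: "(\<Sum>k<N. ?H (R (2*k+c))) \<le> ?H (\<Union>k<N. R (2*k+c))" for N c
  proof (induction N)
    case 0 then show ?case by (simp add: hausdorff1_outer_empty)
  next
    case (Suc N)
    have "(\<Sum>k<Suc N. ?H (R (2*k+c))) \<le> ?H (\<Union>k<N. R (2*k+c)) + ?H (R (2*N+c))"
      using Suc by (simp add: add_right_mono)
    also have "\<dots> \<le> ?H ((\<Union>k<N. R (2*k+c)) \<union> R (2*N+c))"
    proof (cases "N = 0")
      case True then show ?thesis by (simp add: hausdorff1_outer_empty)
    next
      case N: False
      show ?thesis
      proof (rule hausdorff1_outer_separated)
        show "1 / real (2*N+c) - 1 / real (2*N+c+1) > 0" 
        proof -
          have "1 / real (2*N+c+1) < 1 / real (2*N+c)" using N by (intro divide_strict_left_mono) auto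
          then show ?thesis by simp
        qed
        fix x y assume "x \<in> (\<Union>k<N. R (2*k+c))" "y \<in> R (2*N+c)"
        then obtain k where "k < N" "x \<in> R (2*k+c)" "y \<in> R (2*N+c)" by auto
        moreover from this have "1 / real (2*N+c) \<le> 1 / real (2*k+c+2)" by (intro divide_left_mono) auto
        ultimately have "1 / real (2*N+c) \<le> infdist x F" "infdist y F < 1 / real (2*N+c+1)"
          by (auto simp: R_def)
        then show "1 / real (2*N+c) - 1 / real (2*N+c+1) \<le> dist x y"
          using infdist_triangle[of x F y] by linarith
      qed
    qed
    also have "(\<Union>k<N. R (2*k+c)) \<union> R (2*N+c) = (\<Union>k<Suc N. R (2*k+c))"
      by (auto simp: less_Suc_eq)
    finally show ?case .
  qed
  have par: "(\<Sum>k. ?H (R (2*k+c))) \<le> ?H S" for c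
  proof (rule suminf_le_const[OF summableI])
    fix N
    show "(\<Sum>k<N. ?H (R (2*k+c))) \<le> ?H S"
      by (rule order_trans[OF fin_sum hausdorff1_outer_mono]) (auto simp: R_def)
  qed
  have "(\<Sum>k. ?H (R k)) \<le> ?H S + ?H S"
  proof (rule suminf_le_const[OF summableI])
    fix N
    have "(\<Sum>k<N. ?H (R k)) \<le> (\<Sum>k<2*N. ?H (R k))" by (intro sum_mono2) auto
    also have "\<dots> = (\<Sum>k<N. ?H (R (2*k+0))) + (\<Sum>k<N. ?H (R (2*k+1)))"
      by (induction N) (auto simp: algebra_simps)
    also have "\<dots> \<le> (\<Sum>k. ?H (R (2*k+0))) + (\<Sum>k. ?H (R (2*k+1)))"
      by (intro add_mono sum_le_suminf) auto
    also have "\<dots> \<le> ?H S + ?H S" by (intro add_mono par)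
    finally show "(\<Sum>k<N. ?H (R k)) \<le> ?H S + ?H S" .
  qed
  then have sfin: "(\<Sum>k. ?H (R k)) \<noteq> top" using fin by (auto simp: top_unique)
  have tail: "(\<lambda>n. \<Sum>k. ?H (R (k + n))) \<longlonglongrightarrow> 0"
  proof -
    have "(\<lambda>n. (\<Sum>k. ?H (R k)) - (\<Sum>k<n. ?H (R k))) \<longlonglongrightarrow> (\<Sum>k. ?H (R k)) - (\<Sum>k. ?H (R k))"
      using sfin by (intro tendsto_diff_ennreal tendsto_const summable_LIMSEQ summableI) auto
    moreover have "(\<Sum>k. ?H (R k)) - (\<Sum>k<n. ?H (R k)) = (\<Sum>k. ?H (R (k + n)))" for n
    proof -
      have "(\<Sum>k<n. ?H (R k)) \<noteq> top"
      proof
        assume "(\<Sum>k<n. ?H (R k)) = top"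
        moreover have "(\<Sum>k<n. ?H (R k)) \<le> (\<Sum>k. ?H (R k))" by (rule sum_le_suminf) auto
        ultimately show False using sfin by (simp only: top_unique)
      qed
      moreover have "(\<Sum>k. ?H (R k)) = (\<Sum>k. ?H (R (k + n))) + (\<Sum>k<n. ?H (R k))"
        by (rule suminf_offset) auto
      ultimately show ?thesis by simp
    qed
    ultimately show ?thesis using sfin by (simp add: ennreal_minus_eq_0)
  qed
  have split: "?H (S - F) \<le> ?H (T n) + (\<Sum>k. ?H (R (k + n)))" for n
  proof -
    have "S - F \<subseteq> T n \<union> (\<Union>k. R (k + n))"
    proof
      fix x assume x: "x \<in> S - F"
      then have pos: "infdist x F > 0"
        using F ne by (metis Diff_iff in_closed_iff_infdist_zero infdist_nonneg less_le)
      show "x \<in> T n \<union> (\<Union>k. R (k + n))"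
      proof (cases "x \<in> T n")
        case nT: False
        have "\<exists>m. 1 / real (m+1) \<le> infdist x F"
        proof -
          obtain m where "inverse (real (Suc m)) < infdist x F" using reals_Archimedean[OF pos] by blast
          then show ?thesis by (intro exI[of _ m]) (simp add: inverse_eq_divide)
        qed
        define m where "m = (LEAST m. 1 / real (m+1) \<le> infdist x F)"
        have m: "1 / real (m+1) \<le> infdist x F" unfolding m_def by (rule LeastI_ex) fact
        have least: "infdist x F < 1 / real (i+1)" if "i < m" for i
          using not_less_Least[of i "\<lambda>m. 1 / real (m+1) \<le> infdist x F"] that unfolding m_def by linarith
        have "m > n"
        proof (rule ccontr)
          assume "\<not> m > n"
          then have "1 / real (n+1) \<le> 1 / real (m+1)" by (intro divide_left_mono) auto
          with m have "x \<in> T n" using x by (auto simp: T_def)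
          with nT show False by simp
        qed
        then have "x \<in> R (m - 1)"
          using m least[of "m - 1"] x by (auto simp: R_def)
        moreover have "m - 1 = (m - 1 - n) + n" using \<open>m > n\<close> by simp
        ultimately have "x \<in> R ((m - 1 - n) + n)" by simp
        then show ?thesis by blast
      qed auto
    qed
    then have "?H (S - F) \<le> ?H (T n \<union> (\<Union>k. R (k + n)))" by (rule hausdorff1_outer_mono)
    also have "\<dots> \<le> ?H (T n) + ?H (\<Union>k. R (k + n))" by (rule hausdorff1_outer_subadditive)
    also have "\<dots> \<le> ?H (T n) + (\<Sum>k. ?H (R (k + n)))"
      by (intro add_left_mono hausdorff1_outer_countable_subadditive)
    finally show ?thesis .
  qed
  have "?H (S \<inter> F) + ?H (S - F) \<le> ?H S + (\<Sum>k. ?H (R (k + n)))" for n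
  proof -
    have "?H (S \<inter> F) + ?H (S - F) \<le> ?H (S \<inter> F) + (?H (T n) + (\<Sum>k. ?H (R (k + n))))"
      by (intro add_left_mono split)
    also have "\<dots> = (?H (S \<inter> F) + ?H (T n)) + (\<Sum>k. ?H (R (k + n)))" by (simp add: add.assoc)
    also have "\<dots> \<le> ?H S + (\<Sum>k. ?H (R (k + n)))" by (intro add_right_mono Tn)
    finally show ?thesis .
  qed
  moreover have "(\<lambda>n. ?H S + (\<Sum>k. ?H (R (k + n)))) \<longlonglongrightarrow> ?H S + 0"
    by (intro tendsto_add tail tendsto_const)
  ultimately show ?thesis using LIMSEQ_le_const[of _ "?H S + 0"] by auto
qed

lemma borel_subset_lambda_system:
  "sets borel \<subseteq> lambda_system UNIV (Pow UNIV) (hausdorff1_outer :: 'a::metric_space set \<Rightarrow> ennreal)"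
proof -
  let ?H = "hausdorff1_outer :: 'a set \<Rightarrow> ennreal"
  let ?L = "lambda_system UNIV (Pow UNIV) ?H"
  have "measure_space UNIV ?L ?H"
    using sigma_algebra.caratheodory_lemma[OF sigma_algebra_Pow hausdorff1_outer_space] .
  then have L: "sigma_algebra UNIV ?L" by (simp add: measure_space_def)
  have "Collect closed \<subseteq> ?L"
  proof
    fix F :: "'a set" assume "F \<in> Collect closed"
    then have F: "closed F" by simp
    have "?H (S \<inter> F) + ?H (S - F) = ?H S" for S
    proof (rule antisym[OF hausdorff1_outer_caratheodory_closed[OF F]])
      show "?H S \<le> ?H (S \<inter> F) + ?H (S - F)"
        using hausdorff1_outer_subadditive[of "S \<inter> F" "S - F"] by (simp add: Int_Diff_Un)
    qed
    then show "F \<in> ?L" unfolding algebra.lambda_system_eq[OF algebra_Pow] by blast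
  qed
  then have "sigma_sets UNIV (Collect closed) \<subseteq> ?L" by (rule sigma_algebra.sigma_sets_subset[OF L])
  then show ?thesis by (simp add: borel_eq_closed)
qed

lemma sets_hausdorff1 [measurable_cong, simp]: "sets hausdorff1 = sets borel"
  unfolding hausdorff1_def using sets.sets_measure_of_eq[of borel] by simp

lemma space_hausdorff1 [simp]: "space hausdorff1 = UNIV"
  using sets_eq_imp_space_eq[OF sets_hausdorff1] by simp

text \<open>\<^const>\<open>measure_of\<close> yields the zero measure unless the given set function is countably additive on
  the Borel sets, which is what Caratheodory's theorem supplies.\<close>
lemma emeasure_hausdorff1:
  fixes A :: "'a::metric_space set"
  assumes "A \<in> sets borel" shows "emeasure hausdorff1 A = hausdorff1_outer A"
proof -
  have "measure_space UNIV (lambda_system UNIV (Pow UNIV) hausdorff1_outer) (hausdorff1_outer :: 'a set \<Rightarrow> ennreal)"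
    using sigma_algebra.caratheodory_lemma[OF sigma_algebra_Pow hausdorff1_outer_space] .
  then have "measure_space UNIV (sets borel) (hausdorff1_outer :: 'a set \<Rightarrow> ennreal)"
    by (rule measure_down[OF _ _ borel_subset_lambda_system]) (metis sets.sigma_algebra_axioms space_borel)
  then have "positive (sets borel) (hausdorff1_outer :: 'a set \<Rightarrow> ennreal)"
    "countably_additive (sets borel) (hausdorff1_outer :: 'a set \<Rightarrow> ennreal)"
    by (auto simp: measure_space_def)
  moreover have "(hausdorff1 :: 'a measure) = measure_of UNIV (sets borel) hausdorff1_outer"
    unfolding hausdorff1_def hausdorff1_outer_def ..
  moreover have "sigma_sets UNIV (sets borel) = (sets borel :: 'a set set)"
    using sets.sigma_sets_eq[of "borel :: 'a measure"] by simp
  ultimately show ?thesis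
    using assms by (metis emeasure_measure_of_sigma sets.sigma_algebra_axioms space_borel)
qed

text \<open>Cut the segment into \<open>N\<close> pieces of length \<open>w \<le> \<delta>\<close>.\<close>
lemma hausdorff1_outer_segment_le:
  fixes v :: "'a::euclidean_space"
  assumes v: "norm v = 1" and lu: "l \<le> u"
  shows "hausdorff1_outer ((\<lambda>s. s *\<^sub>R v) ` {l<..<u}) \<le> ennreal (u - l)"
  unfolding hausdorff1_outer_def
proof (rule SUP_least)
  fix \<delta> :: real assume "\<delta> \<in> {0<..}"
  then have d: "\<delta> > 0" by simp
  obtain N where N: "(u - l) / \<delta> < real N" using reals_Archimedean2 by blast
  have N0: "N > 0" using N d lu by (cases N) (auto simp: field_simps)
  define w where "w = (u - l) / N"
  have w: "0 \<le> w" "w \<le> \<delta>" using N d lu N0 by (auto simp: w_def field_simps)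
  define C where "C j = (if j < N then (\<lambda>s. s *\<^sub>R v) ` {l + real j * w .. l + (real j + 1) * w} else {})" for j
  have diam: "diameter (C j) \<le> w" for j
  proof (rule diameter_le)
    fix x y assume "x \<in> C j" "y \<in> C j"
    then obtain s t where st: "x = s *\<^sub>R v" "y = t *\<^sub>R v" "s \<in> {l + real j * w .. l + (real j + 1) * w}" "t \<in> {l + real j * w .. l + (real j + 1) * w}"
      unfolding C_def by (cases "j < N") (simp_all only: if_True if_False empty_iff, blast)
    then have "\<bar>s - t\<bar> \<le> w" by (auto simp: algebra_simps abs_le_iff)
    then show "norm (x - y) \<le> w"
      using v st by (simp add: scaleR_diff_left[symmetric])
  qed (use w in auto)
  have bdd: "bounded (C j)" for j
    unfolding C_def by (auto intro!: compact_imp_bounded compact_continuous_image continuous_intros)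
  have cover: "(\<lambda>s. s *\<^sub>R v) ` {l<..<u} \<subseteq> (\<Union>j. C j)"
  proof safe
    fix s assume s: "s \<in> {l<..<u}"
    then have w0: "w > 0" using N0 by (auto simp: w_def)
    define j where "j = nat \<lfloor>(s - l) / w\<rfloor>"
    have "0 \<le> (s - l) / w" using s w0 by simp
    then have j: "real j \<le> (s - l) / w" "(s - l) / w < real j + 1" by (auto simp: j_def)
    have "real j < N"
    proof -
      have "(s - l) / w < (u - l) / w" using s w0 by (simp add: divide_strict_right_mono)
      also have "u - l = N * w" using N0 by (simp add: w_def)
      also have "N * w / w = N" using w0 by simp
      finally show ?thesis using j by simp
    qed
    then have "s *\<^sub>R v \<in> C j" using j w0 by (auto simp: C_def field_simps)
    then show "s *\<^sub>R v \<in> (\<Union>j. C j)" by blast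
  qed
  have "hausdorff1_pre \<delta> ((\<lambda>s. s *\<^sub>R v) ` {l<..<u}) \<le> (\<Sum>j. ennreal (diameter (C j)))"
    using cover bdd order_trans[OF diam w(2)] by (intro hausdorff1_pre_le) (simp add: fine_cover_def)
  also have "\<dots> = (\<Sum>j<N. ennreal (diameter (C j)))"
    by (rule suminf_finite) (auto simp: C_def diameter_def)
  also have "\<dots> \<le> (\<Sum>j<N. ennreal w)" by (intro sum_mono ennreal_leI diam)
  also have "\<dots> = ennreal (N * w)" using w by (simp add: ennreal_mult ennreal_of_nat_eq_real_of_nat)
  also have "N * w = u - l" using N0 by (simp add: w_def)
  finally show "hausdorff1_pre \<delta> ((\<lambda>s. s *\<^sub>R v) ` {l<..<u}) \<le> ennreal (u - l)" .
qed

text \<open>The parameters of the points in a covering set fill at most an interval of length its diameter, so the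
  bound follows from the subadditivity of Lebesgue measure. Coverings with \<open>\<delta> = 1\<close> suffice.\<close>
lemma hausdorff1_outer_segment_ge:
  fixes v :: "'a::euclidean_space"
  assumes v: "norm v = 1" and lu: "l \<le> u"
  shows "ennreal (u - l) \<le> hausdorff1_outer ((\<lambda>s. s *\<^sub>R v) ` {l<..<u})"
proof -
  have "ennreal (u - l) \<le> hausdorff1_pre 1 ((\<lambda>s. s *\<^sub>R v) ` {l<..<u})"
    unfolding hausdorff1_pre_eq
  proof (rule INF_greatest, drule CollectD)
    fix C assume C: "fine_cover 1 ((\<lambda>s. s *\<^sub>R v) ` {l<..<u}) C"
    define D where "D j = {s. s *\<^sub>R v \<in> C j}" for j
    define I where "I j = (if D j = {} then {} else {Inf (D j) .. Sup (D j)})" for j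
    have len: "emeasure lborel (I j) \<le> ennreal (diameter (C j)) \<and> D j \<subseteq> I j" for j
    proof (cases "D j = {}")
      case False
      have dd: "\<bar>s - t\<bar> \<le> diameter (C j)" if "s \<in> D j" "t \<in> D j" for s t
      proof -
        have "dist (s *\<^sub>R v) (t *\<^sub>R v) \<le> diameter (C j)"
          using C that by (intro diameter_bounded_bound) (auto simp: fine_cover_def D_def)
        then show ?thesis using v by (simp add: dist_norm scaleR_diff_left[symmetric])
      qed
      obtain s0 where s0: "s0 \<in> D j" using False by blast
      have bd: "bdd_below (D j)" "bdd_above (D j)"
        using dd[OF s0] by (auto intro!: bdd_belowI[of _ "s0 - diameter (C j)"] bdd_aboveI[of _ "s0 + diameter (C j)"]
            simp: abs_le_iff algebra_simps)
      have "Sup (D j) \<le> Inf (D j) + diameter (C j)"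
      proof (rule cSup_least[OF False])
        fix x assume x: "x \<in> D j"
        have "x - diameter (C j) \<le> Inf (D j)"
          by (rule cInf_greatest[OF False]) (use dd[OF x] in \<open>auto simp: abs_le_iff algebra_simps\<close>)
        then show "x \<le> Inf (D j) + diameter (C j)" by simp
      qed
      moreover have "Inf (D j) \<le> Sup (D j)" using bd False by (rule_tac cInf_le_cSup) auto
      ultimately have "emeasure lborel (I j) \<le> ennreal (diameter (C j))"
        using False by (auto simp: I_def intro!: ennreal_leI)
      moreover have "D j \<subseteq> I j" using bd False by (auto simp: I_def intro: cInf_lower cSup_upper)
      ultimately show ?thesis by simp
    qed (simp add: I_def)
    have "{l<..<u} \<subseteq> (\<Union>j. D j)" using C by (auto simp: fine_cover_def D_def)
    then have sub: "{l<..<u} \<subseteq> (\<Union>j. I j)" using len by blast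
    have "ennreal (u - l) = emeasure lborel {l<..<u}" using lu by simp
    also have "\<dots> \<le> emeasure lborel (\<Union>j. I j)"
      by (rule emeasure_mono[OF sub]) (auto simp: I_def)
    also have "\<dots> \<le> (\<Sum>j. emeasure lborel (I j))"
      by (rule emeasure_subadditive_countably) (auto simp: I_def)
    also have "\<dots> \<le> (\<Sum>j. ennreal (diameter (C j)))" using len by (intro suminf_le summableI) auto
    finally show "ennreal (u - l) \<le> (\<Sum>j. ennreal (diameter (C j)))" .
  qed
  also have "\<dots> \<le> hausdorff1_outer ((\<lambda>s. s *\<^sub>R v) ` {l<..<u})" by (rule hausdorff1_pre_le_outer) simp
  finally show ?thesis .
qed

text \<open>Both sides are Borel measures on the line that agree on intervals.\<close>
lemma emeasure_hausdorff1_line: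
  fixes v :: "'a::euclidean_space"
  assumes v: "norm v = 1" and A: "A \<in> sets borel" "A \<subseteq> range (\<lambda>s. s *\<^sub>R v)"
  shows "emeasure hausdorff1 A = emeasure lborel {s. s *\<^sub>R v \<in> A}"
proof -
  let ?L = "range (\<lambda>s. s *\<^sub>R v)"
  have vv: "v \<bullet> v = 1" using v by (simp add: norm_eq_1)
  have "?L = span {v}" by (simp add: span_singleton)
  then have "closed ?L" by (simp add: closed_subspace)
  then have L: "?L \<in> sets borel" by simp
  define M where "M = distr (restrict_space hausdorff1 ?L) borel (\<lambda>x. x \<bullet> v)"
  have meas: "(\<lambda>x. x \<bullet> v) \<in> restrict_space hausdorff1 ?L \<rightarrow>\<^sub>M borel"
    by (intro measurable_restrict_space1) measurable
  have emM: "emeasure M X = emeasure hausdorff1 ((\<lambda>s. s *\<^sub>R v) ` X)" if "X \<in> sets borel" for X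
  proof -
    have "emeasure M X = emeasure (restrict_space hausdorff1 ?L) ((\<lambda>x. x \<bullet> v) -` X \<inter> ?L)"
      unfolding M_def using that meas by (subst emeasure_distr) (auto simp: space_restrict_space)
    also have "(\<lambda>x. x \<bullet> v) -` X \<inter> ?L = (\<lambda>s. s *\<^sub>R v) ` X"
      using vv by auto
    also have "emeasure (restrict_space hausdorff1 ?L) ((\<lambda>s. s *\<^sub>R v) ` X) = emeasure hausdorff1 ((\<lambda>s. s *\<^sub>R v) ` X)"
      using L by (intro emeasure_restrict_space) auto
    finally show ?thesis .
  qed
  have "lborel = M"
  proof (rule lborel_eqI)
    fix l u :: real assume "\<And>b. b \<in> Basis \<Longrightarrow> l \<bullet> b \<le> u \<bullet> b"
    then have lu: "l \<le> u" by simp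
    have "(\<lambda>s. s *\<^sub>R v) ` {l<..<u} \<in> sets borel"
    proof -
      have "(\<lambda>s. s *\<^sub>R v) ` {l<..<u} = ?L \<inter> {x. l < x \<bullet> v} \<inter> {x. x \<bullet> v < u}" using vv by auto
      moreover have "\<dots> \<in> sets borel" using L by measurable
      ultimately show ?thesis by simp
    qed
    then have "emeasure M {l<..<u} = ennreal (u - l)"
      using hausdorff1_outer_segment_le[OF v lu] hausdorff1_outer_segment_ge[OF v lu]
      by (simp add: emM emeasure_hausdorff1)
    then show "emeasure M (box l u) = (\<Prod>b\<in>Basis. (u - l) \<bullet> b)" by simp
  qed (simp add: M_def)
  moreover have "(\<lambda>s. s *\<^sub>R v) -` A \<in> sets borel"
  proof -
    have "(\<lambda>s. s *\<^sub>R v) \<in> borel_measurable borel" by measurable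
    from measurable_sets[OF this A(1)] show ?thesis by simp
  qed
  moreover have "(\<lambda>s. s *\<^sub>R v) ` ((\<lambda>s. s *\<^sub>R v) -` A) = A" using A(2) by auto
  ultimately show ?thesis using emM[of "(\<lambda>s. s *\<^sub>R v) -` A"] by (simp add: vimage_def)
qed

section \<open>The geometry of the sector\<close>

definition dir :: "real \<Rightarrow> real^2" where "dir \<theta> = vector [cos \<theta>, sin \<theta>]"

lemma dir_nth [simp]: "dir \<theta> $ 1 = cos \<theta>" "dir \<theta> $ 2 = sin \<theta>"
  by (simp_all add: dir_def)

lemma norm_dir: "norm (dir \<theta>) = 1"
  using norm_vec2[of "dir \<theta>"] by (simp add: abs_square_eq_1)

lemma vec2_eq_iff: "(x::real^2) = y \<longleftrightarrow> x$1 = y$1 \<and> x$2 = y$2"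
  by (simp add: vec_eq_iff forall_2)

text \<open>For \<open>0 < \<alpha> < \<pi>/2\<close> this is the signed distance to the line spanned by \<open>dir (-\<alpha>)\<close>, positive on the side
  of \<open>dir \<alpha>\<close>. With \<open>-\<alpha>\<close> in place of \<open>\<alpha>\<close> it is the signed distance to the other edge, negative in the
  sector. Up to sign and the factor \<open>sin (2\<alpha>)\<close> the two distances are the coordinates along the edges.\<close>
definition edge_dist :: "real \<Rightarrow> real^2 \<Rightarrow> real" where
  "edge_dist \<alpha> x = sin \<alpha> * x$1 + cos \<alpha> * x$2"

lemma edge_dist_continuous [continuous_intros]: "continuous_on S (edge_dist \<alpha>)"
  unfolding edge_dist_def[abs_def] by (intro continuous_intros)

lemma edge_dist_combo: "edge_dist \<alpha> (s *\<^sub>R dir \<alpha> + t *\<^sub>R dir (- \<alpha>)) = s * sin (2*\<alpha>)"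
  "edge_dist (- \<alpha>) (s *\<^sub>R dir \<alpha> + t *\<^sub>R dir (- \<alpha>)) = - (t * sin (2*\<alpha>))"
  unfolding edge_dist_def sin_double by (simp_all add: algebra_simps)

lemma edge_dist_abs_le: "\<bar>edge_dist \<alpha> x\<bar> \<le> norm x"
proof -
  have "(edge_dist \<alpha> x)\<^sup>2 \<le> (edge_dist \<alpha> x)\<^sup>2 + (cos \<alpha> * x$1 - sin \<alpha> * x$2)\<^sup>2" by simp
  also have "\<dots> = ((sin \<alpha>)\<^sup>2 + (cos \<alpha>)\<^sup>2) * ((x$1)\<^sup>2 + (x$2)\<^sup>2)"
    unfolding edge_dist_def by algebra
  also have "\<dots> = (norm x)\<^sup>2" by (simp add: norm_vec2)
  finally show ?thesis by (metis abs_le_square_iff abs_norm_cancel)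
qed

lemma combo_of_edge_dist:
  assumes "sin (2*\<alpha>) \<noteq> 0"
  shows "x = (edge_dist \<alpha> x / sin (2*\<alpha>)) *\<^sub>R dir \<alpha> + (- edge_dist (- \<alpha>) x / sin (2*\<alpha>)) *\<^sub>R dir (- \<alpha>)"
  using assms unfolding vec2_eq_iff edge_dist_def sin_double by (simp add: field_simps)

lemma sin_double_pos: "0 < \<alpha> \<Longrightarrow> \<alpha> < pi/2 \<Longrightarrow> sin (2*\<alpha>) > 0"
  by (intro sin_gt_zero) auto

lemma sector_eq:
  assumes "0 < \<alpha>" "\<alpha> < pi/2"
  shows "sector \<alpha> = {x. edge_dist \<alpha> x > 0 \<and> edge_dist (- \<alpha>) x < 0}"
proof (intro set_eqI)
  fix x :: "real^2"
  show "x \<in> sector \<alpha> \<longleftrightarrow> x \<in> {x. edge_dist \<alpha> x > 0 \<and> edge_dist (- \<alpha>) x < 0}"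
  proof (cases "x = 0")
    case True then show ?thesis by (simp add: sector_def edge_dist_def)
  next
    case False
    define z where "z = Complex (x$1) (x$2)"
    define r where "r = cmod z"
    define \<phi> where "\<phi> = Arg z"
    have "z \<noteq> 0" using False by (auto simp: z_def vec2_eq_iff complex_eq_iff)
    then have r: "r > 0" by (simp add: r_def)
    have z: "z = rcis r \<phi>" unfolding r_def \<phi>_def by (rule rcis_cmod_Arg[symmetric])
    have x1: "x$1 = r * cos \<phi>" using arg_cong[OF z, of Re] by (simp add: z_def)
    have x2: "x$2 = r * sin \<phi>" using arg_cong[OF z, of Im] by (simp add: z_def)
    have e1: "edge_dist \<alpha> x = r * sin (\<alpha> + \<phi>)" by (simp add: edge_dist_def x1 x2 sin_add algebra_simps)
    have e2: "edge_dist (- \<alpha>) x = - (r * sin (\<alpha> - \<phi>))" by (simp add: edge_dist_def x1 x2 sin_diff algebra_simps)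
    have \<phi>: "- pi < \<phi>" "\<phi> \<le> pi" unfolding \<phi>_def using Arg_bounded by auto
    have "\<bar>\<phi>\<bar> < \<alpha> \<longleftrightarrow> sin (\<alpha> + \<phi>) > 0 \<and> sin (\<alpha> - \<phi>) > 0"
    proof
      assume "\<bar>\<phi>\<bar> < \<alpha>" then show "sin (\<alpha> + \<phi>) > 0 \<and> sin (\<alpha> - \<phi>) > 0"
        using assms by (auto intro!: sin_gt_zero)
    next
      assume s: "sin (\<alpha> + \<phi>) > 0 \<and> sin (\<alpha> - \<phi>) > 0"
      then have "sin (\<alpha> + \<phi>) + sin (\<alpha> - \<phi>) > 0" by linarith
      then have "sin \<alpha> * cos \<phi> > 0" by (simp add: sin_add sin_diff mult.commute)
      moreover have "sin \<alpha> > 0" using assms by (intro sin_gt_zero) auto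
      ultimately have c: "cos \<phi> > 0" by (simp add: zero_less_mult_iff)
      have b1: "\<phi> < pi/2"
      proof (rule ccontr)
        assume "\<not> \<phi> < pi/2"
        then have "0 \<le> cos (pi - \<phi>)" using \<phi> by (intro cos_ge_zero) auto
        then show False using c by simp
      qed
      have b2: "- (pi/2) < \<phi>"
      proof (rule ccontr)
        assume "\<not> - (pi/2) < \<phi>"
        then have "0 \<le> cos (pi + \<phi>)" using \<phi> by (intro cos_ge_zero) auto
        then show False using c by simp
      qed
      have p: "\<psi> > 0" if "sin \<psi> > 0" "- pi < \<psi>" for \<psi>
      proof (rule ccontr)
        assume "\<not> \<psi> > 0"
        then have "0 \<le> sin (- \<psi>)" using that by (intro sin_ge_zero) auto
        then show False using that by simp
      qed
      have "\<alpha> + \<phi> > 0" using s assms b1 b2 by (rule_tac p) linarith+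
      moreover have "\<alpha> - \<phi> > 0" using s assms b1 b2 by (rule_tac p) linarith+
      ultimately
      show "\<bar>\<phi>\<bar> < \<alpha>" by linarith
    qed
    then show ?thesis using False r unfolding sector_def mem_Collect_eq e1 e2 z_def[symmetric] \<phi>_def[symmetric]
      by (simp add: zero_less_mult_iff)
  qed
qed

lemma open_sector: assumes "0 < \<alpha>" "\<alpha> < pi/2" shows "open (sector \<alpha>)"
  unfolding sector_eq[OF assms] Collect_conj_eq
  by (intro open_Int open_Collect_less continuous_intros)

lemma sector_combo_iff:
  assumes "0 < \<alpha>" "\<alpha> < pi/2"
  shows "s *\<^sub>R dir \<alpha> + t *\<^sub>R dir (- \<alpha>) \<in> sector \<alpha> \<longleftrightarrow> s > 0 \<and> t > 0"
  using sin_double_pos[OF assms] unfolding sector_eq[OF assms] mem_Collect_eq edge_dist_combo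
  by (simp add: zero_less_mult_iff)

lemma frontier_sector:
  assumes a: "0 < \<alpha>" "\<alpha> < pi/2"
  shows "frontier (sector \<alpha>) = (\<lambda>s. s *\<^sub>R dir \<alpha>) ` {0..} \<union> (\<lambda>s. s *\<^sub>R dir (- \<alpha>)) ` {0..}"
proof -
  have s2: "sin (2*\<alpha>) > 0" by (rule sin_double_pos[OF a])
  have cl: "closure (sector \<alpha>) = {x. edge_dist \<alpha> x \<ge> 0 \<and> edge_dist (- \<alpha>) x \<le> 0}"
  proof
    have "closed {x. edge_dist \<alpha> x \<ge> 0 \<and> edge_dist (- \<alpha>) x \<le> 0}"
      unfolding Collect_conj_eq by (intro closed_Int closed_Collect_le continuous_intros)
    then show "closure (sector \<alpha>) \<subseteq> {x. edge_dist \<alpha> x \<ge> 0 \<and> edge_dist (- \<alpha>) x \<le> 0}"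
      by (rule closure_minimal[rotated]) (auto simp: sector_eq[OF a])
    show "{x. edge_dist \<alpha> x \<ge> 0 \<and> edge_dist (- \<alpha>) x \<le> 0} \<subseteq> closure (sector \<alpha>)"
    proof safe
      fix x assume x: "edge_dist \<alpha> x \<ge> 0" "edge_dist (- \<alpha>) x \<le> 0"
      have "sin \<alpha> > 0" using a by (intro sin_gt_zero) auto
      have "x + (1 / real (Suc n)) *\<^sub>R dir 0 \<in> sector \<alpha>" for n
      proof -
        have "sin \<alpha> * (1 / real (Suc n)) > 0" using \<open>sin \<alpha> > 0\<close> by simp
        moreover have "edge_dist \<alpha> (x + (1 / real (Suc n)) *\<^sub>R dir 0) = edge_dist \<alpha> x + sin \<alpha> * (1 / real (Suc n))"
          "edge_dist (- \<alpha>) (x + (1 / real (Suc n)) *\<^sub>R dir 0) = edge_dist (- \<alpha>) x - sin \<alpha> * (1 / real (Suc n))"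
          by (simp_all add: edge_dist_def distrib_left)
        ultimately show ?thesis using x unfolding sector_eq[OF a] by simp
      qed
      moreover have "(\<lambda>n. x + (1 / real (Suc n)) *\<^sub>R dir 0) \<longlonglongrightarrow> x + 0 *\<^sub>R dir 0"
        using LIMSEQ_inverse_real_of_nat by (intro tendsto_intros) (simp add: inverse_eq_divide)
      ultimately show "x \<in> closure (sector \<alpha>)" unfolding closure_sequential
        by (intro exI[of _ "\<lambda>n. x + (1 / real (Suc n)) *\<^sub>R dir 0"]) simp
    qed
  qed
  have "frontier (sector \<alpha>) = closure (sector \<alpha>) - sector \<alpha>"
    using open_sector[OF a] by (simp add: frontier_def interior_open)
  also have "\<dots> = (\<lambda>s. s *\<^sub>R dir \<alpha>) ` {0..} \<union> (\<lambda>s. s *\<^sub>R dir (- \<alpha>)) ` {0..}" (is "?L = ?R")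
  proof
    show "?L \<subseteq> ?R"
    proof
      fix x assume x: "x \<in> ?L"
      define s t where "s = edge_dist \<alpha> x / sin (2*\<alpha>)" and "t = - edge_dist (- \<alpha>) x / sin (2*\<alpha>)"
      have "x = s *\<^sub>R dir \<alpha> + t *\<^sub>R dir (- \<alpha>)" unfolding s_def t_def using s2 by (intro combo_of_edge_dist) simp
      moreover have "edge_dist \<alpha> x \<ge> 0" "edge_dist (- \<alpha>) x \<le> 0" "edge_dist \<alpha> x = 0 \<or> edge_dist (- \<alpha>) x = 0"
        using x cl sector_eq[OF a] by force+
      then have "s \<ge> 0" "t \<ge> 0" "s = 0 \<or> t = 0"
        using s2 unfolding s_def t_def by (auto simp: divide_simps)
      ultimately show "x \<in> ?R" by auto
    qed
    show "?R \<subseteq> ?L"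
      using edge_dist_combo[of \<alpha> _ 0] edge_dist_combo[of \<alpha> 0] s2
      unfolding cl unfolding sector_eq[OF a] by auto
  qed
  finally show ?thesis .
qed

subsection \<open>The boundary measure is arc length\<close>

text \<open>A single arc length parameter for both edges, negative on the lower one, turns the boundary
  measure into an image of Lebesgue measure on the whole line.\<close>
definition boundary_param :: "real \<Rightarrow> real \<Rightarrow> real^2" where
  "boundary_param \<alpha> s = (if 0 \<le> s then s *\<^sub>R dir \<alpha> else (- s) *\<^sub>R dir (- \<alpha>))"

lemma boundary_param_continuous: "continuous_on UNIV (boundary_param \<alpha>)"
proof -
  have "boundary_param \<alpha> = (\<lambda>s. max 0 s *\<^sub>R dir \<alpha> + max 0 (- s) *\<^sub>R dir (- \<alpha>))"
    by (auto simp: boundary_param_def)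
  then show ?thesis by (auto intro!: continuous_intros)
qed

lemma boundary_param_measurable [measurable]: "boundary_param \<alpha> \<in> borel_measurable borel"
  using boundary_param_continuous by (rule borel_measurable_continuous_onI)

lemma boundary_param_in_frontier:
  assumes a: "0 < \<alpha>" "\<alpha> < pi/2"
  shows "boundary_param \<alpha> s \<in> frontier (sector \<alpha>)"
proof (cases "0 \<le> s")
  case True then show ?thesis unfolding boundary_param_def frontier_sector[OF a] by auto
next
  case False
  then have "(- s) *\<^sub>R dir (- \<alpha>) \<in> (\<lambda>s. s *\<^sub>R dir (- \<alpha>)) ` {0..}" by (intro imageI) simp
  with False show ?thesis unfolding boundary_param_def frontier_sector[OF a] by simp
qed

lemma bdry_measure_eq:
  assumes a: "0 < \<alpha>" "\<alpha> < pi/2"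
  shows "bdry_measure (sector \<alpha>) = distr lborel (restrict_space borel (frontier (sector \<alpha>))) (boundary_param \<alpha>)"
proof (rule measure_eqI)
  let ?F = "frontier (sector \<alpha>)"
  have F: "?F \<in> sets borel" by simp
  show sets_eq: "sets (bdry_measure (sector \<alpha>)) = sets (distr lborel (restrict_space borel ?F) (boundary_param \<alpha>))"
    by (simp add: bdry_measure_def sets_restrict_space)
  fix A assume "A \<in> sets (bdry_measure (sector \<alpha>))"
  then have A': "A \<in> sets (restrict_space borel ?F)" by (simp add: bdry_measure_def sets_restrict_space)
  then have A: "A \<in> sets borel" "A \<subseteq> ?F" using sets_restrict_space_iff[of ?F borel] F by auto
  have s2: "sin (2*\<alpha>) > 0" by (rule sin_double_pos[OF a])
  have ray: "range (\<lambda>s. s *\<^sub>R dir \<alpha>) = {x. edge_dist (- \<alpha>) x = 0}"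
  proof safe
    fix s show "edge_dist (- \<alpha>) (s *\<^sub>R dir \<alpha>) = 0" using edge_dist_combo(2)[of \<alpha> s 0] by simp
  next
    fix x assume "edge_dist (- \<alpha>) x = 0"
    then have "x = (edge_dist \<alpha> x / sin (2*\<alpha>)) *\<^sub>R dir \<alpha>" using combo_of_edge_dist[of \<alpha> x] s2 by simp
    then show "x \<in> range (\<lambda>s. s *\<^sub>R dir \<alpha>)" by (rule range_eqI)
  qed
  define A1 where "A1 = A \<inter> range (\<lambda>s. s *\<^sub>R dir \<alpha>)"
  define A2 where "A2 = A - range (\<lambda>s. s *\<^sub>R dir \<alpha>)"
  have "closed {x. edge_dist (- \<alpha>) x = 0}" by (intro closed_Collect_eq continuous_intros)
  then have A12: "A1 \<in> sets borel" "A2 \<in> sets borel" using A(1) by (auto simp: A1_def A2_def ray)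
  have A2sub: "A2 \<subseteq> range (\<lambda>s. s *\<^sub>R dir (- \<alpha>))"
    using A(2) unfolding frontier_sector[OF a] A2_def by blast
  have pneg: "s *\<^sub>R dir \<alpha> \<in> ?F \<longleftrightarrow> s \<ge> 0" for s
  proof
    assume "s *\<^sub>R dir \<alpha> \<in> ?F"
    then obtain r where "r \<ge> 0" "s *\<^sub>R dir \<alpha> = r *\<^sub>R dir \<alpha> \<or> s *\<^sub>R dir \<alpha> = r *\<^sub>R dir (- \<alpha>)"
      unfolding frontier_sector[OF a] by auto
    moreover have "cos \<alpha> > 0" using a by (intro cos_gt_zero) auto
    ultimately show "s \<ge> 0" by (auto simp: vec2_eq_iff)
  qed (auto simp: frontier_sector[OF a])
  have qneg: "s *\<^sub>R dir (- \<alpha>) \<in> ?F \<longleftrightarrow> s \<ge> 0" for s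
  proof
    assume "s *\<^sub>R dir (- \<alpha>) \<in> ?F"
    then obtain r where "r \<ge> 0" "s *\<^sub>R dir (- \<alpha>) = r *\<^sub>R dir \<alpha> \<or> s *\<^sub>R dir (- \<alpha>) = r *\<^sub>R dir (- \<alpha>)"
      unfolding frontier_sector[OF a] by auto
    moreover have "cos \<alpha> > 0" using a by (intro cos_gt_zero) auto
    ultimately show "s \<ge> 0" by (auto simp: vec2_eq_iff)
  qed (auto simp: frontier_sector[OF a])
  have qray: "s *\<^sub>R dir (- \<alpha>) \<in> range (\<lambda>s. s *\<^sub>R dir \<alpha>) \<longleftrightarrow> s = 0" for s
    unfolding ray using edge_dist_combo(2)[of \<alpha> 0 s] s2 by auto
  have m1: "{s. s *\<^sub>R dir \<alpha> \<in> A1} = boundary_param \<alpha> -` A \<inter> {0..}"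
  proof (intro set_eqI iffI)
    fix s assume "s \<in> {s. s *\<^sub>R dir \<alpha> \<in> A1}"
    then have "s *\<^sub>R dir \<alpha> \<in> A" by (simp add: A1_def)
    then show "s \<in> boundary_param \<alpha> -` A \<inter> {0..}" using A(2) pneg[of s] by (auto simp: boundary_param_def)
  next
    fix s assume "s \<in> boundary_param \<alpha> -` A \<inter> {0..}"
    then show "s \<in> {s. s *\<^sub>R dir \<alpha> \<in> A1}" by (auto simp: A1_def boundary_param_def)
  qed
  have m2: "{s. s *\<^sub>R dir (- \<alpha>) \<in> A2} = uminus -` (boundary_param \<alpha> -` A \<inter> {..<0})"
  proof (intro set_eqI iffI)
    fix s assume "s \<in> {s. s *\<^sub>R dir (- \<alpha>) \<in> A2}"
    then have "s *\<^sub>R dir (- \<alpha>) \<in> A" "s \<noteq> 0" using qray[of s] by (auto simp: A2_def)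
    moreover from this have "s > 0" using A(2) qneg[of s] by auto
    ultimately show "s \<in> uminus -` (boundary_param \<alpha> -` A \<inter> {..<0})" by (auto simp: boundary_param_def)
  next
    fix s assume "s \<in> uminus -` (boundary_param \<alpha> -` A \<inter> {..<0})"
    then have "s > 0" "s *\<^sub>R dir (- \<alpha>) \<in> A" by (auto simp: boundary_param_def)
    then show "s \<in> {s. s *\<^sub>R dir (- \<alpha>) \<in> A2}" using qray[of s] by (auto simp: A2_def)
  qed
  have pm: "boundary_param \<alpha> -` A \<in> sets borel"
    using measurable_sets[OF boundary_param_measurable A(1)] by simp
  have "emeasure (bdry_measure (sector \<alpha>)) A = emeasure hausdorff1 A"
    unfolding bdry_measure_def using A F by (intro emeasure_restrict_space) auto
  also have "\<dots> = emeasure hausdorff1 (A1 \<union> A2)"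
    by (rule arg_cong[of A]) (auto simp: A1_def A2_def)
  also have "\<dots> = emeasure hausdorff1 A1 + emeasure hausdorff1 A2"
    using A12 by (intro plus_emeasure[symmetric]) (auto simp: A1_def A2_def)
  also have "emeasure hausdorff1 A1 = emeasure lborel (boundary_param \<alpha> -` A \<inter> {0..})"
    unfolding m1[symmetric] by (intro emeasure_hausdorff1_line norm_dir A12) (auto simp: A1_def)
  also have "emeasure hausdorff1 A2 = emeasure lborel (uminus -` (boundary_param \<alpha> -` A \<inter> {..<0}))"
    unfolding m2[symmetric] by (intro emeasure_hausdorff1_line norm_dir A12 A2sub)
  also have "\<dots> = emeasure (distr lborel borel uminus) (boundary_param \<alpha> -` A \<inter> {..<0})"
    using pm by (subst emeasure_distr) auto
  also have "\<dots> = emeasure lborel (boundary_param \<alpha> -` A \<inter> {..<0})" by (simp add: lborel_distr_uminus)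
  also have "emeasure lborel (boundary_param \<alpha> -` A \<inter> {0..}) + emeasure lborel (boundary_param \<alpha> -` A \<inter> {..<0})
     = emeasure lborel ((boundary_param \<alpha> -` A \<inter> {0..}) \<union> (boundary_param \<alpha> -` A \<inter> {..<0}))"
    using pm by (intro plus_emeasure) auto
  also have "(boundary_param \<alpha> -` A \<inter> {0..}) \<union> (boundary_param \<alpha> -` A \<inter> {..<0}) = boundary_param \<alpha> -` A" by auto
  also have "emeasure lborel (boundary_param \<alpha> -` A)
     = emeasure (distr lborel (restrict_space borel ?F) (boundary_param \<alpha>)) A"
  proof (subst emeasure_distr)
    show "boundary_param \<alpha> \<in> lborel \<rightarrow>\<^sub>M restrict_space borel ?F"
      by (intro measurable_restrict_space2) (auto simp: boundary_param_in_frontier[OF a])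
  qed (use A' in auto)
  finally show "emeasure (bdry_measure (sector \<alpha>)) A = emeasure (distr lborel (restrict_space borel ?F) (boundary_param \<alpha>)) A" .
qed

lemma boundary_param_measurable_frontier:
  assumes a: "0 < \<alpha>" "\<alpha> < pi/2"
  shows "boundary_param \<alpha> \<in> lborel \<rightarrow>\<^sub>M restrict_space borel (frontier (sector \<alpha>))"
  by (intro measurable_restrict_space2) (auto simp: boundary_param_in_frontier[OF a])

lemma borel_measurable_bdry:
  "f \<in> borel_measurable borel \<Longrightarrow> f \<in> borel_measurable (bdry_measure U)"
  unfolding bdry_measure_def by (intro measurable_restrict_space1) (simp cong: measurable_cong_sets)

lemma integral_bdry:
  fixes f :: "real^2 \<Rightarrow> 'b::{banach,second_countable_topology}"
  assumes a: "0 < \<alpha>" "\<alpha> < pi/2" and f: "f \<in> borel_measurable borel"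
  shows "(\<integral>x. f x \<partial>bdry_measure (sector \<alpha>)) = (\<integral>s. f (boundary_param \<alpha> s) \<partial>lborel)"
    and "integrable (bdry_measure (sector \<alpha>)) f \<longleftrightarrow> integrable lborel (\<lambda>s. f (boundary_param \<alpha> s))"
proof -
  have "f \<in> borel_measurable (restrict_space borel (frontier (sector \<alpha>)))"
    using f by (rule measurable_restrict_space1)
  then show "(\<integral>x. f x \<partial>bdry_measure (sector \<alpha>)) = (\<integral>s. f (boundary_param \<alpha> s) \<partial>lborel)"
    and "integrable (bdry_measure (sector \<alpha>)) f \<longleftrightarrow> integrable lborel (\<lambda>s. f (boundary_param \<alpha> s))"
    unfolding bdry_measure_eq[OF a]
    by (auto intro!: integral_distr integrable_distr_eq boundary_param_measurable_frontier[OF a])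
qed

subsection \<open>Integration in the coordinates along the two edges\<close>

lemma Basis_vec2: "(Basis :: (real^2) set) = {axis 1 1, axis 2 1}"
  by (auto simp: Basis_vec_def UNIV_2)

lemma axis12_neq: "(axis 1 1 :: real^2) \<noteq> axis 2 1"
  by (simp add: axis_eq_axis)

lemma inner_axis2: "(x::real^2) \<bullet> axis i 1 = x $ i"
  by (simp add: inner_axis)

lemma vec2_measurable: "(\<lambda>z. vector [fst z, snd z] :: real^2) \<in> borel_measurable borel"
proof -
  have "(\<lambda>z. vector [fst z, snd z] :: real^2) = (\<lambda>z. fst z *\<^sub>R axis 1 1 + snd z *\<^sub>R axis 2 1)"
    by (auto simp: vec2_eq_iff axis_def)
  then show ?thesis by (auto intro!: borel_measurable_continuous_onI continuous_intros)
qed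

text \<open>Transfers integrals over the plane to integrals over pairs, to which Tonelli's theorem applies.\<close>
lemma lborel_vec2: "(lborel :: (real^2) measure) = distr lborel borel (\<lambda>z. vector [fst z, snd z])"
proof (rule lborel_eqI)
  fix l u :: "real^2" assume le: "\<And>b. b \<in> Basis \<Longrightarrow> l \<bullet> b \<le> u \<bullet> b"
  have le1: "l$1 \<le> u$1" and le2: "l$2 \<le> u$2"
    using le[of "axis 1 1"] le[of "axis 2 1"] by (auto simp: Basis_vec2 inner_axis2)
  have pre: "(\<lambda>z. vector [fst z, snd z]) -` box l u = box (l$1, l$2) (u$1, u$2)"
    by (auto simp: box_def Basis_vec2 inner_axis2 Basis_prod_def)
  have "emeasure (distr lborel borel (\<lambda>z. vector [fst z, snd z])) (box l u) = emeasure lborel (box (l$1, l$2) (u$1, u$2))"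
    using vec2_measurable by (subst emeasure_distr) (auto simp: pre)
  also have "box (l$1, l$2) (u$1, u$2) = {l$1<..<u$1} \<times> {l$2<..<u$2}"
    by (auto simp: box_def Basis_prod_def)
  also have "emeasure lborel ({l$1<..<u$1} \<times> {l$2<..<u$2}) = ennreal ((u$1 - l$1) * (u$2 - l$2))"
    unfolding lborel_prod[symmetric] using le1 le2
    by (subst lborel.emeasure_pair_measure_Times) (auto simp: ennreal_mult)
  also have "(u$1 - l$1) * (u$2 - l$2) = (\<Prod>b\<in>Basis. (u - l) \<bullet> b)"
    using axis12_neq by (simp add: Basis_vec2 inner_axis2)
  finally show "emeasure (distr lborel borel (\<lambda>z. vector [fst z, snd z])) (box l u) = ennreal (\<Prod>b\<in>Basis. (u - l) \<bullet> b)" .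
qed simp

definition edge_coords :: "real \<Rightarrow> real \<times> real \<Rightarrow> real^2" where
  "edge_coords \<alpha> z = fst z *\<^sub>R dir \<alpha> + snd z *\<^sub>R dir (- \<alpha>)"

lemma edge_coords_measurable [measurable]: "edge_coords \<alpha> \<in> borel_measurable borel"
  unfolding edge_coords_def[abs_def] by (intro borel_measurable_continuous_onI continuous_intros)

text \<open>Substituting \<open>s\<close> by \<open>s - t\<close> makes the first coordinate of \<open>s dir \<alpha> + t dir (-\<alpha>)\<close> independent of \<open>t\<close>;
  after exchanging the order of integration both variables are only rescaled.\<close>
lemma nn_integral_edge_coords:
  assumes c: "cos \<alpha> \<noteq> 0" and s: "sin \<alpha> \<noteq> 0" and F: "F \<in> borel_measurable borel"
  shows "(\<integral>\<^sup>+x. F x \<partial>lborel) = ennreal \<bar>sin (2*\<alpha>)\<bar> * (\<integral>\<^sup>+z. F (edge_coords \<alpha> z) \<partial>lborel)"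
proof -
  define G where "G x y = F (vector [x, y] :: real^2)" for x y
  have [measurable]: "F \<in> borel_measurable borel" by fact
  have vm: "(\<lambda>z. vector [fst z, snd z] :: real^2) \<in> borel_measurable (borel \<Otimes>\<^sub>M borel)"
    using vec2_measurable by (simp add: borel_prod)
  have Gm: "(\<lambda>z. G (fst z) (snd z)) \<in> borel_measurable (borel \<Otimes>\<^sub>M borel)"
    unfolding G_def using measurable_compose[OF vm F] .
  have [measurable]: "(\<lambda>w. G (f w) (g w)) \<in> borel_measurable M" if "f \<in> borel_measurable M" "g \<in> borel_measurable M" for f g and M :: "'z measure"
    using measurable_compose[OF measurable_Pair[OF that] Gm] by simp
  have e: "edge_coords \<alpha> (s, t) = vector [(s + t) * cos \<alpha>, (s - t) * sin \<alpha>]" for s t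
    by (simp add: edge_coords_def vec2_eq_iff algebra_simps)
  have Gm2: "(\<lambda>(s, t). G ((s + t) * cos \<alpha>) ((s - t) * sin \<alpha>)) \<in> borel_measurable (lborel \<Otimes>\<^sub>M lborel)"
    unfolding case_prod_unfold by (intro measurable_compose[OF measurable_Pair Gm, simplified]) measurable
  have Gm3: "(\<lambda>(s, t). G (s * cos \<alpha>) ((s - 2 * t) * sin \<alpha>)) \<in> borel_measurable (lborel \<Otimes>\<^sub>M lborel)"
    unfolding case_prod_unfold by (intro measurable_compose[OF measurable_Pair Gm, simplified]) measurable
  have Gm1: "(\<lambda>(x, y). G x y) \<in> borel_measurable (lborel \<Otimes>\<^sub>M lborel)"
    using Gm by (simp add: case_prod_unfold cong: measurable_cong_sets)
  have "(\<integral>\<^sup>+z. F (edge_coords \<alpha> z) \<partial>lborel) = (\<integral>\<^sup>+z. (case z of (s, t) \<Rightarrow> G ((s + t) * cos \<alpha>) ((s - t) * sin \<alpha>)) \<partial>(lborel \<Otimes>\<^sub>M lborel))"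
    unfolding lborel_prod by (intro nn_integral_cong) (auto simp: e G_def)
  also have "\<dots> = (\<integral>\<^sup>+t. \<integral>\<^sup>+s. G ((s + t) * cos \<alpha>) ((s - t) * sin \<alpha>) \<partial>lborel \<partial>lborel)"
    using lborel_pair.nn_integral_snd[OF Gm2] by simp
  also have "\<dots> = (\<integral>\<^sup>+t. \<integral>\<^sup>+s. G (s * cos \<alpha>) ((s - 2 * t) * sin \<alpha>) \<partial>lborel \<partial>lborel)"
  proof (rule nn_integral_cong)
    fix t :: real
    have "(\<integral>\<^sup>+s. G ((s + t) * cos \<alpha>) ((s - t) * sin \<alpha>) \<partial>lborel)
        = ennreal \<bar>1\<bar> * (\<integral>\<^sup>+s. G ((- t + 1 * s + t) * cos \<alpha>) ((- t + 1 * s - t) * sin \<alpha>) \<partial>lborel)"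
      by (rule nn_integral_real_affine) auto
    then show "(\<integral>\<^sup>+s. G ((s + t) * cos \<alpha>) ((s - t) * sin \<alpha>) \<partial>lborel)
        = (\<integral>\<^sup>+s. G (s * cos \<alpha>) ((s - 2 * t) * sin \<alpha>) \<partial>lborel)" by simp
  qed
  also have "\<dots> = (\<integral>\<^sup>+s. \<integral>\<^sup>+t. G (s * cos \<alpha>) ((s - 2 * t) * sin \<alpha>) \<partial>lborel \<partial>lborel)"
    using lborel_pair.Fubini'[OF Gm3] by simp
  finally have T: "(\<integral>\<^sup>+z. F (edge_coords \<alpha> z) \<partial>lborel) = (\<integral>\<^sup>+s. \<integral>\<^sup>+t. G (s * cos \<alpha>) ((s - 2 * t) * sin \<alpha>) \<partial>lborel \<partial>lborel)" .
  have inner: "(\<integral>\<^sup>+y. G (s * cos \<alpha>) y \<partial>lborel)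
      = ennreal \<bar>2 * sin \<alpha>\<bar> * (\<integral>\<^sup>+t. G (s * cos \<alpha>) ((s - 2 * t) * sin \<alpha>) \<partial>lborel)" for s
  proof -
    have "(\<integral>\<^sup>+y. G (s * cos \<alpha>) y \<partial>lborel)
      = ennreal \<bar>- 2 * sin \<alpha>\<bar> * (\<integral>\<^sup>+t. G (s * cos \<alpha>) (s * sin \<alpha> + (- 2 * sin \<alpha>) * t) \<partial>lborel)"
      using s by (intro nn_integral_real_affine) auto
    then show ?thesis by (simp add: algebra_simps)
  qed
  have "(\<integral>\<^sup>+x. F x \<partial>lborel) = (\<integral>\<^sup>+z. (case z of (x, y) \<Rightarrow> G x y) \<partial>(lborel \<Otimes>\<^sub>M lborel))"
    unfolding lborel_prod using vec2_measurable F
    by (subst lborel_vec2, subst nn_integral_distr) (auto simp: G_def case_prod_unfold)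
  also have "\<dots> = (\<integral>\<^sup>+x. \<integral>\<^sup>+y. G x y \<partial>lborel \<partial>lborel)"
    using lborel.nn_integral_fst[OF Gm1] by simp
  also have "\<dots> = ennreal \<bar>cos \<alpha>\<bar> * (\<integral>\<^sup>+s. \<integral>\<^sup>+y. G (0 + cos \<alpha> * s) y \<partial>lborel \<partial>lborel)"
    using c by (intro nn_integral_real_affine) measurable
  also have "\<dots> = ennreal \<bar>cos \<alpha>\<bar> * (\<integral>\<^sup>+s. ennreal \<bar>2 * sin \<alpha>\<bar> * (\<integral>\<^sup>+t. G (s * cos \<alpha>) ((s - 2 * t) * sin \<alpha>) \<partial>lborel) \<partial>lborel)"
    using inner by (simp add: mult.commute)
  also have "\<dots> = ennreal \<bar>cos \<alpha>\<bar> * (ennreal \<bar>2 * sin \<alpha>\<bar> * (\<integral>\<^sup>+s. \<integral>\<^sup>+t. G (s * cos \<alpha>) ((s - 2 * t) * sin \<alpha>) \<partial>lborel \<partial>lborel))"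
    by (subst nn_integral_cmult) (auto intro!: lborel.borel_measurable_nn_integral Gm3)
  also have "\<dots> = ennreal \<bar>sin (2*\<alpha>)\<bar> * (\<integral>\<^sup>+z. F (edge_coords \<alpha> z) \<partial>lborel)"
    unfolding T sin_double by (simp add: abs_mult ennreal_mult mult_ac)
  finally show ?thesis .
qed

lemma lborel_edge_coords:
  assumes c: "cos \<alpha> \<noteq> 0" and s: "sin \<alpha> \<noteq> 0"
  shows "lborel = density (distr lborel borel (edge_coords \<alpha>)) (\<lambda>_. ennreal \<bar>sin (2*\<alpha>)\<bar>)"
proof (rule measure_eqI)
  fix A :: "(real^2) set" assume "A \<in> sets lborel"
  then have A: "A \<in> sets borel" by simp
  have "emeasure lborel A = (\<integral>\<^sup>+x. indicator A x \<partial>lborel)" using A by simp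
  also have "\<dots> = ennreal \<bar>sin (2*\<alpha>)\<bar> * (\<integral>\<^sup>+z. indicator A (edge_coords \<alpha> z) \<partial>lborel)"
    using A by (intro nn_integral_edge_coords c s) simp
  also have "\<dots> = emeasure (density (distr lborel borel (edge_coords \<alpha>)) (\<lambda>_. ennreal \<bar>sin (2*\<alpha>)\<bar>)) A"
    using A nn_integral_distr[of "edge_coords \<alpha>" lborel borel "indicator A :: _ \<Rightarrow> ennreal"]
    by (simp add: emeasure_density nn_integral_cmult)
  finally show "emeasure lborel A = emeasure (density (distr lborel borel (edge_coords \<alpha>)) (\<lambda>_. ennreal \<bar>sin (2*\<alpha>)\<bar>)) A" .
qed simp

lemma integral_edge_coords:
  fixes F :: "real^2 \<Rightarrow> complex"
  assumes c: "cos \<alpha> \<noteq> 0" and s: "sin \<alpha> \<noteq> 0" and F: "F \<in> borel_measurable borel"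
  shows "(\<integral>x. F x \<partial>lborel) = \<bar>sin (2*\<alpha>)\<bar> *\<^sub>R (\<integral>z. F (edge_coords \<alpha> z) \<partial>lborel)"
proof -
  have "(\<integral>x. F x \<partial>lborel) = (\<integral>x. \<bar>sin (2*\<alpha>)\<bar> *\<^sub>R F x \<partial>distr lborel borel (edge_coords \<alpha>))"
    using F by (subst lborel_edge_coords[OF c s], subst integral_density) auto
  also have "\<dots> = (\<integral>z. \<bar>sin (2*\<alpha>)\<bar> *\<^sub>R F (edge_coords \<alpha> z) \<partial>lborel)"
    using F by (intro integral_distr) auto
  finally show ?thesis by simp
qed

lemma integral_lebesgue_on:
  fixes f :: "'a::euclidean_space \<Rightarrow> 'b::euclidean_space"
  assumes "U \<in> sets borel" "f \<in> borel_measurable borel"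
  shows "(\<integral>x. f x \<partial>lebesgue_on U) = (\<integral>x. indicator U x *\<^sub>R f x \<partial>lborel)"
    and "integrable (lebesgue_on U) f \<longleftrightarrow> integrable lborel (\<lambda>x. indicator U x *\<^sub>R f x)"
proof -
  have m: "(\<lambda>x. indicator U x *\<^sub>R f x) \<in> borel_measurable lborel"
    using assms by (intro borel_measurable_scaleR borel_measurable_indicator) auto
  show "(\<integral>x. f x \<partial>lebesgue_on U) = (\<integral>x. indicator U x *\<^sub>R f x \<partial>lborel)"
    using assms m by (simp add: integral_restrict_space integral_completion)
  show "integrable (lebesgue_on U) f \<longleftrightarrow> integrable lborel (\<lambda>x. indicator U x *\<^sub>R f x)"
    using assms m by (simp add: integrable_restrict_space integrable_completion)
qed

lemma sector_borel: assumes "0 < \<alpha>" "\<alpha> < pi/2" shows "sector \<alpha> \<in> sets borel"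
  using open_sector[OF assms] by simp

text \<open>Divergence theorem for the constant direction of one edge: along every line parallel to that edge
  the fundamental theorem of calculus leaves only the value on the other edge.\<close>
lemma integral_edge_derivative:
  fixes h :: "real^2 \<Rightarrow> complex"
  assumes a: "0 < \<bar>\<alpha>\<bar>" "\<bar>\<alpha>\<bar> < pi/2"
    and d: "\<And>x. (h has_derivative D x) (at x)"
    and cont: "continuous_on UNIV (\<lambda>x. D x (dir \<alpha>))"
    and supp: "\<And>x. R < norm x \<Longrightarrow> h x = 0"
  shows "(\<integral>x. D x (dir \<alpha>) \<partial>lebesgue_on (sector \<bar>\<alpha>\<bar>)) =
    - (\<bar>sin (2*\<alpha>)\<bar> *\<^sub>R (\<integral>t. indicator {0<..} t *\<^sub>R h (t *\<^sub>R dir (- \<alpha>)) \<partial>lborel))"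
proof -
  let ?U = "sector \<bar>\<alpha>\<bar>"
  have s2: "\<bar>sin (2*\<alpha>)\<bar> > 0" using sin_double_pos[OF a] by (cases "\<alpha> \<ge> 0") auto
  then have cs: "cos \<alpha> \<noteq> 0" "sin \<alpha> \<noteq> 0" by (auto simp: sin_double)
  have Dm: "(\<lambda>x. D x (dir \<alpha>)) \<in> borel_measurable borel" using cont by (rule borel_measurable_continuous_onI)
  have Um: "?U \<in> sets borel" by (rule sector_borel[OF a])
  have Dsupp: "D x v = 0" if "R < norm x" for x v
  proof -
    have "(h has_derivative (\<lambda>_. 0)) (at x)"
      by (rule has_derivative_transform_within_open[of "\<lambda>_. 0" _ _ _ "{x. R < norm x}"])
         (use that supp in \<open>auto intro!: open_Collect_less continuous_intros\<close>)
    then show ?thesis using has_derivative_unique[OF d[of x]] by metis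
  qed
  \<comment> \<open>Beyond \<open>L\<close> in either coordinate, \<open>h\<close> vanishes.\<close>
  define L where "L = 2 * (\<bar>R\<bar> + 1) / \<bar>sin (2*\<alpha>)\<bar>"
  have L: "L > 0" using s2 by (simp add: L_def)
  have far: "R < norm (edge_coords \<alpha> z)" if "L \<le> \<bar>fst z\<bar> \<or> L \<le> \<bar>snd z\<bar>" for z
  proof -
    have e: "edge_dist \<alpha> (edge_coords \<alpha> z) = fst z * sin (2*\<alpha>)" "edge_dist (- \<alpha>) (edge_coords \<alpha> z) = - (snd z * sin (2*\<alpha>))"
      by (simp_all add: edge_coords_def edge_dist_combo)
    have "\<bar>fst z\<bar> * \<bar>sin (2*\<alpha>)\<bar> \<le> norm (edge_coords \<alpha> z)" "\<bar>snd z\<bar> * \<bar>sin (2*\<alpha>)\<bar> \<le> norm (edge_coords \<alpha> z)"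
      using edge_dist_abs_le[of \<alpha> "edge_coords \<alpha> z"] edge_dist_abs_le[of "- \<alpha>" "edge_coords \<alpha> z"]
      unfolding e by (simp_all add: abs_mult)
    moreover have "2 * (\<bar>R\<bar> + 1) \<le> \<bar>fst z\<bar> * \<bar>sin (2*\<alpha>)\<bar> \<or> 2 * (\<bar>R\<bar> + 1) \<le> \<bar>snd z\<bar> * \<bar>sin (2*\<alpha>)\<bar>"
      using that s2 by (auto simp: L_def pos_divide_le_eq)
    ultimately have "2 * (\<bar>R\<bar> + 1) \<le> norm (edge_coords \<alpha> z)" by (metis order_trans)
    moreover have "R \<le> \<bar>R\<bar>" "0 \<le> \<bar>R\<bar>" by simp_all
    ultimately show ?thesis unfolding distrib_left by argo
  qed
  have inU: "edge_coords \<alpha> z \<in> ?U \<longleftrightarrow> fst z > 0 \<and> snd z > 0" for z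
    using sector_combo_iff[OF a, of "fst z" "snd z"] sector_combo_iff[OF a, of "snd z" "fst z"]
    by (cases "\<alpha> \<ge> 0") (auto simp: edge_coords_def add.commute)
  obtain B where B: "\<And>x. norm (D x (dir \<alpha>)) \<le> B"
  proof -
    have "compact ((\<lambda>x. D x (dir \<alpha>)) ` cball 0 (max R 0))"
      by (intro compact_continuous_image continuous_on_subset[OF cont]) auto
    then obtain B where B: "\<forall>y\<in>(\<lambda>x. D x (dir \<alpha>)) ` cball 0 (max R 0). norm y \<le> B"
      using compact_imp_bounded bounded_iff by metis
    have "norm (D x (dir \<alpha>)) \<le> max B 0" for x
      using B Dsupp[of x] by (cases "norm x \<le> max R 0") force+
    then show ?thesis using that by blast
  qed
  define g where "g z = indicator ?U (edge_coords \<alpha> z) *\<^sub>R D (edge_coords \<alpha> z) (dir \<alpha>)" for z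
  have gm: "g \<in> borel_measurable borel"
    unfolding g_def[abs_def]
    using measurable_compose[OF edge_coords_measurable[of \<alpha>], of "\<lambda>x. indicator ?U x *\<^sub>R D x (dir \<alpha>)" borel] Um Dm
    by (simp add: borel_measurable_scaleR)
  have gi: "integrable lborel g"
  proof (rule Bochner_Integration.integrable_bound[where f="\<lambda>z. indicator (cbox (-L, -L) (L, L)) z *\<^sub>R B"])
    show "integrable lborel (\<lambda>z. indicator (cbox (-L, -L) (L, L)) z *\<^sub>R B :: real)"
      using emeasure_lborel_cbox_finite[of "(-L, -L)" "(L, L)"]
      by (intro integrable_scaleR_left integrable_real_indicator impI) (simp_all add: infinity_ennreal_def)
    show "AE z in lborel. norm (g z) \<le> norm (indicator (cbox (-L, -L) (L, L)) z *\<^sub>R B)"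
    proof (rule AE_I2)
      fix z :: "real \<times> real"
      show "norm (g z) \<le> norm (indicator (cbox (-L, -L) (L, L)) z *\<^sub>R B)"
      proof (cases "z \<in> cbox (-L, -L) (L, L)")
        case True
        then show ?thesis using B[of "edge_coords \<alpha> z"] norm_ge_zero[of "D 0 (dir \<alpha>)"] B[of 0]
          by (auto simp: g_def indicator_def)
      next
        case False
        then have "L \<le> \<bar>fst z\<bar> \<or> L \<le> \<bar>snd z\<bar>" by (cases z) (auto simp: cbox_Pair_eq mem_Times_iff)
        then have "g z = 0" using far[of z] by (simp add: g_def Dsupp)
        then show ?thesis by simp
      qed
    qed
  qed (use gm in auto)
  have inner: "(\<integral>s. g (s, t) \<partial>lborel) = - (indicator {0<..} t *\<^sub>R h (t *\<^sub>R dir (- \<alpha>)))" for t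
  proof (cases "t > 0")
    case False
    then have "g (s, t) = 0" for s using inU[of "(s, t)"] by (simp add: g_def)
    then show ?thesis using False by simp
  next
    case True
    let ?c = "\<lambda>s. s *\<^sub>R dir \<alpha> + t *\<^sub>R dir (- \<alpha>)"
    have "(\<integral>s. g (s, t) \<partial>lborel) = (\<integral>s. indicator {0..L} s *\<^sub>R D (?c s) (dir \<alpha>) \<partial>lborel)"
    proof (rule integral_cong_AE)
      show "(\<lambda>s. g (s, t)) \<in> borel_measurable lborel"
        using measurable_compose[of "\<lambda>s. (s, t)" borel borel g borel] gm
        by (simp add: borel_prod[symmetric])
      show "(\<lambda>s. indicator {0..L} s *\<^sub>R D (?c s) (dir \<alpha>)) \<in> borel_measurable lborel"
        by (intro borel_measurable_scaleR borel_measurable_indicator)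
           (auto intro!: borel_measurable_continuous_onI continuous_on_compose2[OF cont] continuous_intros)
      show "AE s in lborel. g (s, t) = indicator {0..L} s *\<^sub>R D (?c s) (dir \<alpha>)"
        using AE_lborel_singleton[of 0]
      proof eventually_elim
        fix s :: real assume "s \<noteq> 0"
        then show "g (s, t) = indicator {0..L} s *\<^sub>R D (?c s) (dir \<alpha>)"
          using inU[of "(s, t)"] True far[of "(s, t)"] Dsupp[of "?c s"]
          by (cases "s \<le> L"; cases "s > 0") (auto simp: g_def edge_coords_def)
      qed
    qed
    also have "\<dots> = h (?c L) - h (?c 0)"
    proof (rule integral_FTC_atLeastAtMost)
      show "0 \<le> L" using L by simp
      show "continuous_on {0..L} (\<lambda>s. D (?c s) (dir \<alpha>))"
        by (intro continuous_on_compose2[OF cont] continuous_intros) auto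
      show "((\<lambda>s. h (?c s)) has_vector_derivative D (?c s) (dir \<alpha>)) (at s within {0..L})" for s
      proof -
        have "linear (D (?c s))" using d by (rule has_derivative_linear)
        moreover have "(?c has_derivative (\<lambda>r. r *\<^sub>R dir \<alpha>)) (at s within {0..L})"
          by (auto intro!: derivative_eq_intros)
        ultimately have "((\<lambda>s. h (?c s)) has_derivative (\<lambda>r. r *\<^sub>R D (?c s) (dir \<alpha>))) (at s within {0..L})"
          using has_derivative_compose[of ?c "\<lambda>r. r *\<^sub>R dir \<alpha>" s "{0..L}" h "D (?c s)", OF _ d]
          by (simp add: linear_cmul)
        then show ?thesis by (simp add: has_vector_derivative_def)
      qed
    qed
    also have "h (?c L) = 0" using far[of "(L, t)"] L by (intro supp) (simp add: edge_coords_def)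
    finally show ?thesis using True by simp
  qed
  have "(\<integral>x. D x (dir \<alpha>) \<partial>lebesgue_on ?U) = (\<integral>x. indicator ?U x *\<^sub>R D x (dir \<alpha>) \<partial>lborel)"
    by (rule integral_lebesgue_on[OF Um Dm])
  also have "\<dots> = \<bar>sin (2*\<alpha>)\<bar> *\<^sub>R (\<integral>z. g z \<partial>lborel)"
    unfolding g_def by (intro integral_edge_coords cs borel_measurable_scaleR borel_measurable_indicator Um Dm)
  also have "(\<integral>z. g z \<partial>lborel) = (\<integral>z. (case z of (s, t) \<Rightarrow> g (s, t)) \<partial>(lborel \<Otimes>\<^sub>M lborel))"
    by (simp add: lborel_prod)
  also have "\<dots> = (\<integral>t. \<integral>s. g (s, t) \<partial>lborel \<partial>lborel)"
    using gi by (intro lborel_pair.integral_snd[symmetric]) (simp add: lborel_prod)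
  also have "\<dots> = - (\<integral>t. indicator {0<..} t *\<^sub>R h (t *\<^sub>R dir (- \<alpha>)) \<partial>lborel)"
    by (simp add: inner)
  finally show ?thesis by simp
qed

section \<open>Mollification\<close>

lemma Cauchy_Schwarz_weighted:
  fixes g :: "'a \<Rightarrow> complex" and \<rho> :: "'a \<Rightarrow> real"
  assumes \<rho>: "integrable M \<rho>" "\<And>x. 0 \<le> \<rho> x" "(\<integral>x. \<rho> x \<partial>M) = 1"
    and g: "g \<in> borel_measurable M" "integrable M (\<lambda>x. (cmod (g x))\<^sup>2 * \<rho> x)"
  shows "(cmod (\<integral>x. g x * complex_of_real (\<rho> x) \<partial>M))\<^sup>2 \<le> (\<integral>x. (cmod (g x))\<^sup>2 * \<rho> x \<partial>M)"
proof -
  have [measurable]: "\<rho> \<in> borel_measurable M" "g \<in> borel_measurable M" using \<rho> g by auto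
  have sq: "complex_of_real (sqrt (\<rho> x)) * complex_of_real (sqrt (\<rho> x)) = complex_of_real (\<rho> x)" for x
    using \<rho>(2)[of x] by (simp flip: of_real_mult)
  have n1: "(cmod (g x * complex_of_real (sqrt (\<rho> x))))\<^sup>2 = (cmod (g x))\<^sup>2 * \<rho> x" for x
    using \<rho>(2)[of x] by (simp add: norm_mult power_mult_distrib)
  have n2: "(cmod (complex_of_real (sqrt (\<rho> x))))\<^sup>2 = \<rho> x" for x
    using \<rho>(2)[of x] by simp
  have L1: "(\<lambda>x. g x * complex_of_real (sqrt (\<rho> x))) \<in> L2 M"
    unfolding L2_def mem_Collect_eq n1 using g by auto
  have L2': "(\<lambda>x. complex_of_real (sqrt (\<rho> x))) \<in> L2 M"
    unfolding L2_def mem_Collect_eq n2 using \<rho> by auto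
  have "(cmod (\<integral>x. g x * complex_of_real (\<rho> x) \<partial>M))\<^sup>2
    = (cmod (\<integral>x. (g x * complex_of_real (sqrt (\<rho> x))) * complex_of_real (sqrt (\<rho> x)) \<partial>M))\<^sup>2"
    by (simp add: mult.assoc sq)
  also have "\<dots> \<le> L2_normsq M (\<lambda>x. g x * complex_of_real (sqrt (\<rho> x))) * L2_normsq M (\<lambda>x. complex_of_real (sqrt (\<rho> x)))"
    by (rule L2_Cauchy_Schwarz[OF L1 L2'])
  also have "\<dots> = (\<integral>x. (cmod (g x))\<^sup>2 * \<rho> x \<partial>M)"
    unfolding L2_normsq_def n1 n2 \<rho>(3) by simp
  finally show ?thesis .
qed

lemma borel_imp_lebesgue_on: "f \<in> borel_measurable borel \<Longrightarrow> f \<in> borel_measurable (lebesgue_on S)"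
  by (intro measurable_restrict_space1 measurable_completion) auto

lemma indicator_cball_L2: "(\<lambda>x::'a::euclidean_space. complex_of_real (indicator (cball c R) x)) \<in> L2 lborel"
proof -
  have "integrable lborel (indicator (cball c R) :: 'a \<Rightarrow> real)"
    using emeasure_lborel_cball_finite[of c R] by (intro integrable_real_indicator) (auto simp: less_top)
  then have "integrable lborel (\<lambda>x. (cmod (complex_of_real (indicator (cball c R) x)))\<^sup>2)"
    by (rule Bochner_Integration.integrable_bound) (auto simp: indicator_def)
  moreover have "(\<lambda>x::'a. complex_of_real (indicator (cball c R) x)) \<in> borel_measurable lborel"
    by (rule borel_measurable_continuous_on[where f=complex_of_real])
       (auto intro: continuous_intros borel_measurable_indicator)
  ultimately show ?thesis by (simp add: L2_def)
qed

text \<open>A square integrable function is first truncated to a bounded function of bounded support. That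
  function is an almost everywhere limit of continuous functions, which may be taken bounded and
  supported in a slightly larger ball, so dominated convergence applies twice.\<close>
lemma L2_approx_continuous:
  fixes f :: "'a::euclidean_space \<Rightarrow> complex"
  assumes f: "f \<in> L2 lborel" and e: "e > 0"
  shows "\<exists>g R. continuous_on UNIV g \<and> (\<forall>x. R < norm x \<longrightarrow> g x = 0) \<and> L2_normsq lborel (\<lambda>x. f x - g x) < e"
proof -
  have [measurable]: "f \<in> borel_measurable borel" using L2_measurable[OF f] by simp
  define T where "T n x = (if norm x \<le> real n \<and> cmod (f x) \<le> real n then f x else 0)" for n x
  have Tm [measurable]: "T n \<in> borel_measurable borel" for n unfolding T_def by measurable
  have TL: "T n \<in> L2 lborel" for n
    by (rule L2_bound[OF _ L2_integrable_sq[OF f]]) (auto simp: T_def)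
  have l1: "(\<lambda>n. L2_normsq lborel (\<lambda>x. f x - T n x)) \<longlonglongrightarrow> 0"
  proof (rule L2_dominated_convergence[OF f, where C=1])
    show "AE x in lborel. (\<lambda>n. f x - T n x) \<longlonglongrightarrow> 0"
    proof (rule AE_I2)
      fix x
      obtain N where N: "max (norm x) (cmod (f x)) \<le> real N" using real_arch_simple by blast
      have "\<forall>\<^sub>F n in sequentially. f x - T n x = 0"
        by (rule eventually_sequentiallyI[of N]) (use N in \<open>auto simp: T_def\<close>)
      then show "(\<lambda>n. f x - T n x) \<longlonglongrightarrow> 0" by (rule tendsto_eventually)
    qed
  qed (auto simp: T_def)
  obtain n where n: "L2_normsq lborel (\<lambda>x. f x - T n x) < e/4"
    using eventually_happens'[OF sequentially_bot order_tendstoD(2)[OF l1, of "e/4"]] e by auto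
  define M where "M = real n"
  have M: "M \<ge> 0" by (simp add: M_def)
  have "T n measurable_on UNIV"
    unfolding measurable_on_iff_borel_measurable[OF sets.top, simplified] by (intro borel_imp_lebesgue_on Tm)
  then obtain N g where N: "negligible N" and g: "\<And>k. continuous_on UNIV (g k)"
    and lim: "\<And>x. x \<notin> N \<Longrightarrow> (\<lambda>k. g k x) \<longlonglongrightarrow> T n x"
    unfolding measurable_on_def by auto
  let ?P = "closest_point (cball (0::complex) M)"
  have P: "cmod (?P z) \<le> M" for z
    using closest_point_in_set[of "cball (0::complex) M" z] M by auto
  have Pc: "continuous_on UNIV ?P" by (rule continuous_on_closest_point) (use M in auto)
  define h where "h x = max 0 (min 1 (M + 1 - norm x))" for x :: 'a
  define G where "G k x = h x *\<^sub>R ?P (g k x)" for k x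
  have hc: "continuous_on UNIV h" unfolding h_def by (intro continuous_intros)
  have Gc: "continuous_on UNIV (G k)" for k unfolding G_def
    by (intro continuous_on_scaleR hc continuous_on_compose2[OF Pc g]) auto
  have Gsupp: "G k x = 0" if "M + 1 < norm x" for k x using that by (simp add: G_def h_def)
  have [measurable]: "G k \<in> borel_measurable borel" for k using Gc by (rule borel_measurable_continuous_onI)
  have l2: "(\<lambda>k. L2_normsq lborel (\<lambda>x. T n x - G k x)) \<longlonglongrightarrow> 0"
  proof (rule L2_dominated_convergence[OF indicator_cball_L2[of 0 "M+1"], where C="2*M"])
    fix k x
    have "cmod (G k x) \<le> 1 * M" unfolding G_def norm_scaleR by (rule mult_mono) (use P M in \<open>auto simp: h_def\<close>)
    moreover have "cmod (T n x) \<le> M" using M by (simp add: T_def M_def)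
    ultimately have "cmod (T n x - G k x) \<le> 2 * M" using norm_triangle_ineq4[of "T n x" "G k x"] by linarith
    moreover have "T n x - G k x = 0" if "M + 1 < norm x" using that Gsupp by (simp add: T_def M_def)
    ultimately show "cmod (T n x - G k x) \<le> 2 * M * cmod (complex_of_real (indicator (cball 0 (M+1)) x))"
      by (cases "norm x \<le> M + 1") auto
  next
    have "N \<in> null_sets lebesgue" using N by (simp add: negligible_iff_null_sets)
    then have "AE x in lborel. x \<notin> N" using AE_not_in[of N lebesgue] AE_completion_iff by blast
    then show "AE x in lborel. (\<lambda>k. T n x - G k x) \<longlonglongrightarrow> 0"
    proof eventually_elim
      fix x assume "x \<notin> N"
      have "?P (T n x) = T n x" using M by (intro closest_point_self) (simp add: T_def M_def)
      moreover have "isCont ?P (T n x)" using Pc by (simp add: continuous_on_eq_continuous_at)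
      ultimately have "(\<lambda>k. ?P (g k x)) \<longlonglongrightarrow> T n x"
        using isCont_tendsto_compose[OF _ lim[OF \<open>x \<notin> N\<close>], of ?P] by simp
      then have "(\<lambda>k. T n x - G k x) \<longlonglongrightarrow> T n x - h x *\<^sub>R T n x" unfolding G_def by (intro tendsto_intros)
      moreover have "h x *\<^sub>R T n x = T n x" by (auto simp: h_def T_def M_def)
      ultimately show "(\<lambda>k. T n x - G k x) \<longlonglongrightarrow> 0" by simp
    qed
  qed auto
  obtain k where k: "L2_normsq lborel (\<lambda>x. T n x - G k x) < e/4"
    using eventually_happens'[OF sequentially_bot order_tendstoD(2)[OF l2, of "e/4"]] e by auto
  have GL: "G k \<in> L2 lborel"
  proof (rule L2_bound[OF _ L2_integrable_sq[OF L2_cmult[OF indicator_cball_L2[of 0 "M+1"], of "complex_of_real M"]]])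
    fix x
    have "cmod (G k x) \<le> 1 * M" unfolding G_def norm_scaleR by (rule mult_mono) (use P M in \<open>auto simp: h_def\<close>)
    then have "cmod (G k x) \<le> cmod (complex_of_real M * complex_of_real (indicator (cball 0 (M+1)) x))"
      using Gsupp[of x k] M by (cases "norm x \<le> M + 1") auto
    then show "(cmod (G k x))\<^sup>2 \<le> (cmod (complex_of_real M * complex_of_real (indicator (cball 0 (M+1)) x)))\<^sup>2"
      by (intro power_mono) auto
  qed auto
  have "L2_normsq lborel (\<lambda>x. f x - G k x) < e"
    using L2_normsq_diff_triangle[OF f TL[of n] GL] n k by linarith
  then show ?thesis using Gc Gsupp by blast
qed

lemma lborel_integral_translate:
  fixes F :: "'a::euclidean_space \<Rightarrow> 'b::{banach,second_countable_topology}"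
  assumes "F \<in> borel_measurable borel"
  shows "(\<integral>x. F (x - y) \<partial>lborel) = (\<integral>x. F x \<partial>lborel)"
    and "integrable lborel (\<lambda>x. F (x - y)) \<longleftrightarrow> integrable lborel F"
proof -
  have d: "lborel = distr lborel borel (\<lambda>x. x - y)"
  proof -
    have "(\<lambda>x. x - y) = (+) (- y)" by auto
    then show ?thesis using lborel_distr_plus[of "- y"] by simp
  qed
  show "(\<integral>x. F (x - y) \<partial>lborel) = (\<integral>x. F x \<partial>lborel)"
    by (subst (2) d, subst integral_distr) (use assms in auto)
  show "integrable lborel (\<lambda>x. F (x - y)) \<longleftrightarrow> integrable lborel F"
    by (subst (2) d, subst integrable_distr_eq) (use assms in auto)
qed

lemma L2_translate:
  assumes "f \<in> L2 lborel"
  shows "(\<lambda>x. f (x - y)) \<in> L2 lborel" "L2_normsq lborel (\<lambda>x. f (x - y)) = L2_normsq lborel f"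
proof -
  have "(\<lambda>x. (cmod (f x))\<^sup>2) \<in> borel_measurable borel" using L2_measurable[OF assms] by simp
  from lborel_integral_translate[OF this, of y]
  show "(\<lambda>x. f (x - y)) \<in> L2 lborel" "L2_normsq lborel (\<lambda>x. f (x - y)) = L2_normsq lborel f"
    using assms by (auto simp: L2_def L2_normsq_def)
qed

text \<open>Uniform continuity settles continuous functions of bounded support; the general case follows by
  approximation, since translations preserve the norm.\<close>
lemma L2_translation_continuous:
  fixes f :: "'a::euclidean_space \<Rightarrow> complex"
  assumes f: "f \<in> L2 lborel" and e: "e > 0"
  shows "\<exists>d>0. \<forall>y. norm y < d \<longrightarrow> L2_normsq lborel (\<lambda>x. f (x - y) - f x) \<le> e"
proof -
  obtain g R where gc: "continuous_on UNIV g" and gs: "\<And>x. R < norm x \<Longrightarrow> g x = 0"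
    and fg: "L2_normsq lborel (\<lambda>x. f x - g x) < e/12"
    using L2_approx_continuous[OF f, of "e/12"] e by auto
  have gm: "g \<in> borel_measurable borel" using gc by (rule borel_measurable_continuous_onI)
  define V where "V = L2_normsq lborel (\<lambda>x::'a. complex_of_real (indicator (cball 0 (\<bar>R\<bar>+1)) x))"
  have V: "V \<ge> 0" by (simp add: V_def L2_normsq_nonneg)
  define \<eta> where "\<eta> = sqrt (e / (12 * (V + 1)))"
  have \<eta>: "\<eta> > 0" "\<eta>\<^sup>2 * V \<le> e/12" using e V by (auto simp: \<eta>_def field_simps)
  have "uniformly_continuous_on (cball 0 (\<bar>R\<bar> + 2)) g"
    using gc by (intro compact_uniformly_continuous continuous_on_subset[OF gc]) auto
  then obtain d where d: "d > 0" and ud: "\<And>x x'. x \<in> cball 0 (\<bar>R\<bar>+2) \<Longrightarrow> x' \<in> cball 0 (\<bar>R\<bar>+2) \<Longrightarrow> dist x' x < d \<Longrightarrow> dist (g x') (g x) < \<eta>"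
    unfolding uniformly_continuous_on_def using \<eta> by meson
  have gb: "cmod (g (x - y) - g x) \<le> \<eta> * cmod (complex_of_real (indicator (cball 0 (\<bar>R\<bar>+1)) x))" if y: "norm y < min d 1" for x y
  proof (cases "norm x \<le> \<bar>R\<bar> + 1")
    case True
    then have "norm (x - y) \<le> \<bar>R\<bar> + 2" using norm_triangle_ineq4[of x y] y by linarith
    then have "dist (g (x - y)) (g x) < \<eta>" using True y by (intro ud) (simp_all add: dist_norm norm_minus_commute)
    then show ?thesis using True by (simp add: dist_norm)
  next
    case False
    then have "R < norm x" "R < norm (x - y)" using norm_triangle_ineq2[of x y] y by linarith+
    then show ?thesis using gs \<eta> by simp
  qed
  have gL: "g \<in> L2 lborel"
  proof -
    obtain B where B: "\<And>x. cmod (g x) \<le> B"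
    proof -
      have "compact (g ` cball 0 (\<bar>R\<bar>))" by (intro compact_continuous_image continuous_on_subset[OF gc]) auto
      then obtain B where B: "\<forall>z\<in>g ` cball 0 \<bar>R\<bar>. norm z \<le> B" using compact_imp_bounded bounded_iff by metis
      have "cmod (g x) \<le> max B 0" for x using B gs[of x] by (cases "norm x \<le> \<bar>R\<bar>") force+
      then show ?thesis using that by blast
    qed
    have B0: "B \<ge> 0" using B[of 0] norm_ge_zero order_trans by blast
    show ?thesis
    proof (rule L2_bound[OF _ L2_integrable_sq[OF L2_cmult[OF indicator_cball_L2[of 0 "\<bar>R\<bar>+1"], of "complex_of_real B"]]])
      fix x
      have "cmod (g x) \<le> cmod (complex_of_real B * complex_of_real (indicator (cball 0 (\<bar>R\<bar>+1)) x))"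
        using gs[of x] B[of x] B0 by (cases "norm x \<le> \<bar>R\<bar> + 1") auto
      then show "(cmod (g x))\<^sup>2 \<le> (cmod (complex_of_real B * complex_of_real (indicator (cball 0 (\<bar>R\<bar>+1)) x)))\<^sup>2"
        by (intro power_mono) auto
    qed (use gm in auto)
  qed
  have "L2_normsq lborel (\<lambda>x. f (x - y) - f x) \<le> e" if y: "norm y < min d 1" for y
  proof -
    have gt: "L2_normsq lborel (\<lambda>x. g (x - y) - g x) \<le> e/12"
    proof -
      have "L2_normsq lborel (\<lambda>x. g (x - y) - g x) \<le> (\<integral>x. \<eta>\<^sup>2 * (cmod (complex_of_real (indicator (cball (0::'a) (\<bar>R\<bar>+1)) x)))\<^sup>2 \<partial>lborel)"
        unfolding L2_normsq_def
      proof (rule Bochner_Integration.integral_mono)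
        show "integrable lborel (\<lambda>x. (cmod (g (x - y) - g x))\<^sup>2)"
          using L2_diff[OF L2_translate(1)[OF gL] gL] by (rule L2_integrable_sq)
        show "integrable lborel (\<lambda>x. \<eta>\<^sup>2 * (cmod (complex_of_real (indicator (cball (0::'a) (\<bar>R\<bar>+1)) x)))\<^sup>2)"
          using L2_integrable_sq[OF indicator_cball_L2] by (intro integrable_mult_right)
        fix x
        show "(cmod (g (x - y) - g x))\<^sup>2 \<le> \<eta>\<^sup>2 * (cmod (complex_of_real (indicator (cball 0 (\<bar>R\<bar>+1)) x)))\<^sup>2"
          using power_mono[OF gb[OF y, of x], of 2] by (simp add: power_mult_distrib)
      qed
      also have "\<dots> = \<eta>\<^sup>2 * V" by (simp add: V_def L2_normsq_def)
      finally show ?thesis using \<eta> by simp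
    qed
    note t1 = L2_normsq_diff_triangle[OF L2_translate(1)[OF f] L2_translate(1)[OF gL] f, of y y]
    note t2 = L2_normsq_diff_triangle[OF L2_translate(1)[OF gL] gL f, of y]
    have "L2_normsq lborel (\<lambda>x. f (x - y) - g (x - y)) = L2_normsq lborel (\<lambda>x. f x - g x)"
      using L2_translate(2)[OF L2_diff[OF f gL]] by simp
    moreover have "L2_normsq lborel (\<lambda>x. g x - f x) = L2_normsq lborel (\<lambda>x. f x - g x)"
      by (rule L2_normsq_minus_commute)
    ultimately show ?thesis using t1 t2 gt fg e by linarith
  qed
  then show ?thesis using d by (intro exI[of _ "min d 1"]) auto
qed

definition conv :: "(real^2 \<Rightarrow> complex) \<Rightarrow> (real^2 \<Rightarrow> complex) \<Rightarrow> real^2 \<Rightarrow> complex" where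
  "conv f \<psi> x = (\<integral>y. f y * \<psi> (x - y) \<partial>lborel)"

lemma Cc_smooth_reflect:
  assumes "\<psi> \<in> Cc_smooth UNIV" shows "(\<lambda>y. \<psi> (x - y)) \<in> Cc_smooth UNIV"
proof -
  obtain K where K: "compact K" "\<And>y. y \<notin> K \<Longrightarrow> \<psi> y = 0"
    by (rule Cc_smooth_compact_support[OF assms]) blast
  show ?thesis
  proof (rule Cc_smoothI)
    show "C_k k (\<lambda>y. \<psi> (x - y))" for k
      using C_k_affine_comp[OF Cc_smooth_C_k[OF assms, of k], of "-1" x] by (simp add: add.commute)
    show "compact ((\<lambda>y. x - y) ` K)" by (intro compact_continuous_image continuous_intros K(1))
    show "{y. \<psi> (x - y) \<noteq> 0} \<subseteq> (\<lambda>y. x - y) ` K"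
    proof safe
      fix y assume "\<psi> (x - y) \<noteq> 0"
      then have "x - y \<in> K" using K(2) by blast
      then show "y \<in> (\<lambda>y. x - y) ` K" by (rule rev_image_eqI) simp
    qed
  qed simp
qed

lemma Cc_smooth_measurable: "\<psi> \<in> Cc_smooth U \<Longrightarrow> \<psi> \<in> borel_measurable borel"
  by (intro borel_measurable_continuous_onI C_k_imp_continuous[OF Cc_smooth_C_k])

lemma Cc_smooth_radius:
  assumes "\<psi> \<in> Cc_smooth U" obtains R where "R \<ge> 0" "\<And>x. R < norm x \<Longrightarrow> \<psi> x = 0"
proof -
  obtain K where K: "compact K" "\<And>y. y \<notin> K \<Longrightarrow> \<psi> y = 0"
    by (rule Cc_smooth_compact_support[OF assms]) blast
  obtain R where "\<forall>x\<in>K. norm x \<le> R" using compact_imp_bounded[OF K(1)] bounded_iff by blast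
  then show ?thesis using K(2) by (intro that[of "max R 0"]) force+
qed

lemma Cc_smooth_bounded:
  assumes "\<psi> \<in> Cc_smooth U" obtains B where "B \<ge> 0" "\<And>x. cmod (\<psi> x) \<le> B"
proof -
  obtain R where R: "R \<ge> 0" "\<And>x. R < norm x \<Longrightarrow> \<psi> x = 0" by (rule Cc_smooth_radius[OF assms]) blast
  have "continuous_on UNIV \<psi>" by (rule C_k_imp_continuous[OF Cc_smooth_C_k[OF assms]])
  then have "compact (\<psi> ` cball 0 R)" by (intro compact_continuous_image) (auto intro: continuous_on_subset)
  then obtain B where B: "\<forall>z\<in>\<psi> ` cball 0 R. norm z \<le> B" using compact_imp_bounded bounded_iff by metis
  have "cmod (\<psi> x) \<le> max B 0" for x using B R(2)[of x] by (cases "norm x \<le> R") force+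
  then show ?thesis by (intro that[of "max B 0"]) auto
qed

lemma Cc_smooth_L2:
  assumes "\<psi> \<in> Cc_smooth U" shows "\<psi> \<in> L2 lborel"
proof -
  obtain R where R: "R \<ge> 0" "\<And>x. R < norm x \<Longrightarrow> \<psi> x = 0" by (rule Cc_smooth_radius[OF assms]) blast
  obtain B where B: "B \<ge> 0" "\<And>x. cmod (\<psi> x) \<le> B" by (rule Cc_smooth_bounded[OF assms]) blast
  have "(\<lambda>x. \<psi> x * complex_of_real (indicator (cball 0 R) x)) \<in> L2 lborel"
    using Cc_smooth_measurable[OF assms] B by (intro L2_bounded_mult[OF indicator_cball_L2]) auto
  also have "(\<lambda>x. \<psi> x * complex_of_real (indicator (cball 0 R) x)) = \<psi>"
  proof
    fix x show "\<psi> x * complex_of_real (indicator (cball 0 R) x) = \<psi> x"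
      using R(2)[of x] by (cases "norm x \<le> R") auto
  qed
  finally show ?thesis .
qed

text \<open>The estimate is uniform in the base point because the partial derivatives are uniformly continuous.\<close>
lemma Cc_smooth_remainder:
  assumes \<psi>: "\<psi> \<in> Cc_smooth UNIV" and e: "e > 0"
  obtains d where "d > 0" "\<And>z h. norm h < d \<Longrightarrow>
    cmod (\<psi> (z + h) - \<psi> z - (\<Sum>i\<in>UNIV. complex_of_real (h$i) * partial_deriv i \<psi> z)) \<le> e * norm h"
proof -
  have d\<psi>: "\<psi> differentiable at x" for x using Cc_smooth_differentiable[OF \<psi>] .
  have uc: "\<exists>d>0. \<forall>x y. dist x y < d \<longrightarrow> cmod (partial_deriv i \<psi> x - partial_deriv i \<psi> y) \<le> e/2" for i
  proof -
    note P = Cc_smooth_partial_deriv[OF \<psi>, of i]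
    obtain R where R: "R \<ge> 0" "\<And>x. R < norm x \<Longrightarrow> partial_deriv i \<psi> x = 0"
      by (rule Cc_smooth_radius[OF P]) blast
    have "uniformly_continuous_on (cball 0 (R+1)) (partial_deriv i \<psi>)"
      by (intro compact_uniformly_continuous continuous_on_subset[OF C_k_imp_continuous[OF Cc_smooth_C_k[OF P]]]) auto
    then obtain d where d: "d > 0" "\<And>x x'. x \<in> cball 0 (R+1) \<Longrightarrow> x' \<in> cball 0 (R+1) \<Longrightarrow> dist x' x < d \<Longrightarrow>
        dist (partial_deriv i \<psi> x') (partial_deriv i \<psi> x) < e/2"
      unfolding uniformly_continuous_on_def using e half_gt_zero by meson
    have "cmod (partial_deriv i \<psi> x - partial_deriv i \<psi> y) \<le> e/2" if "dist x y < min d 1" for x y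
    proof (cases "norm x \<le> R + 1 \<and> norm y \<le> R + 1")
      case True
      then show ?thesis using d(2)[of y x] that by (simp add: dist_norm)
    next
      case False
      moreover have "norm x \<le> norm y + dist x y" "norm y \<le> norm x + dist x y"
        using norm_triangle_ineq2[of x y] norm_triangle_ineq2[of y x] by (auto simp: dist_norm norm_minus_commute)
      ultimately have "R < norm x" "R < norm y" using that by auto
      then show ?thesis using R e by simp
    qed
    then show ?thesis using d(1) by (intro exI[of _ "min d 1"]) auto
  qed
  obtain d where d: "\<And>i. d i > 0" "\<And>i x y. dist x y < d i \<Longrightarrow> cmod (partial_deriv i \<psi> x - partial_deriv i \<psi> y) \<le> e/2"
    using uc by metis
  define \<delta> where "\<delta> = min (d 1) (d 2)"
  have \<delta>: "\<delta> > 0" using d by (simp add: \<delta>_def)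
  have dd: "cmod (partial_deriv i \<psi> x - partial_deriv i \<psi> y) \<le> e/2" if "dist x y < \<delta>" for i x y
  proof -
    have "i = 1 \<or> i = 2" by (rule exhaust_2)
    then show ?thesis using that d(2)[of x y i] by (auto simp: \<delta>_def)
  qed
  show ?thesis
  proof (rule that[OF \<delta>])
    fix z h :: "real^2" assume h: "norm h < \<delta>"
    have "norm (\<psi> (z + h) - \<psi> z - frechet_derivative \<psi> (at z) ((z + h) - z)) \<le> norm ((z + h) - z) * e"
    proof (rule differentiable_bound_linearization[where S="ball z \<delta>"])
      show "z + t *\<^sub>R (z + h - z) \<in> ball z \<delta>" if "t \<in> {0..1}" for t
      proof -
        have "\<bar>t\<bar> * norm h \<le> 1 * norm h" using that by (intro mult_right_mono) auto
        then show ?thesis using h by (simp add: dist_norm)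
      qed
      show "(\<psi> has_derivative frechet_derivative \<psi> (at x)) (at x within ball z \<delta>)" for x
        using has_derivative_frechet[OF d\<psi>] has_derivative_at_withinI by blast
      show "z \<in> ball z \<delta>" using \<delta> by simp
      fix x assume x: "x \<in> ball z \<delta>"
      show "onorm (frechet_derivative \<psi> (at x) - frechet_derivative \<psi> (at z)) \<le> e"
      proof (rule onorm_le)
        fix v
        have "norm ((frechet_derivative \<psi> (at x) - frechet_derivative \<psi> (at z)) v)
          = cmod (\<Sum>i\<in>UNIV. complex_of_real (v$i) * (partial_deriv i \<psi> x - partial_deriv i \<psi> z))"
          by (simp add: frechet_derivative_partial[OF d\<psi>] sum_subtractf right_diff_distrib)
        also have "\<dots> \<le> (\<Sum>i\<in>(UNIV :: 2 set). norm v * (e/2))"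
        proof (rule sum_norm_le)
          fix i
          have "\<bar>v$i\<bar> * cmod (partial_deriv i \<psi> x - partial_deriv i \<psi> z) \<le> norm v * (e/2)"
            using x by (intro mult_mono dd component_le_norm_cart) (auto simp: dist_commute)
          then show "cmod (complex_of_real (v$i) * (partial_deriv i \<psi> x - partial_deriv i \<psi> z)) \<le> norm v * (e/2)"
            by (simp add: norm_mult)
        qed
        also have "\<dots> = e * norm v" by (simp add: sum_2)
        finally show "norm ((frechet_derivative \<psi> (at x) - frechet_derivative \<psi> (at z)) v) \<le> e * norm v" .
      qed
    qed
    then show "cmod (\<psi> (z + h) - \<psi> z - (\<Sum>i\<in>UNIV. complex_of_real (h$i) * partial_deriv i \<psi> z)) \<le> e * norm h"
      by (simp add: frechet_derivative_partial[OF d\<psi>] mult.commute)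
  qed
qed

lemma conv_integrable:
  assumes "f \<in> L2 lborel" "\<psi> \<in> Cc_smooth UNIV"
  shows "integrable lborel (\<lambda>y. f y * \<psi> (x - y))"
  using assms by (intro L2_mult_integrable Cc_smooth_L2[OF Cc_smooth_reflect])

text \<open>The Taylor remainder of \<open>\<psi>\<close> at \<open>x - y\<close> vanishes for \<open>y\<close> outside a fixed ball around \<open>x\<close>, and \<open>f\<close> is
  integrable on that ball.\<close>
lemma conv_has_derivative:
  assumes f: "f \<in> L2 lborel" and \<psi>: "\<psi> \<in> Cc_smooth UNIV"
  shows "(conv f \<psi> has_derivative (\<lambda>h. \<Sum>i\<in>UNIV. complex_of_real (h$i) * conv f (partial_deriv i \<psi>) x)) (at x)"
proof -
  let ?D = "\<lambda>h. \<Sum>i\<in>UNIV. complex_of_real (h$i) * conv f (partial_deriv i \<psi>) x"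
  let ?r = "\<lambda>z h. \<psi> (z + h) - \<psi> z - (\<Sum>i\<in>UNIV. complex_of_real (h$i) * partial_deriv i \<psi> z)"
  have P: "partial_deriv i \<psi> \<in> Cc_smooth UNIV" for i by (rule Cc_smooth_partial_deriv[OF \<psi>])
  obtain R where R: "R \<ge> 0" "\<And>x. R < norm x \<Longrightarrow> \<psi> x = 0"
    by (rule Cc_smooth_radius[OF \<psi>]) blast
  have Rp: "partial_deriv i \<psi> x = 0" if "R < norm x" for i x
    by (rule partial_deriv_zero_outside[of "cball 0 R"]) (use R that in auto)
  define I where "I = (\<lambda>y::real^2. complex_of_real (indicator (cball x (R+1)) y))"
  have IL: "I \<in> L2 lborel" unfolding I_def by (rule indicator_cball_L2)
  define C where "C = (\<integral>y. cmod (f y * I y) \<partial>lborel)"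
  have C: "C \<ge> 0" by (simp add: C_def)
  have Ci: "integrable lborel (\<lambda>y. cmod (f y * I y))" by (intro integrable_norm L2_mult_integrable f IL)
  have diff: "conv f \<psi> (x + h) - conv f \<psi> x - ?D h = (\<integral>y. f y * ?r (x - y) h \<partial>lborel)" for h
  proof -
    have s: "(\<Sum>i\<in>UNIV. complex_of_real (h$i) * conv f (partial_deriv i \<psi>) x)
      = (\<integral>y. (\<Sum>i\<in>UNIV. complex_of_real (h$i) * (f y * partial_deriv i \<psi> (x - y))) \<partial>lborel)"
      unfolding conv_def by (subst Bochner_Integration.integral_sum) (auto intro!: integrable_mult_right conv_integrable f P)
    have i: "integrable lborel (\<lambda>y. \<Sum>i\<in>UNIV. complex_of_real (h$i) * (f y * partial_deriv i \<psi> (x - y)))"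
      by (intro Bochner_Integration.integrable_sum integrable_mult_right conv_integrable f P)
    have "conv f \<psi> (x + h) - conv f \<psi> x - ?D h = (\<integral>y. f y * \<psi> (x + h - y) - f y * \<psi> (x - y)
       - (\<Sum>i\<in>UNIV. complex_of_real (h$i) * (f y * partial_deriv i \<psi> (x - y))) \<partial>lborel)"
      unfolding s unfolding conv_def using i conv_integrable[OF f \<psi>]
      by (simp add: Bochner_Integration.integral_diff Bochner_Integration.integrable_diff)
    also have "\<dots> = (\<integral>y. f y * ?r (x - y) h \<partial>lborel)"
      by (intro Bochner_Integration.integral_cong) (auto simp: right_diff_distrib sum_distrib_left algebra_simps)
    finally show ?thesis .
  qed
  have bl: "bounded_linear ?D"
    unfolding linear_conv_bounded_linear[symmetric]
    by (rule linearI) (simp_all add: sum_2 algebra_simps scaleR_conv_of_real[where 'a=complex])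
  have "(\<lambda>h. norm (conv f \<psi> (x + h) - conv f \<psi> x - ?D h) / norm h) \<midarrow>0\<rightarrow> 0"
  proof (rule LIM_I)
    fix e :: real assume e: "e > 0"
    obtain d where d: "d > 0" "\<And>z h. norm h < d \<Longrightarrow> cmod (?r z h) \<le> (e / (2 * (C + 1))) * norm h"
      by (rule Cc_smooth_remainder[OF \<psi>, of "e / (2 * (C + 1))"]) (use e C in auto)
    have "norm (norm (conv f \<psi> (x + h) - conv f \<psi> x - ?D h) / norm h - 0) < e" if h: "h \<noteq> 0" "norm h < min d 1" for h
    proof -
      have b: "cmod (f y * ?r (x - y) h) \<le> (e / (2 * (C + 1))) * norm h * cmod (f y * I y)" for y
      proof (cases "dist x y \<le> R + 1")
        case True
        have "cmod (f y) * cmod (?r (x - y) h) \<le> cmod (f y) * ((e / (2 * (C + 1))) * norm h)"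
          using h by (intro mult_left_mono d(2)) auto
        then show ?thesis using True by (simp add: norm_mult I_def mult_ac)
      next
        case False
        then have "R < norm (x - y)" by (simp add: dist_norm)
        moreover have "R < norm (x - y + h)"
          using False h norm_triangle_ineq2[of "x - y" "- h"] by (simp add: dist_norm)
        ultimately have "?r (x - y) h = 0" using R Rp by simp
        then show ?thesis using e C by simp
      qed
      have "norm (conv f \<psi> (x + h) - conv f \<psi> x - ?D h) \<le> (\<integral>y. (e / (2 * (C + 1))) * norm h * cmod (f y * I y) \<partial>lborel)"
        unfolding diff
        by (rule order_trans[OF integral_norm_bound integral_mono'])
           (use b Ci e C in \<open>auto intro!: integrable_mult_right divide_nonneg_nonneg mult_nonneg_nonneg\<close>)
      also have "\<dots> = (e / (2 * (C + 1))) * norm h * C" by (simp add: C_def)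
      finally have "norm (conv f \<psi> (x + h) - conv f \<psi> x - ?D h) / norm h \<le> (e / (2 * (C + 1))) * C"
        using h by (simp add: pos_divide_le_eq mult_ac)
      also have "\<dots> < e" using e C by (simp add: pos_divide_less_eq algebra_simps add_nonneg_pos)
      finally show ?thesis by simp
    qed
    then show "\<exists>s>0. \<forall>h. h \<noteq> 0 \<and> norm (h - 0) < s \<longrightarrow> norm (norm (conv f \<psi> (x + h) - conv f \<psi> x - ?D h) / norm h - 0) < e"
      using d(1) by (intro exI[of _ "min d 1"]) auto
  qed
  with bl show ?thesis by (simp add: has_derivative_at)
qed

lemma partial_deriv_conv:
  assumes "f \<in> L2 lborel" "\<psi> \<in> Cc_smooth UNIV"
  shows "partial_deriv i (conv f \<psi>) = conv f (partial_deriv i \<psi>)"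
proof
  fix x
  have "i = 1 \<or> i = 2" by (rule exhaust_2)
  then show "partial_deriv i (conv f \<psi>) x = conv f (partial_deriv i \<psi>) x"
    using partial_deriv_eqI[OF conv_has_derivative[OF assms], of i x] by (auto simp: sum_2 axis_def)
qed

lemma C_k_conv:
  assumes f: "f \<in> L2 lborel" and \<psi>: "\<psi> \<in> Cc_smooth UNIV"
  shows "C_k k (conv f \<psi>)"
  using \<psi>
proof (induction k arbitrary: \<psi>)
  case 0
  then have "conv f \<psi> differentiable at x" for x using conv_has_derivative[OF f] differentiable_def by blast
  then show ?case by (auto intro!: continuous_at_imp_continuous_on differentiable_imp_continuous_within)
next
  case (Suc k)
  then have "conv f \<psi> differentiable at x" for x using conv_has_derivative[OF f] differentiable_def by blast
  then show ?case using Suc Cc_smooth_partial_deriv partial_deriv_conv[OF f Suc.prems] by auto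
qed

lemma nn_integral_lborel_reflect:
  fixes x :: "'a::euclidean_space"
  assumes "F \<in> borel_measurable borel"
  shows "(\<integral>\<^sup>+z. F (x - z) \<partial>lborel) = (\<integral>\<^sup>+y. F y \<partial>lborel)"
proof -
  have d: "lborel = distr lborel borel (\<lambda>z. x - z)"
    using lborel_affine[of "-1" x] by (simp add: density_1)
  show ?thesis
    by (subst (2) d, subst nn_integral_distr) (use assms in auto)
qed

definition mollifier :: "real \<Rightarrow> (real^2 \<Rightarrow> real) \<Rightarrow> bool" where
  "mollifier d \<rho> \<longleftrightarrow> (\<lambda>x. complex_of_real (\<rho> x)) \<in> Cc_smooth UNIV \<and> (\<forall>x. 0 \<le> \<rho> x) \<and>
     (\<integral>x. \<rho> x \<partial>lborel) = 1 \<and> (\<forall>x. \<rho> x \<noteq> 0 \<longrightarrow> norm x < d)"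

lemma Cc_smooth_integrable:
  assumes "\<psi> \<in> Cc_smooth U" shows "integrable lborel \<psi>"
proof -
  obtain R where R: "R \<ge> 0" "\<And>x. R < norm x \<Longrightarrow> \<psi> x = 0" by (rule Cc_smooth_radius[OF assms]) blast
  have "integrable lborel (\<lambda>x. \<psi> x * complex_of_real (indicator (cball 0 R) x))"
    by (intro L2_mult_integrable Cc_smooth_L2[OF assms] indicator_cball_L2)
  also have "(\<lambda>x. \<psi> x * complex_of_real (indicator (cball 0 R) x)) = \<psi>"
  proof
    fix x show "\<psi> x * complex_of_real (indicator (cball 0 R) x) = \<psi> x"
      using R(2)[of x] by (cases "norm x \<le> R") auto
  qed
  finally show ?thesis .
qed

text \<open>By the Cauchy--Schwarz inequality for the probability density \<open>\<rho>\<close>, the error of mollification is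
  at most an average of the errors of translation.\<close>
lemma conv_error:
  assumes f: "f \<in> L2 lborel" and \<rho>: "mollifier d \<rho>"
    and tr: "\<And>y. norm y < d \<Longrightarrow> L2_normsq lborel (\<lambda>x. f (x - y) - f x) \<le> e" and e: "e \<ge> 0"
  shows "(\<lambda>x. conv f (\<lambda>x. complex_of_real (\<rho> x)) x - f x) \<in> L2 lborel"
    "L2_normsq lborel (\<lambda>x. conv f (\<lambda>x. complex_of_real (\<rho> x)) x - f x) \<le> e"
proof -
  let ?\<rho> = "\<lambda>x. complex_of_real (\<rho> x)"
  have \<rho>C: "?\<rho> \<in> Cc_smooth UNIV" and \<rho>0: "\<And>x. 0 \<le> \<rho> x" and \<rho>1: "(\<integral>x. \<rho> x \<partial>lborel) = 1"
    and \<rho>d: "\<And>x. \<rho> x \<noteq> 0 \<Longrightarrow> norm x < d"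
    using \<rho> by (auto simp: mollifier_def)
  have fm [measurable]: "f \<in> borel_measurable borel" using L2_measurable[OF f] by simp
  have "(\<lambda>x. Re (?\<rho> x)) \<in> borel_measurable borel" using Cc_smooth_measurable[OF \<rho>C] by measurable
  then have \<rho>m [measurable]: "\<rho> \<in> borel_measurable borel" by simp
  have \<rho>i: "integrable lborel \<rho>" using integrable_Re[OF Cc_smooth_integrable[OF \<rho>C]] by simp
  have cm: "conv f ?\<rho> \<in> borel_measurable borel"
    by (intro borel_measurable_continuous_onI C_k_imp_continuous[OF C_k_conv[OF f \<rho>C]])
  obtain B where B: "B \<ge> 0" "\<And>x. cmod (?\<rho> x) \<le> B" by (rule Cc_smooth_bounded[OF \<rho>C]) blast
  define k where "k x z = ennreal ((cmod (f (x - z) - f x))\<^sup>2 * \<rho> z)" for x z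
  have km: "(\<lambda>(x, z). k x z) \<in> borel_measurable (lborel \<Otimes>\<^sub>M lborel)"
    unfolding k_def case_prod_unfold by measurable
  have pt: "ennreal ((cmod (conv f ?\<rho> x - f x))\<^sup>2) \<le> (\<integral>\<^sup>+z. k x z \<partial>lborel)" for x
  proof -
    let ?r = "\<lambda>y. \<rho> (x - y)"
    have rC: "(\<lambda>y. complex_of_real (?r y)) \<in> Cc_smooth UNIV" using Cc_smooth_reflect[OF \<rho>C] .
    have ri: "integrable lborel ?r" using integrable_Re[OF Cc_smooth_integrable[OF rC]] by simp
    have "ennreal (\<integral>y. ?r y \<partial>lborel) = (\<integral>\<^sup>+y. ennreal (?r y) \<partial>lborel)"
      using ri \<rho>0 by (simp add: nn_integral_eq_integral)
    also have "\<dots> = (\<integral>\<^sup>+y. ennreal (\<rho> y) \<partial>lborel)"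
      by (rule nn_integral_lborel_reflect[where F="\<lambda>y. ennreal (\<rho> y)"]) measurable
    also have "\<dots> = ennreal (\<integral>y. \<rho> y \<partial>lborel)" using \<rho>i \<rho>0 by (simp add: nn_integral_eq_integral)
    finally have r1: "(\<integral>y. ?r y \<partial>lborel) = 1" using \<rho>1 \<rho>0 ri by (simp add: ennreal_inj)
    have gi: "integrable lborel (\<lambda>y. (cmod (f y - f x))\<^sup>2 * ?r y)"
    proof (rule Bochner_Integration.integrable_bound[where f="\<lambda>y. 2 * (B * (cmod (f y))\<^sup>2) + 2 * (cmod (f x))\<^sup>2 * ?r y"])
      show "integrable lborel (\<lambda>y. 2 * (B * (cmod (f y))\<^sup>2) + 2 * (cmod (f x))\<^sup>2 * ?r y)"
        using L2_integrable_sq[OF f] ri by (intro Bochner_Integration.integrable_add integrable_mult_right)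
      show "AE y in lborel. norm ((cmod (f y - f x))\<^sup>2 * ?r y) \<le> norm (2 * (B * (cmod (f y))\<^sup>2) + 2 * (cmod (f x))\<^sup>2 * ?r y)"
      proof (rule AE_I2)
        fix y
        have "(cmod (f y - f x))\<^sup>2 \<le> 2 * (cmod (f y))\<^sup>2 + 2 * (cmod (f x))\<^sup>2"
          using cmod_add_sq_le[of "f y" "- f x"] by simp
        then have "(cmod (f y - f x))\<^sup>2 * ?r y \<le> (2 * (cmod (f y))\<^sup>2 + 2 * (cmod (f x))\<^sup>2) * ?r y"
          using \<rho>0 by (rule mult_right_mono)
        also have "\<dots> = 2 * ((cmod (f y))\<^sup>2 * ?r y) + 2 * (cmod (f x))\<^sup>2 * ?r y" by (simp add: algebra_simps)
        also have "\<dots> \<le> 2 * (B * (cmod (f y))\<^sup>2) + 2 * (cmod (f x))\<^sup>2 * ?r y"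
          using B(2)[of "x - y"] \<rho>0[of "x - y"] mult_left_mono[of "?r y" B "(cmod (f y))\<^sup>2"] by (simp add: mult.commute)
        finally show "norm ((cmod (f y - f x))\<^sup>2 * ?r y) \<le> norm (2 * (B * (cmod (f y))\<^sup>2) + 2 * (cmod (f x))\<^sup>2 * ?r y)"
          using \<rho>0[of "x - y"] by simp
      qed
    qed measurable
    have "conv f ?\<rho> x - f x = (\<integral>y. f y * ?\<rho> (x - y) \<partial>lborel) - (\<integral>y. f x * ?\<rho> (x - y) \<partial>lborel)"
      using r1 by (simp add: conv_def)
    also have "\<dots> = (\<integral>y. (f y - f x) * ?\<rho> (x - y) \<partial>lborel)"
      using conv_integrable[OF f \<rho>C, of x] Cc_smooth_integrable[OF rC]
      by (subst Bochner_Integration.integral_diff[symmetric]) (auto simp: left_diff_distrib)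
    finally have "(cmod (conv f ?\<rho> x - f x))\<^sup>2 \<le> (\<integral>y. (cmod (f y - f x))\<^sup>2 * ?r y \<partial>lborel)"
      using Cauchy_Schwarz_weighted[OF ri \<rho>0 r1 _ gi] by simp
    then have "ennreal ((cmod (conv f ?\<rho> x - f x))\<^sup>2) \<le> (\<integral>\<^sup>+y. ennreal ((cmod (f y - f x))\<^sup>2 * ?r y) \<partial>lborel)"
      using gi \<rho>0 by (subst nn_integral_eq_integral) (auto intro!: ennreal_leI)
    also have "\<dots> = (\<integral>\<^sup>+z. k x z \<partial>lborel)"
      unfolding k_def
      by (subst nn_integral_lborel_reflect[where F="\<lambda>y. ennreal ((cmod (f y - f x))\<^sup>2 * \<rho> (x - y))" and x=x, symmetric]) auto
    finally show ?thesis .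
  qed
  have "(\<integral>\<^sup>+x. ennreal ((cmod (conv f ?\<rho> x - f x))\<^sup>2) \<partial>lborel) \<le> (\<integral>\<^sup>+x. \<integral>\<^sup>+z. k x z \<partial>lborel \<partial>lborel)"
    by (rule nn_integral_mono) (rule pt)
  also have "\<dots> = (\<integral>\<^sup>+z. \<integral>\<^sup>+x. k x z \<partial>lborel \<partial>lborel)"
    using lborel_pair.Fubini'[OF km] by simp
  also have "\<dots> \<le> (\<integral>\<^sup>+z. ennreal e * ennreal (\<rho> z) \<partial>lborel)"
  proof (rule nn_integral_mono)
    fix z
    have L: "(\<lambda>x. f (x - z) - f x) \<in> L2 lborel" by (intro L2_diff L2_translate f)
    have "(\<integral>\<^sup>+x. k x z \<partial>lborel) = ennreal (L2_normsq lborel (\<lambda>x. f (x - z) - f x) * \<rho> z)"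
      unfolding k_def using L2_integrable_sq[OF L] \<rho>0
      by (subst nn_integral_eq_integral) (auto simp: L2_normsq_def)
    also have "\<dots> \<le> ennreal (e * \<rho> z)"
      using tr[of z] \<rho>d[of z] \<rho>0[of z] by (cases "\<rho> z = 0") (auto intro!: ennreal_leI mult_right_mono)
    finally show "(\<integral>\<^sup>+x. k x z \<partial>lborel) \<le> ennreal e * ennreal (\<rho> z)" using e \<rho>0 by (simp add: ennreal_mult)
  qed
  also have "\<dots> = ennreal e * ennreal (\<integral>z. \<rho> z \<partial>lborel)"
    using \<rho>i \<rho>0 by (simp add: nn_integral_cmult nn_integral_eq_integral)
  also have "\<dots> = ennreal e" using \<rho>1 by simp
  finally have nn: "(\<integral>\<^sup>+x. ennreal ((cmod (conv f ?\<rho> x - f x))\<^sup>2) \<partial>lborel) \<le> ennreal e" .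
  show L: "(\<lambda>x. conv f ?\<rho> x - f x) \<in> L2 lborel"
    unfolding L2_def using cm nn by (auto simp: integrable_iff_bounded intro: le_less_trans)
  then show "L2_normsq lborel (\<lambda>x. conv f ?\<rho> x - f x) \<le> e"
    using nn e by (subst (asm) nn_integral_eq_integral) (auto simp: L2_def L2_normsq_def)
qed

lemma conv_tendsto:
  assumes f: "f \<in> L2 lborel" and \<rho>: "\<And>n. mollifier (d n) (\<rho> n)" and d: "d \<longlonglongrightarrow> 0"
  shows "(\<lambda>n. L2_normsq lborel (\<lambda>x. conv f (\<lambda>x. complex_of_real (\<rho> n x)) x - f x)) \<longlonglongrightarrow> 0"
proof (rule LIMSEQ_I)
  fix e :: real assume e: "e > 0"
  obtain \<delta> where \<delta>: "\<delta> > 0" "\<And>y. norm y < \<delta> \<Longrightarrow> L2_normsq lborel (\<lambda>x. f (x - y) - f x) \<le> e/2"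
    using L2_translation_continuous[OF f, of "e/2"] e by auto
  obtain N where N: "\<And>n. n \<ge> N \<Longrightarrow> d n < \<delta>"
    using order_tendstoD(2)[OF d \<delta>(1)] unfolding eventually_sequentially by blast
  have "norm (L2_normsq lborel (\<lambda>x. conv f (\<lambda>x. complex_of_real (\<rho> n x)) x - f x) - 0) < e" if "n \<ge> N" for n
  proof -
    have "L2_normsq lborel (\<lambda>x. conv f (\<lambda>x. complex_of_real (\<rho> n x)) x - f x) \<le> e/2"
    proof (rule conv_error(2)[OF f \<rho>[of n]])
      fix y :: "real^2" assume "norm y < d n"
      then show "L2_normsq lborel (\<lambda>x. f (x - y) - f x) \<le> e/2" using N[OF that] by (intro \<delta>(2)) simp
    qed (use e in auto)
    then show ?thesis using e L2_normsq_nonneg[of lborel "\<lambda>x. conv f (\<lambda>x. complex_of_real (\<rho> n x)) x - f x"] by simp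
  qed
  then show "\<exists>no. \<forall>n\<ge>no. norm (L2_normsq lborel (\<lambda>x. conv f (\<lambda>x. complex_of_real (\<rho> n x)) x - f x) - 0) < e" by blast
qed

lemma conv_L2:
  assumes f: "f \<in> L2 lborel" and \<rho>: "mollifier d \<rho>"
  shows "conv f (\<lambda>x. complex_of_real (\<rho> x)) \<in> L2 lborel"
proof -
  have "L2_normsq lborel (\<lambda>x. f (x - y) - f x) \<le> 4 * L2_normsq lborel f" for y
    using L2_normsq_add_le[OF L2_translate(1)[OF f] L2_uminus[OF f], of y] L2_translate(2)[OF f, of y]
    by (simp add: L2_normsq_uminus)
  then have "(\<lambda>x. conv f (\<lambda>x. complex_of_real (\<rho> x)) x - f x) \<in> L2 lborel"
    by (intro conv_error(1)[OF f \<rho>, of "4 * L2_normsq lborel f"]) (auto simp: L2_normsq_nonneg)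
  from L2_add[OF this f] show ?thesis by simp
qed

lemma mollifier_bump:
  assumes r: "r > 0" and d: "norm c + r \<le> d"
  shows "mollifier d (\<lambda>x. bump c r x / (\<integral>x. bump c r x \<partial>lborel))"
proof -
  let ?I = "\<integral>x. bump c r x \<partial>lborel"
  have C: "(\<lambda>x. complex_of_real (bump c r x)) \<in> Cc_smooth UNIV" using r by (intro Cc_smooth_bump) auto
  have i: "integrable lborel (bump c r)" using integrable_Re[OF Cc_smooth_integrable[OF C]] by simp
  have "?I \<noteq> 0"
  proof
    assume "?I = 0"
    then have "AE x in lborel. bump c r x = 0"
      using integral_nonneg_eq_0_iff_AE[OF i] bump_nonneg by simp
    then have "AE x in lborel. x \<notin> ball c r"
      by eventually_elim (use bump_pos_iff[OF r, of c] in blast)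
    then have "emeasure lborel (ball c r) = 0" by (subst (asm) AE_iff_measurable[OF _ refl]) (auto simp: ball_def)
    then have "ball c r \<in> null_sets lborel" by auto
    then have "ball c r \<in> null_sets lebesgue" by (rule null_sets_completionI)
    then have "negligible (ball c r)" by (simp add: negligible_iff_null_sets)
    then show False using r open_not_negligible[of "ball c r"] by auto
  qed
  moreover have "?I \<ge> 0" using bump_nonneg by simp
  ultimately have I: "?I > 0" by simp
  have "(\<lambda>x. complex_of_real (1 / ?I) * complex_of_real (bump c r x)) \<in> Cc_smooth UNIV"
    by (intro Cc_smooth_mult C C_k_const)
  moreover have "norm x < d" if "bump c r x \<noteq> 0" for x
  proof -
    have "dist c x < r" using that bump_pos_iff[OF r] by simp
    then show ?thesis using norm_triangle_ineq2[of x c] d by (simp add: dist_norm norm_minus_commute)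
  qed
  ultimately show ?thesis using I bump_nonneg[of c r] by (auto simp: mollifier_def)
qed

subsection \<open>Extension by zero\<close>

lemma L2_lborel_imp_lebesgue_on:
  assumes f: "f \<in> L2 lborel" and U: "U \<in> sets borel"
  shows "f \<in> L2 (lebesgue_on U)" "L2_normsq (lebesgue_on U) f \<le> L2_normsq lborel f"
proof -
  have fm: "f \<in> borel_measurable borel" using L2_measurable[OF f] by simp
  then have sm: "(\<lambda>x. (cmod (f x))\<^sup>2) \<in> borel_measurable borel" by measurable
  have i: "integrable lborel (\<lambda>x. indicator U x *\<^sub>R (cmod (f x))\<^sup>2)"
    using L2_integrable_sq[OF f] U by (intro integrable_mult_indicator) auto
  then show "f \<in> L2 (lebesgue_on U)"
    using integral_lebesgue_on(2)[OF U sm] borel_imp_lebesgue_on[OF fm] by (simp add: L2_def)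
  show "L2_normsq (lebesgue_on U) f \<le> L2_normsq lborel f"
    unfolding L2_normsq_def integral_lebesgue_on(1)[OF U sm]
    using i L2_integrable_sq[OF f] by (intro Bochner_Integration.integral_mono) (auto simp: indicator_def)
qed

text \<open>A Lebesgue measurable \<open>u\<close> is replaced by a Borel function that agrees with it almost everywhere on \<open>U\<close>.
  Borel measurability makes \<open>f (x - y)\<close> jointly measurable, as Tonelli's theorem requires.\<close>
lemma L2_zero_extension:
  fixes u :: "'a::euclidean_space \<Rightarrow> complex"
  assumes u: "u \<in> L2 (lebesgue_on U)" and U: "U \<in> sets borel"
  obtains f where "f \<in> L2 lborel" "AE x in lebesgue_on U. f x = u x"
    "\<And>w. w \<in> borel_measurable borel \<Longrightarrow> (\<integral>x. u x * w x \<partial>lebesgue_on U) = (\<integral>x. f x * w x \<partial>lborel)"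
proof -
  have U': "U \<in> sets lebesgue" using U by simp
  have "(\<lambda>x. if x \<in> U then u x else 0) \<in> borel_measurable lebesgue"
    using L2_measurable[OF u] by (subst borel_measurable_if) (auto simp: U')
  then have R: "(\<lambda>x. Re (if x \<in> U then u x else 0)) \<in> borel_measurable (completion lborel)"
    and I: "(\<lambda>x. Im (if x \<in> U then u x else 0)) \<in> borel_measurable (completion lborel)"
    by (auto intro: measurable_compose)
  obtain g h where g: "g \<in> borel_measurable lborel" "AE x in lborel. Re (if x \<in> U then u x else 0) = g x"
    and h: "h \<in> borel_measurable lborel" "AE x in lborel. Im (if x \<in> U then u x else 0) = h x"
    using completion_ex_borel_measurable_real[OF R] completion_ex_borel_measurable_real[OF I] by blast
  define f where "f x = (if x \<in> U then Complex (g x) (h x) else 0)" for x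
  have [measurable]: "g \<in> borel_measurable borel" "h \<in> borel_measurable borel" "U \<in> sets borel"
    using g(1) h(1) U by auto
  have fm: "f \<in> borel_measurable borel" unfolding f_def Complex_eq using U by (intro measurable_If) auto
  have ae: "AE x in lborel. f x = (if x \<in> U then u x else 0)"
    using g(2) h(2) by eventually_elim (auto simp: f_def complex_eq_iff)
  then have aeU: "AE x in lebesgue_on U. f x = u x"
    by (subst AE_restrict_space_iff) (auto simp: U' AE_completion elim: eventually_mono intro!: AE_completion)
  have fL: "f \<in> L2 (lebesgue_on U)"
  proof (rule L2_normsq_cong_AE(1)[OF u])
    show "f \<in> borel_measurable (lebesgue_on U)" using fm by (rule borel_imp_lebesgue_on)
    show "AE x in lebesgue_on U. u x = f x" using aeU by eventually_elim simp
  qed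
  have sm: "(\<lambda>x. (cmod (f x))\<^sup>2) \<in> borel_measurable borel" using fm by measurable
  have "(\<lambda>x. indicator U x *\<^sub>R (cmod (f x))\<^sup>2) = (\<lambda>x. (cmod (f x))\<^sup>2)" by (auto simp: f_def)
  then have f2: "f \<in> L2 lborel"
    using L2_integrable_sq[OF fL] integral_lebesgue_on(2)[OF U sm] fm by (simp add: L2_def)
  have "(\<integral>x. u x * w x \<partial>lebesgue_on U) = (\<integral>x. f x * w x \<partial>lborel)" if w: "w \<in> borel_measurable borel" for w
  proof -
    have "(\<integral>x. u x * w x \<partial>lebesgue_on U) = (\<integral>x. f x * w x \<partial>lebesgue_on U)"
    proof (rule integral_cong_AE)
      show "AE x in lebesgue_on U. u x * w x = f x * w x" using aeU by eventually_elim simp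
    qed (use L2_measurable[OF u] L2_measurable[OF fL] borel_imp_lebesgue_on[OF w] in auto)
    also have "\<dots> = (\<integral>x. indicator U x *\<^sub>R (f x * w x) \<partial>lborel)"
      by (rule integral_lebesgue_on(1)[OF U]) (use fm w in measurable)
    also have "(\<lambda>x. indicator U x *\<^sub>R (f x * w x)) = (\<lambda>x. f x * w x)" by (auto simp: f_def)
    finally show ?thesis .
  qed
  with f2 aeU show ?thesis by (rule that)
qed

section \<open>Green's formula and weak gradients in the sector\<close>

definition edge_integral :: "real \<Rightarrow> (real^2 \<Rightarrow> complex) \<Rightarrow> complex" where
  "edge_integral \<theta> h = (\<integral>t. indicator {0<..} t *\<^sub>R h (t *\<^sub>R dir \<theta>) \<partial>lborel)"

definition grad :: "(real^2 \<Rightarrow> complex) \<Rightarrow> real^2 \<Rightarrow> complex^2" where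
  "grad w x = (\<chi> i. partial_deriv i w x)"

lemma grad_nth [simp]: "grad w x $ i = partial_deriv i w x"
  by (simp add: grad_def)

locale acute_sector =
  fixes \<alpha> :: real
  assumes \<alpha>: "0 < \<alpha>" "\<alpha> < pi/2"
begin

abbreviation "U \<equiv> sector \<alpha>"
abbreviation "M \<equiv> lebesgue_on (sector \<alpha>)"
abbreviation "S \<equiv> bdry_measure (sector \<alpha>)"

lemma U_borel: "U \<in> sets borel" by (rule sector_borel[OF \<alpha>])

lemma sin_pos: "sin \<alpha> > 0" using \<alpha> by (intro sin_gt_zero) auto
lemma cos_pos: "cos \<alpha> > 0" using \<alpha> by (intro cos_gt_zero) auto

lemma Cc_smooth_integrable_M: "\<psi> \<in> Cc_smooth V \<Longrightarrow> integrable M \<psi>"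
  using integrable_mult_indicator[OF _ Cc_smooth_integrable] U_borel
  by (subst integral_lebesgue_on(2)[OF U_borel Cc_smooth_measurable]) auto

lemma Cc_smooth_L2_M: "\<psi> \<in> Cc_smooth V \<Longrightarrow> \<psi> \<in> L2 M"
  using L2_lborel_imp_lebesgue_on(1)[OF Cc_smooth_L2 U_borel] by blast

text \<open>Green's formula in the direction \<open>\<theta>\<close>: the factors \<open>sin (\<theta> - \<alpha>)\<close> and \<open>- sin (\<theta> + \<alpha>)\<close> are the scalar
  products of \<open>dir \<theta>\<close> with the outer normals of the two edges. Decomposing \<open>dir \<theta>\<close> along the edges
  reduces it to derivatives in the directions of the edges.\<close>
lemma directional_Green:
  assumes h: "h \<in> Cc_smooth UNIV"
  shows "(\<integral>x. complex_of_real (cos \<theta>) * partial_deriv 1 h x + complex_of_real (sin \<theta>) * partial_deriv 2 h x \<partial>M)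
    = complex_of_real (sin (\<theta> - \<alpha>)) * edge_integral \<alpha> h - complex_of_real (sin (\<theta> + \<alpha>)) * edge_integral (- \<alpha>) h"
proof -
  define D where "D x = frechet_derivative h (at x)" for x
  have d: "(h has_derivative D x) (at x)" for x
    unfolding D_def by (rule has_derivative_frechet[OF Cc_smooth_differentiable[OF h]])
  have Ddir: "D x (dir \<theta>) = complex_of_real (cos \<theta>) * partial_deriv 1 h x + complex_of_real (sin \<theta>) * partial_deriv 2 h x" for x \<theta>
    unfolding D_def frechet_derivative_partial[OF Cc_smooth_differentiable[OF h]] by (simp add: sum_2)
  have P: "partial_deriv i h \<in> Cc_smooth UNIV" for i by (rule Cc_smooth_partial_deriv[OF h])
  have Dc: "continuous_on UNIV (\<lambda>x. D x (dir \<theta>))" for \<theta>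
    unfolding Ddir using C_k_imp_continuous[OF Cc_smooth_C_k[OF P]] by (intro continuous_intros)
  have Di: "integrable M (\<lambda>x. D x (dir \<theta>))" for \<theta>
    unfolding Ddir by (intro Bochner_Integration.integrable_add integrable_mult_right Cc_smooth_integrable_M[OF P])
  obtain R where R: "R \<ge> 0" "\<And>x. R < norm x \<Longrightarrow> h x = 0" by (rule Cc_smooth_radius[OF h]) blast
  have s2: "sin (2*\<alpha>) > 0" by (rule sin_double_pos[OF \<alpha>])
  have 1: "(\<integral>x. D x (dir \<alpha>) \<partial>M) = - (sin (2*\<alpha>) *\<^sub>R edge_integral (- \<alpha>) h)"
    using integral_edge_derivative[of \<alpha> h D R, OF _ _ d Dc R(2)] \<alpha> s2 by (simp add: edge_integral_def)
  have 2: "(\<integral>x. D x (dir (- \<alpha>)) \<partial>M) = - (sin (2*\<alpha>) *\<^sub>R edge_integral \<alpha> h)"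
    using integral_edge_derivative[of "- \<alpha>" h D R, OF _ _ d Dc R(2)] \<alpha> s2 by (simp add: edge_integral_def)
  define a b where "a = sin (\<theta> + \<alpha>) / sin (2*\<alpha>)" and "b = sin (\<alpha> - \<theta>) / sin (2*\<alpha>)"
  have dt: "dir \<theta> = a *\<^sub>R dir \<alpha> + b *\<^sub>R dir (- \<alpha>)"
  proof -
    have "edge_dist \<alpha> (dir \<theta>) = sin (\<theta> + \<alpha>)" "- edge_dist (- \<alpha>) (dir \<theta>) = sin (\<alpha> - \<theta>)"
      by (simp_all add: edge_dist_def sin_add sin_diff algebra_simps)
    then show ?thesis using combo_of_edge_dist[of \<alpha> "dir \<theta>"] s2 by (simp add: a_def b_def)
  qed
  have "D x (dir \<theta>) = a *\<^sub>R D x (dir \<alpha>) + b *\<^sub>R D x (dir (- \<alpha>))" for x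
    using has_derivative_linear[OF d[of x]] unfolding dt by (simp add: linear_add linear_cmul)
  then have "(\<integral>x. D x (dir \<theta>) \<partial>M) = a *\<^sub>R (\<integral>x. D x (dir \<alpha>) \<partial>M) + b *\<^sub>R (\<integral>x. D x (dir (- \<alpha>)) \<partial>M)"
    using Di[of \<alpha>] Di[of "- \<alpha>"] by (simp add: Bochner_Integration.integral_add)
  also have "\<dots> = - ((a * sin (2*\<alpha>)) *\<^sub>R edge_integral (- \<alpha>) h) - (b * sin (2*\<alpha>)) *\<^sub>R edge_integral \<alpha> h"
    unfolding 1 2 by simp
  also have "a * sin (2*\<alpha>) = sin (\<theta> + \<alpha>)" using s2 by (simp add: a_def)
  also have "b * sin (2*\<alpha>) = - sin (\<theta> - \<alpha>)"
    using s2 sin_minus[of "\<theta> - \<alpha>"] by (simp add: b_def)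
  finally show ?thesis unfolding Ddir by (simp add: scaleR_conv_of_real)
qed

lemma bdry_integral_Cc_smooth:
  assumes h: "h \<in> Cc_smooth UNIV"
  shows "integrable S h" "(\<integral>x. h x \<partial>S) = edge_integral \<alpha> h + edge_integral (- \<alpha>) h"
proof -
  let ?g = "boundary_param \<alpha>"
  have hm: "h \<in> borel_measurable borel" by (rule Cc_smooth_measurable[OF h])
  obtain R where R: "R \<ge> 0" "\<And>x. R < norm x \<Longrightarrow> h x = 0" by (rule Cc_smooth_radius[OF h]) blast
  obtain B where B: "B \<ge> 0" "\<And>x. cmod (h x) \<le> B" by (rule Cc_smooth_bounded[OF h]) blast
  have ng: "norm (?g s) = \<bar>s\<bar>" for s by (simp add: boundary_param_def norm_dir)
  have hgm: "(\<lambda>s. h (?g s)) \<in> borel_measurable borel"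
    using measurable_compose[OF boundary_param_measurable hm] .
  have i: "integrable lborel (\<lambda>s. h (?g s))"
  proof (rule Bochner_Integration.integrable_bound[where f="\<lambda>s. indicator {-R..R} s *\<^sub>R B"])
    show "integrable lborel (\<lambda>s. indicator {-R..R} s *\<^sub>R B)"
      by (intro integrable_scaleR_left integrable_real_indicator impI) (auto simp: emeasure_lborel_Icc_eq)
    show "AE s in lborel. norm (h (?g s)) \<le> norm (indicator {-R..R} s *\<^sub>R B)"
    proof (rule AE_I2)
      fix s show "norm (h (?g s)) \<le> norm (indicator {-R..R} s *\<^sub>R B)"
        using R(2)[of "?g s"] B ng[of s] by (cases "\<bar>s\<bar> \<le> R") (auto simp: indicator_def)
    qed
  qed (use hgm in auto)
  then show "integrable S h" using integral_bdry(2)[OF \<alpha> hm] by simp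
  have i1: "integrable lborel (\<lambda>s. indicator {0<..} s *\<^sub>R h (?g s))" "integrable lborel (\<lambda>s. indicator {..<0} s *\<^sub>R h (?g s))"
    using i by (intro integrable_mult_indicator; simp)+
  have "(\<integral>x. h x \<partial>S) = (\<integral>s. h (?g s) \<partial>lborel)" by (rule integral_bdry(1)[OF \<alpha> hm])
  also have "\<dots> = (\<integral>s. indicator {0<..} s *\<^sub>R h (?g s) + indicator {..<0} s *\<^sub>R h (?g s) \<partial>lborel)"
  proof (rule integral_cong_AE)
    show "AE s in lborel. h (?g s) = indicator {0<..} s *\<^sub>R h (?g s) + indicator {..<0} s *\<^sub>R h (?g s)"
      using AE_lborel_singleton[of 0] by eventually_elim (auto simp: indicator_def)
  qed (use hgm i1 in auto)
  also have "\<dots> = (\<integral>s. indicator {0<..} s *\<^sub>R h (?g s) \<partial>lborel) + (\<integral>s. indicator {..<0} s *\<^sub>R h (?g s) \<partial>lborel)"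
    using i1 by (rule Bochner_Integration.integral_add)
  also have "(\<integral>s. indicator {0<..} s *\<^sub>R h (?g s) \<partial>lborel) = edge_integral \<alpha> h"
    unfolding edge_integral_def by (intro Bochner_Integration.integral_cong) (auto simp: boundary_param_def indicator_def)
  also have "(\<integral>s. indicator {..<0} s *\<^sub>R h (?g s) \<partial>lborel) = \<bar>-1\<bar> *\<^sub>R (\<integral>s. indicator {..<0} (0 + (-1) * s) *\<^sub>R h (?g (0 + (-1) * s)) \<partial>lborel)"
    by (rule lborel_integral_real_affine) simp
  also have "\<dots> = edge_integral (- \<alpha>) h"
    unfolding edge_integral_def by (simp, intro Bochner_Integration.integral_cong) (auto simp: boundary_param_def indicator_def)
  finally show "(\<integral>x. h x \<partial>S) = edge_integral \<alpha> h + edge_integral (- \<alpha>) h" .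
qed

lemma Cc_smooth_L2_S:
  assumes "\<psi> \<in> Cc_smooth UNIV" shows "\<psi> \<in> L2 S"
proof -
  have "(\<lambda>x. cnj (\<psi> x) * \<psi> x) \<in> Cc_smooth UNIV"
    by (intro Cc_smooth_mult assms C_k_cnj Cc_smooth_C_k[OF assms])
  from integrable_Re[OF bdry_integral_Cc_smooth(1)[OF this]]
  have "integrable S (\<lambda>x. (cmod (\<psi> x))\<^sup>2)" by (simp add: cmod_def power2_eq_square)
  then show ?thesis using borel_measurable_bdry[OF Cc_smooth_measurable[OF assms]] by (simp add: L2_def)
qed

lemma zero_on_edges:
  assumes "\<phi> \<in> Cc_smooth U"
  shows "\<phi> (t *\<^sub>R dir \<alpha>) = 0" "\<phi> (t *\<^sub>R dir (- \<alpha>)) = 0"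
proof -
  have z: "\<phi> x = 0" if "x \<notin> U" for x
    using assms that closure_subset[of "{x. \<phi> x \<noteq> 0}"] unfolding Cc_smooth_def by auto
  show "\<phi> (t *\<^sub>R dir \<alpha>) = 0" "\<phi> (t *\<^sub>R dir (- \<alpha>)) = 0"
    using sector_combo_iff[OF \<alpha>, of t 0] sector_combo_iff[OF \<alpha>, of 0 t] by (intro z; simp)+
qed

lemma integral_partial_deriv_zero:
  assumes \<phi>: "\<phi> \<in> Cc_smooth U" shows "(\<integral>x. partial_deriv i \<phi> x \<partial>M) = 0"
proof -
  have \<phi>': "\<phi> \<in> Cc_smooth UNIV" using \<phi> by (rule Cc_smooth_mono) simp
  have e: "edge_integral \<alpha> \<phi> = 0" "edge_integral (- \<alpha>) \<phi> = 0"
    by (simp_all add: edge_integral_def zero_on_edges[OF \<phi>])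
  have "i = 1 \<or> i = 2" by (rule exhaust_2)
  then show ?thesis
    using directional_Green[OF \<phi>', of 0] directional_Green[OF \<phi>', of "pi/2"] e by auto
qed

lemma smooth_weak_grad:
  assumes w: "\<And>k. C_k k w" and P: "\<And>i. partial_deriv i w \<in> L2 M"
  shows "is_weak_grad U w (grad w)"
  unfolding is_weak_grad_def grad_nth
proof (intro allI conjI ballI P)
  fix i \<phi> assume \<phi>: "\<phi> \<in> Cc_smooth U"
  have wd: "w differentiable at x" for x using w[of 1] by simp
  have Pw: "C_k k (partial_deriv i w)" for k using w[of "Suc k"] by simp
  have c: "(\<lambda>x. w x * \<phi> x) \<in> Cc_smooth U" "(\<lambda>x. partial_deriv i w x * \<phi> x) \<in> Cc_smooth U"
    "(\<lambda>x. w x * partial_deriv i \<phi> x) \<in> Cc_smooth U"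
    by (intro Cc_smooth_mult \<phi> Cc_smooth_partial_deriv w Pw)+
  have "0 = (\<integral>x. partial_deriv i (\<lambda>x. w x * \<phi> x) x \<partial>M)" using integral_partial_deriv_zero[OF c(1)] by simp
  also have "\<dots> = (\<integral>x. partial_deriv i w x * \<phi> x + w x * partial_deriv i \<phi> x \<partial>M)"
    by (simp add: partial_deriv_mult[OF wd Cc_smooth_differentiable[OF \<phi>]])
  also have "\<dots> = (\<integral>x. partial_deriv i w x * \<phi> x \<partial>M) + (\<integral>x. w x * partial_deriv i \<phi> x \<partial>M)"
    using Cc_smooth_integrable_M[OF c(2)] Cc_smooth_integrable_M[OF c(3)] by (rule Bochner_Integration.integral_add)
  finally show "(\<integral>x. w x * partial_deriv i \<phi> x \<partial>M) = - (\<integral>x. partial_deriv i w x * \<phi> x \<partial>M)"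
    by (simp add: eq_neg_iff_add_eq_0 add.commute)
qed

lemma Cc_smooth_weak_grad: "\<phi> \<in> Cc_smooth UNIV \<Longrightarrow> is_weak_grad U \<phi> (grad \<phi>)"
  by (intro smooth_weak_grad Cc_smooth_C_k Cc_smooth_L2_M[OF Cc_smooth_partial_deriv])

text \<open>The mollifiers are supported in \<open>-U\<close>. Since \<open>U + U \<subseteq> U\<close>, their reflected translates to points of
  \<open>U\<close> are test functions on \<open>U\<close>.\<close>
lemma inward_mollifiers:
  obtains \<rho> where "\<And>n::nat. mollifier (2 / real (Suc n)) (\<rho> n)"
    "\<And>n x. x \<in> U \<Longrightarrow> (\<lambda>y. complex_of_real (\<rho> n (x - y))) \<in> Cc_smooth U"
proof -
  define c where "c n = - ((1 / real (Suc n)) *\<^sub>R dir 0)" for n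
  define r where "r n = sin \<alpha> / (2 * real (Suc n))" for n
  define \<rho> where "\<rho> n x = bump (c n) (r n) x / (\<integral>x. bump (c n) (r n) x \<partial>lborel)" for n x
  have r: "r n > 0" for n using sin_pos by (simp add: r_def)
  have moll: "mollifier (2 / real (Suc n)) (\<rho> n)" for n
    unfolding \<rho>_def
  proof (rule mollifier_bump[OF r])
    have "sin \<alpha> / (2 * real (Suc n)) \<le> 2 / (2 * real (Suc n))"
      by (intro divide_right_mono order_trans[OF sin_le_one]) auto
    also have "2 / (2 * real (Suc n)) = 1 / real (Suc n)" by (simp del: of_nat_Suc)
    finally have "r n \<le> 1 / real (Suc n)" unfolding r_def .
    then show "norm (c n) + r n \<le> 2 / real (Suc n)" by (simp add: c_def norm_dir)
  qed
  moreover have "(\<lambda>y. complex_of_real (\<rho> n (x - y))) \<in> Cc_smooth U" if x: "x \<in> U" for n x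
  proof (rule Cc_smoothI)
    have "(\<lambda>x. complex_of_real (\<rho> n x)) \<in> Cc_smooth UNIV" using moll by (simp add: mollifier_def)
    then show "C_k k (\<lambda>y. complex_of_real (\<rho> n (x - y)))" for k
      by (rule Cc_smooth_C_k[OF Cc_smooth_reflect])
    show "compact ((\<lambda>z. x - z) ` cball (c n) (r n))"
      by (intro compact_continuous_image continuous_intros compact_cball)
    show "{y. complex_of_real (\<rho> n (x - y)) \<noteq> 0} \<subseteq> (\<lambda>z. x - z) ` cball (c n) (r n)"
    proof safe
      fix y assume "complex_of_real (\<rho> n (x - y)) \<noteq> 0"
      then have "bump (c n) (r n) (x - y) \<noteq> 0" by (auto simp: \<rho>_def)
      then have "x - y \<in> cball (c n) (r n)" using bump_pos_iff[OF r] ball_subset_cball by blast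
      then show "y \<in> (\<lambda>z. x - z) ` cball (c n) (r n)" by (rule rev_image_eqI) simp
    qed
    show "(\<lambda>z. x - z) ` cball (c n) (r n) \<subseteq> U"
    proof safe
      fix z assume z: "z \<in> cball (c n) (r n)"
      have e: "edge_dist \<beta> (x - z) = edge_dist \<beta> x + sin \<beta> / real (Suc n) - edge_dist \<beta> (z - c n)" for \<beta>
        by (simp add: edge_dist_def c_def algebra_simps)
      have "\<bar>edge_dist \<beta> (z - c n)\<bar> \<le> r n" for \<beta>
        using edge_dist_abs_le[of \<beta> "z - c n"] z by (simp add: dist_norm norm_minus_commute)
      note b = this[of \<alpha>] this[of "- \<alpha>"]
      have "r n < sin \<alpha> / real (Suc n)" unfolding r_def using sin_pos by (intro divide_strict_left_mono) auto
      then show "x - z \<in> U"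
        using x b e[of \<alpha>] e[of "- \<alpha>"] unfolding sector_eq[OF \<alpha>] by auto
    qed
  qed
  ultimately show ?thesis by (rule that)
qed

lemma two_over_Suc: "(\<lambda>n. 2 / real (Suc n)) \<longlonglongrightarrow> 0"
  using tendsto_mult[OF tendsto_const[of 2] LIMSEQ_inverse_real_of_nat] by (simp add: inverse_eq_divide)

text \<open>The fundamental lemma of the calculus of variations: a function that annihilates all test functions
  has mollifications that vanish on \<open>U\<close>.\<close>
lemma test_functions_separate:
  assumes w: "w \<in> L2 M" and z: "\<And>\<phi>. \<phi> \<in> Cc_smooth U \<Longrightarrow> (\<integral>x. w x * \<phi> x \<partial>M) = 0"
  shows "AE x in M. w x = 0"
proof -
  obtain f where f: "f \<in> L2 lborel" "AE x in M. f x = w x"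
    and int: "\<And>g. g \<in> borel_measurable borel \<Longrightarrow> (\<integral>x. w x * g x \<partial>M) = (\<integral>x. f x * g x \<partial>lborel)"
    by (rule L2_zero_extension[OF w U_borel]) blast
  obtain \<rho> where moll: "\<And>n::nat. mollifier (2 / real (Suc n)) (\<rho> n)"
    and test: "\<And>n x. x \<in> U \<Longrightarrow> (\<lambda>y. complex_of_real (\<rho> n (x - y))) \<in> Cc_smooth U"
    by (rule inward_mollifiers) blast
  define F where "F n = conv f (\<lambda>x. complex_of_real (\<rho> n x))" for n
  have FL: "F n \<in> L2 lborel" for n unfolding F_def by (rule conv_L2[OF f(1) moll])
  have F0: "F n x = 0" if "x \<in> U" for n x
    using int[OF Cc_smooth_measurable[OF test[OF that]]] z[OF test[OF that]] by (simp add: F_def conv_def)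
  have lim: "(\<lambda>n. L2_normsq lborel (\<lambda>x. F n x - f x)) \<longlonglongrightarrow> 0"
    unfolding F_def by (rule conv_tendsto[OF f(1) moll two_over_Suc])
  have fM: "f \<in> L2 M" using L2_lborel_imp_lebesgue_on(1)[OF f(1) U_borel] .
  have "L2_normsq M f \<le> L2_normsq lborel (\<lambda>x. F n x - f x)" for n
  proof -
    have "L2_normsq M f = L2_normsq M (\<lambda>x. F n x - f x)"
      unfolding L2_normsq_def by (intro Bochner_Integration.integral_cong) (auto simp: F0 space_restrict_space)
    also have "\<dots> \<le> L2_normsq lborel (\<lambda>x. F n x - f x)"
      by (intro L2_lborel_imp_lebesgue_on(2) L2_diff FL f U_borel)
    finally show ?thesis .
  qed
  then have "L2_normsq M f \<le> 0" using LIMSEQ_le_const[OF lim] by blast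
  then have "AE x in M. f x = 0" using L2_normsq_eq_0[OF fM] L2_normsq_nonneg[of M f] by simp
  with f(2) show ?thesis by eventually_elim simp
qed

lemma weak_grad_L2: "is_weak_grad U u G \<Longrightarrow> (\<lambda>x. G x $ i) \<in> L2 M"
  by (simp add: is_weak_grad_def)

lemma weak_grad_unique:
  assumes "is_weak_grad U u G" "is_weak_grad U u G'"
  shows "AE x in M. G x $ i = G' x $ i"
proof -
  have L: "(\<lambda>x. G x $ i) \<in> L2 M" "(\<lambda>x. G' x $ i) \<in> L2 M" using assms by (auto intro: weak_grad_L2)
  have "AE x in M. G x $ i - G' x $ i = 0"
  proof (rule test_functions_separate[OF L2_diff[OF L]])
    fix \<phi> assume \<phi>: "\<phi> \<in> Cc_smooth U"
    have "(\<integral>x. u x * partial_deriv i \<phi> x \<partial>M) = - (\<integral>x. G x $ i * \<phi> x \<partial>M)"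
      "(\<integral>x. u x * partial_deriv i \<phi> x \<partial>M) = - (\<integral>x. G' x $ i * \<phi> x \<partial>M)"
      using assms \<phi> unfolding is_weak_grad_def by blast+
    then have "(\<integral>x. G x $ i * \<phi> x \<partial>M) = (\<integral>x. G' x $ i * \<phi> x \<partial>M)" by simp
    then show "(\<integral>x. (G x $ i - G' x $ i) * \<phi> x \<partial>M) = 0"
      using L2_mult_integrable[OF L(1) Cc_smooth_L2_M[OF \<phi>]] L2_mult_integrable[OF L(2) Cc_smooth_L2_M[OF \<phi>]]
      by (simp add: left_diff_distrib)
  qed
  then show ?thesis by simp
qed

text \<open>\<^const>\<open>weak_grad\<close> is chosen by Hilbert's operator; uniqueness makes every other weak gradient as good.\<close>
lemma weak_grad_AE:
  assumes "is_weak_grad U u G"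
  shows "is_weak_grad U u (weak_grad U u)" "AE x in M. weak_grad U u x $ i = G x $ i"
proof -
  show "is_weak_grad U u (weak_grad U u)" using someI[of "is_weak_grad U u", OF assms] by (simp add: weak_grad_def)
  then show "AE x in M. weak_grad U u x $ i = G x $ i" using assms by (rule weak_grad_unique)
qed

lemma H1_normsq_eq:
  assumes "is_weak_grad U u G"
  shows "H1_normsq U u = L2_normsq M u + (\<Sum>i\<in>UNIV. L2_normsq M (\<lambda>x. G x $ i))"
proof -
  have "L2_normsq M (\<lambda>x. weak_grad U u x $ i) = L2_normsq M (\<lambda>x. G x $ i)" for i
  proof (rule L2_normsq_cong_AE(2)[OF weak_grad_L2[OF assms]])
    show "(\<lambda>x. weak_grad U u x $ i) \<in> borel_measurable M"
      by (rule L2_measurable[OF weak_grad_L2[OF weak_grad_AE(1)[OF assms]]])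
    show "AE x in M. G x $ i = weak_grad U u x $ i" using weak_grad_AE(2)[OF assms, of i] by eventually_elim simp
  qed
  then show ?thesis by (simp add: H1_normsq_def)
qed

lemma weak_grad_diff:
  assumes u: "u \<in> L2 M" "is_weak_grad U u G" and v: "v \<in> L2 M" "is_weak_grad U v H"
  shows "is_weak_grad U (\<lambda>x. u x - v x) (\<lambda>x. G x - H x)"
  unfolding is_weak_grad_def vector_minus_component
proof (intro allI conjI ballI)
  fix i show "(\<lambda>x. G x $ i - H x $ i) \<in> L2 M" using u v by (intro L2_diff weak_grad_L2)
  fix \<phi> assume \<phi>: "\<phi> \<in> Cc_smooth U"
  note P = Cc_smooth_L2_M[OF Cc_smooth_partial_deriv[OF \<phi>, of i]] Cc_smooth_L2_M[OF \<phi>]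
  have e: "(\<integral>x. u x * partial_deriv i \<phi> x \<partial>M) = - (\<integral>x. G x $ i * \<phi> x \<partial>M)"
    "(\<integral>x. v x * partial_deriv i \<phi> x \<partial>M) = - (\<integral>x. H x $ i * \<phi> x \<partial>M)"
    using u v \<phi> unfolding is_weak_grad_def by blast+
  show "(\<integral>x. (u x - v x) * partial_deriv i \<phi> x \<partial>M) = - (\<integral>x. (G x $ i - H x $ i) * \<phi> x \<partial>M)"
    using L2_mult_integrable[OF u(1) P(1)] L2_mult_integrable[OF v(1) P(1)]
      L2_mult_integrable[OF weak_grad_L2[OF u(2), of i] P(2)] L2_mult_integrable[OF weak_grad_L2[OF v(2), of i] P(2)]
    by (simp add: left_diff_distrib e)
qed

lemma H1_normsq_diff_triangle:
  assumes u: "u \<in> H1 U" and v: "v \<in> H1 U" and w: "w \<in> H1 U"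
  shows "H1_normsq U (\<lambda>x. u x - w x) \<le> 2 * H1_normsq U (\<lambda>x. u x - v x) + 2 * H1_normsq U (\<lambda>x. v x - w x)"
proof -
  obtain G H K where g: "is_weak_grad U u G" "is_weak_grad U v H" "is_weak_grad U w K"
    and L: "u \<in> L2 M" "v \<in> L2 M" "w \<in> L2 M" using assms by (auto simp: H1_def)
  have "L2_normsq M (\<lambda>x. G x $ i - K x $ i) \<le> 2 * L2_normsq M (\<lambda>x. G x $ i - H x $ i) + 2 * L2_normsq M (\<lambda>x. H x $ i - K x $ i)" for i
    using g by (intro L2_normsq_diff_triangle weak_grad_L2)
  note this[of 1] this[of 2] L2_normsq_diff_triangle[OF L]
  then show ?thesis
    by (simp add: H1_normsq_eq[OF weak_grad_diff[OF L(1) g(1) L(3) g(3)]] H1_normsq_eq[OF weak_grad_diff[OF L(1) g(1) L(2) g(2)]]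
       H1_normsq_eq[OF weak_grad_diff[OF L(2) g(2) L(3) g(3)]] sum_2)
qed

lemma H1_normsq_minus_commute:
  assumes u: "u \<in> H1 U" and v: "v \<in> H1 U"
  shows "H1_normsq U (\<lambda>x. u x - v x) = H1_normsq U (\<lambda>x. v x - u x)"
proof -
  obtain G H where g: "is_weak_grad U u G" "is_weak_grad U v H"
    and L: "u \<in> L2 M" "v \<in> L2 M" using assms by (auto simp: H1_def)
  show ?thesis
    by (simp add: H1_normsq_eq[OF weak_grad_diff[OF L(1) g(1) L(2) g(2)]] H1_normsq_eq[OF weak_grad_diff[OF L(2) g(2) L(1) g(1)]]
       L2_normsq_minus_commute[of M u] L2_normsq_minus_commute[of M "\<lambda>x. G x $ _"])
qed

lemma Cc_smooth_H1: "\<phi> \<in> Cc_smooth UNIV \<Longrightarrow> \<phi> \<in> H1 U"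
  unfolding H1_def using Cc_smooth_weak_grad Cc_smooth_L2_M by blast

end

section \<open>Density of smooth functions\<close>

text \<open>The factor \<open>exp 1\<close> normalizes the maximum, attained at the origin, to 1.\<close>
definition cutoff :: "nat \<Rightarrow> real^2 \<Rightarrow> complex" where
  "cutoff n x = complex_of_real (exp 1 * bump 0 1 ((1 / real (Suc n)) *\<^sub>R x))"

lemma cutoff_base: "(\<lambda>x. complex_of_real (exp 1 * bump 0 1 x)) \<in> Cc_smooth UNIV"
  using Cc_smooth_mult[OF Cc_smooth_bump[of 1 0 UNIV] C_k_const[of _ "complex_of_real (exp 1)"]] by simp

lemma cutoff_Cc_smooth: "cutoff n \<in> Cc_smooth UNIV"
proof (rule Cc_smoothI)
  show "C_k k (cutoff n)" for k
    using C_k_affine_comp[OF Cc_smooth_C_k[OF cutoff_base], of k "1 / real (Suc n)" 0] by (simp add: cutoff_def[abs_def])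
  show "{x. cutoff n x \<noteq> 0} \<subseteq> cball 0 (real (Suc n))"
    using bump_pos_iff[of 1 0] by (auto simp: cutoff_def field_simps simp del: of_nat_Suc)
qed auto

lemma cutoff_le_1: "cmod (cutoff n x) \<le> 1"
proof -
  have "flat 0 t \<le> exp (- 1)" if "t \<le> 1" for t
    using that by (auto simp: flat_def)
  then have "bump 0 1 y \<le> exp (- 1)" for y unfolding bump_def by simp
  then have "exp 1 * bump 0 1 y \<le> exp 1 * exp (- 1)" for y by (intro mult_left_mono) auto
  then show ?thesis using bump_nonneg by (simp add: cutoff_def abs_mult exp_minus norm_mult)
qed

lemma cutoff_tendsto_1: "(\<lambda>n. cutoff n x) \<longlonglongrightarrow> 1"
proof -
  have "continuous_on UNIV (\<lambda>x. complex_of_real (exp 1 * bump 0 1 x))"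
    by (rule C_k_imp_continuous[OF Cc_smooth_C_k[OF cutoff_base]])
  then have "isCont (\<lambda>x. complex_of_real (exp 1 * bump 0 1 x)) 0" by (simp add: continuous_on_eq_continuous_at)
  moreover have "(\<lambda>n. (1 / real (Suc n)) *\<^sub>R x) \<longlonglongrightarrow> 0 *\<^sub>R x"
    using LIMSEQ_inverse_real_of_nat by (intro tendsto_intros) (simp add: inverse_eq_divide)
  ultimately have "(\<lambda>n. cutoff n x) \<longlonglongrightarrow> complex_of_real (exp 1 * bump 0 1 0)"
    unfolding cutoff_def using isCont_tendsto_compose[of 0 "\<lambda>x. complex_of_real (exp 1 * bump 0 1 x)"] by simp
  also have "exp 1 * bump 0 1 0 = 1" by (simp add: bump_def flat_def exp_minus)
  finally show ?thesis by simp
qed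

lemma cutoff_partial_deriv_bound:
  obtains C where "C \<ge> 0" "\<And>n i x. cmod (partial_deriv i (cutoff n) x) \<le> C / real (Suc n)"
proof -
  let ?b = "\<lambda>x. complex_of_real (exp 1 * bump 0 1 x)"
  obtain C1 where C1: "C1 \<ge> 0" "\<And>x. cmod (partial_deriv 1 ?b x) \<le> C1"
    by (rule Cc_smooth_bounded[OF Cc_smooth_partial_deriv[OF cutoff_base]]) blast
  obtain C2 where C2: "C2 \<ge> 0" "\<And>x. cmod (partial_deriv 2 ?b x) \<le> C2"
    by (rule Cc_smooth_bounded[OF Cc_smooth_partial_deriv[OF cutoff_base]]) blast
  have "cmod (partial_deriv i (cutoff n) x) \<le> (C1 + C2) / real (Suc n)" for n i x
  proof -
    have "partial_deriv i (cutoff n) x = complex_of_real (1 / real (Suc n)) * partial_deriv i ?b ((1 / real (Suc n)) *\<^sub>R x + 0)"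
      using partial_deriv_affine_comp[where c="1 / real (Suc n)" and x=x and b=0 and i=i, OF Cc_smooth_differentiable[OF cutoff_base]]
      by (simp add: cutoff_def[abs_def])
    moreover have "cmod (partial_deriv i ?b y) \<le> C1 + C2" for y
      using exhaust_2[of i] C1(1) C1(2)[of y] C2(1) C2(2)[of y] by auto
    ultimately show ?thesis by (simp add: norm_mult norm_divide divide_right_mono del: of_nat_Suc)
  qed
  then show ?thesis using C1 C2 by (intro that[of "C1 + C2"]) auto
qed

lemma cutoff_L2_tendsto:
  assumes f: "f \<in> L2 N" and m: "\<And>n. cutoff n \<in> borel_measurable N"
  shows "(\<lambda>n. L2_normsq N (\<lambda>x. cutoff n x * f x - f x)) \<longlonglongrightarrow> 0"
proof (rule L2_dominated_convergence[OF f, where C=2])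
  show "(\<lambda>x. cutoff n x * f x - f x) \<in> borel_measurable N" for n
    using m L2_measurable[OF f] by measurable
  fix n x
  have "cmod (cutoff n x * f x - f x) \<le> cmod (cutoff n x) * cmod (f x) + cmod (f x)"
    using norm_triangle_ineq4[of "cutoff n x * f x" "f x"] by (simp add: norm_mult)
  also have "\<dots> \<le> 1 * cmod (f x) + cmod (f x)" by (intro add_mono mult_right_mono cutoff_le_1) auto
  finally show "cmod (cutoff n x * f x - f x) \<le> 2 * cmod (f x)" by simp
next
  show "AE x in N. (\<lambda>n. cutoff n x * f x - f x) \<longlonglongrightarrow> 0"
    by (intro AE_I2) (auto intro!: tendsto_eq_intros cutoff_tendsto_1)
qed

context acute_sector
begin

lemma cutoff_measurable_M: "cutoff n \<in> borel_measurable M"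
  by (intro borel_imp_lebesgue_on Cc_smooth_measurable[OF cutoff_Cc_smooth])

text \<open>The gradient of a cutoff is of order \<open>1/n\<close>.\<close>
lemma cutoff_grad_tendsto:
  assumes B: "\<And>n. F n \<in> L2 M" "\<And>n. L2_normsq M (F n) \<le> K"
  shows "(\<lambda>n. L2_normsq M (\<lambda>x. partial_deriv i (cutoff n) x * F n x)) \<longlonglongrightarrow> 0"
proof -
  obtain C where C: "C \<ge> 0" "\<And>n i x. cmod (partial_deriv i (cutoff n) x) \<le> C / real (Suc n)"
    by (rule cutoff_partial_deriv_bound) blast
  show ?thesis
  proof (rule tendsto_sandwich[OF _ _ tendsto_const])
    have "(\<lambda>n. (C * (1 / real (Suc n)))\<^sup>2 * K) \<longlonglongrightarrow> (C * 0)\<^sup>2 * K"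
      using LIMSEQ_inverse_real_of_nat by (intro tendsto_intros) (simp add: inverse_eq_divide)
    then show "(\<lambda>n. (C / real (Suc n))\<^sup>2 * K) \<longlonglongrightarrow> 0" by simp
    show "\<forall>\<^sub>F n in sequentially. L2_normsq M (\<lambda>x. partial_deriv i (cutoff n) x * F n x) \<le> (C / real (Suc n))\<^sup>2 * K"
    proof (rule always_eventually, rule allI)
      fix n
      have "L2_normsq M (\<lambda>x. partial_deriv i (cutoff n) x * F n x) \<le> (C / real (Suc n))\<^sup>2 * L2_normsq M (F n)"
        by (intro L2_normsq_bounded_mult B C borel_imp_lebesgue_on Cc_smooth_measurable[OF Cc_smooth_partial_deriv[OF cutoff_Cc_smooth]])
      also have "\<dots> \<le> (C / real (Suc n))\<^sup>2 * K" by (intro mult_left_mono B) auto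
      finally show "L2_normsq M (\<lambda>x. partial_deriv i (cutoff n) x * F n x) \<le> (C / real (Suc n))\<^sup>2 * K" .
    qed
  qed (auto simp: L2_normsq_nonneg)
qed

lemma cutoff_mult:
  assumes F: "\<And>k. C_k k F"
  shows "(\<lambda>x. cutoff n x * F x) \<in> Cc_smooth UNIV"
    "partial_deriv i (\<lambda>x. cutoff n x * F x) x = cutoff n x * partial_deriv i F x + partial_deriv i (cutoff n) x * F x"
proof -
  show "(\<lambda>x. cutoff n x * F x) \<in> Cc_smooth UNIV"
    using Cc_smooth_mult[OF cutoff_Cc_smooth[of n] F] by (simp add: mult.commute)
  have "F differentiable at x" using F[of 1] by simp
  then show "partial_deriv i (\<lambda>x. cutoff n x * F x) x = cutoff n x * partial_deriv i F x + partial_deriv i (cutoff n) x * F x"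
    by (simp add: partial_deriv_mult[OF Cc_smooth_differentiable[OF cutoff_Cc_smooth]] add.commute)
qed

lemma L2_normsq_sum3:
  assumes "f \<in> L2 M" "g \<in> L2 M" "h \<in> L2 M"
  shows "L2_normsq M (\<lambda>x. f x + g x - h x) \<le> 2 * L2_normsq M (\<lambda>x. f x - h x) + 2 * L2_normsq M g"
  using L2_normsq_add_le[OF L2_diff[OF assms(1,3)] assms(2)] by (simp add: algebra_simps)

text \<open>Applied twice: to the mollifications of \<open>u\<close>, and to a constant sequence when \<open>u\<close> is smooth but does not
  have compact support.\<close>
lemma cutoff_H1_tendsto:
  assumes u: "u \<in> L2 M" "is_weak_grad U u G"
    and F: "\<And>n k. C_k k (F n)" "\<And>n. F n \<in> L2 M" "\<And>n i. partial_deriv i (F n) \<in> L2 M"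
    and lim: "(\<lambda>n. L2_normsq M (\<lambda>x. F n x - u x)) \<longlonglongrightarrow> 0"
      "\<And>i. (\<lambda>n. L2_normsq M (\<lambda>x. partial_deriv i (F n) x - G x $ i)) \<longlonglongrightarrow> 0"
  shows "(\<lambda>n. H1_normsq U (\<lambda>x. cutoff n x * F n x - u x)) \<longlonglongrightarrow> 0"
proof -
  have cm: "cutoff n \<in> borel_measurable M" for n by (rule cutoff_measurable_M)
  have cl: "(\<lambda>n. L2_normsq M (\<lambda>x. cutoff n x * H n x - v x)) \<longlonglongrightarrow> 0"
    if v: "v \<in> L2 M" and H: "\<And>n. H n \<in> L2 M" and l: "(\<lambda>n. L2_normsq M (\<lambda>x. H n x - v x)) \<longlonglongrightarrow> 0" for v H
  proof (rule tendsto_sandwich[OF _ _ tendsto_const])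
    show "(\<lambda>n. 2 * L2_normsq M (\<lambda>x. H n x - v x) + 2 * L2_normsq M (\<lambda>x. cutoff n x * v x - v x)) \<longlonglongrightarrow> 0"
      using l cutoff_L2_tendsto[OF v cm] by (auto intro!: tendsto_eq_intros)
    show "\<forall>\<^sub>F n in sequentially. L2_normsq M (\<lambda>x. cutoff n x * H n x - v x)
      \<le> 2 * L2_normsq M (\<lambda>x. H n x - v x) + 2 * L2_normsq M (\<lambda>x. cutoff n x * v x - v x)"
    proof (rule always_eventually, rule allI)
      fix n
      have c: "(\<lambda>x. cutoff n x * w x) \<in> L2 M" if "w \<in> L2 M" for w
        using that cm cutoff_le_1 by (rule L2_bounded_mult)
      have "L2_normsq M (\<lambda>x. cutoff n x * H n x - v x)
        \<le> 2 * L2_normsq M (\<lambda>x. cutoff n x * H n x - cutoff n x * v x) + 2 * L2_normsq M (\<lambda>x. cutoff n x * v x - v x)"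
        by (intro L2_normsq_diff_triangle c H v)
      moreover have "L2_normsq M (\<lambda>x. cutoff n x * (H n x - v x)) \<le> 1\<^sup>2 * L2_normsq M (\<lambda>x. H n x - v x)"
        by (intro L2_normsq_bounded_mult L2_diff H v cm cutoff_le_1)
      ultimately show "L2_normsq M (\<lambda>x. cutoff n x * H n x - v x)
          \<le> 2 * L2_normsq M (\<lambda>x. H n x - v x) + 2 * L2_normsq M (\<lambda>x. cutoff n x * v x - v x)"
        by (simp add: right_diff_distrib)
    qed
  qed (auto simp: L2_normsq_nonneg)
  have "convergent (\<lambda>n. L2_normsq M (\<lambda>x. F n x - u x))" using lim(1) by (auto simp: convergent_def)
  then have "Bseq (\<lambda>n. L2_normsq M (\<lambda>x. F n x - u x))" by (rule convergent_imp_Bseq)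
  then obtain K0 where "\<forall>n. norm (L2_normsq M (\<lambda>x. F n x - u x)) \<le> K0" by (rule BseqE)
  then have K0: "L2_normsq M (\<lambda>x. F n x - u x) \<le> K0" for n
    using abs_le_D1 unfolding real_norm_def by blast
  have K: "L2_normsq M (F n) \<le> 2 * K0 + 2 * L2_normsq M u" for n
    using L2_normsq_add_le[OF L2_diff[OF F(2)[of n] u(1)] u(1)] K0[of n] by simp
  have "H1_normsq U (\<lambda>x. cutoff n x * F n x - u x) = L2_normsq M (\<lambda>x. cutoff n x * F n x - u x) +
     (\<Sum>i\<in>UNIV. L2_normsq M (\<lambda>x. cutoff n x * partial_deriv i (F n) x + partial_deriv i (cutoff n) x * F n x - G x $ i))" for n
    using H1_normsq_eq[OF weak_grad_diff[OF Cc_smooth_L2_M[OF cutoff_mult(1)[OF F(1)[of _ n], of n]] Cc_smooth_weak_grad[OF cutoff_mult(1)[OF F(1)[of _ n]]] u]]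
    by (simp add: cutoff_mult(2)[OF F(1)])
  moreover have "(\<lambda>n. L2_normsq M (\<lambda>x. cutoff n x * partial_deriv i (F n) x + partial_deriv i (cutoff n) x * F n x - G x $ i)) \<longlonglongrightarrow> 0" for i
  proof (rule tendsto_sandwich[OF _ _ tendsto_const])
    show "(\<lambda>n. 2 * L2_normsq M (\<lambda>x. cutoff n x * partial_deriv i (F n) x - G x $ i) + 2 * L2_normsq M (\<lambda>x. partial_deriv i (cutoff n) x * F n x)) \<longlonglongrightarrow> 0"
      using cl[OF weak_grad_L2[OF u(2)] F(3) lim(2), of i] cutoff_grad_tendsto[OF F(2) K, of i] by (auto intro!: tendsto_eq_intros)
    show "\<forall>\<^sub>F n in sequentially. L2_normsq M (\<lambda>x. cutoff n x * partial_deriv i (F n) x + partial_deriv i (cutoff n) x * F n x - G x $ i)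
      \<le> 2 * L2_normsq M (\<lambda>x. cutoff n x * partial_deriv i (F n) x - G x $ i) + 2 * L2_normsq M (\<lambda>x. partial_deriv i (cutoff n) x * F n x)"
    proof (rule always_eventually, rule allI)
      fix n
      obtain C where C: "\<And>x. cmod (partial_deriv i (cutoff n) x) \<le> C"
        by (rule Cc_smooth_bounded[OF Cc_smooth_partial_deriv[OF cutoff_Cc_smooth]]) blast
      have "(\<lambda>x. partial_deriv i (cutoff n) x * F n x) \<in> L2 M"
        by (intro L2_bounded_mult[OF F(2) _ C] borel_imp_lebesgue_on Cc_smooth_measurable[OF Cc_smooth_partial_deriv[OF cutoff_Cc_smooth]])
      then show "L2_normsq M (\<lambda>x. cutoff n x * partial_deriv i (F n) x + partial_deriv i (cutoff n) x * F n x - G x $ i)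
        \<le> 2 * L2_normsq M (\<lambda>x. cutoff n x * partial_deriv i (F n) x - G x $ i) + 2 * L2_normsq M (\<lambda>x. partial_deriv i (cutoff n) x * F n x)"
        by (intro L2_normsq_sum3 weak_grad_L2[OF u(2)] L2_bounded_mult[OF F(3) cm cutoff_le_1])
    qed
  qed (auto simp: L2_normsq_nonneg)
  moreover have "(\<lambda>n. L2_normsq M (\<lambda>x. cutoff n x * F n x - u x)) \<longlonglongrightarrow> 0" by (rule cl[OF u(1) F(2) lim(1)])
  ultimately show ?thesis by (auto simp: sum_2 intro!: tendsto_eq_intros)
qed

text \<open>Mollification commutes with the weak gradient at points of \<open>U\<close>, because there the mollifier is a
  test function.\<close>
lemma Cc_smooth_dense_H1:
  assumes "u \<in> H1 U"
  obtains \<phi> where "\<And>n::nat. \<phi> n \<in> Cc_smooth UNIV" "(\<lambda>n. H1_normsq U (\<lambda>x. \<phi> n x - u x)) \<longlonglongrightarrow> 0"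
proof -
  obtain G where uL: "u \<in> L2 M" and G: "is_weak_grad U u G" using assms by (auto simp: H1_def)
  obtain \<rho> where moll: "\<And>n::nat. mollifier (2 / real (Suc n)) (\<rho> n)"
    and test: "\<And>n x. x \<in> U \<Longrightarrow> (\<lambda>y. complex_of_real (\<rho> n (x - y))) \<in> Cc_smooth U"
    by (rule inward_mollifiers) blast
  let ?\<rho> = "\<lambda>n x. complex_of_real (\<rho> n x)"
  have \<rho>C: "?\<rho> n \<in> Cc_smooth UNIV" for n using moll by (simp add: mollifier_def)
  obtain f where f: "f \<in> L2 lborel" "AE x in M. f x = u x"
    and fint: "\<And>g. g \<in> borel_measurable borel \<Longrightarrow> (\<integral>x. u x * g x \<partial>M) = (\<integral>x. f x * g x \<partial>lborel)"
    by (rule L2_zero_extension[OF uL U_borel]) blast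
  define F where "F n = conv f (?\<rho> n)" for n
  have approx: "(\<lambda>n. L2_normsq M (\<lambda>x. conv f (?\<rho> n) x - v x)) \<longlonglongrightarrow> 0"
    if f: "f \<in> L2 lborel" "AE x in M. f x = v x" and v: "v \<in> L2 M" for f v
  proof (rule tendsto_sandwich[OF _ _ tendsto_const conv_tendsto[OF f(1) moll two_over_Suc]])
    show "\<forall>\<^sub>F n in sequentially. L2_normsq M (\<lambda>x. conv f (?\<rho> n) x - v x) \<le> L2_normsq lborel (\<lambda>x. conv f (?\<rho> n) x - f x)"
    proof (rule always_eventually, rule allI)
      fix n
      have L: "(\<lambda>x. conv f (?\<rho> n) x - f x) \<in> L2 lborel" by (intro L2_diff conv_L2[OF f(1) moll] f(1))
      have "L2_normsq M (\<lambda>x. conv f (?\<rho> n) x - v x) = L2_normsq M (\<lambda>x. conv f (?\<rho> n) x - f x)"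
      proof (rule L2_normsq_cong_AE(2)[OF L2_lborel_imp_lebesgue_on(1)[OF L U_borel]])
        show "(\<lambda>x. conv f (?\<rho> n) x - v x) \<in> borel_measurable M"
          using L2_measurable[OF v] L2_measurable[OF L2_lborel_imp_lebesgue_on(1)[OF conv_L2[OF f(1) moll[of n]] U_borel]] by measurable
        show "AE x in M. conv f (?\<rho> n) x - f x = conv f (?\<rho> n) x - v x" using f(2) by eventually_elim simp
      qed
      also have "\<dots> \<le> L2_normsq lborel (\<lambda>x. conv f (?\<rho> n) x - f x)" by (rule L2_lborel_imp_lebesgue_on(2)[OF L U_borel])
      finally show "L2_normsq M (\<lambda>x. conv f (?\<rho> n) x - v x) \<le> L2_normsq lborel (\<lambda>x. conv f (?\<rho> n) x - f x)" .
    qed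
  qed (auto simp: L2_normsq_nonneg)
  have part: "partial_deriv i (F n) \<in> L2 M \<and> (\<lambda>n. L2_normsq M (\<lambda>x. partial_deriv i (F n) x - G x $ i)) \<longlonglongrightarrow> 0" for i n
  proof -
    obtain g where g: "g \<in> L2 lborel" "AE x in M. g x = G x $ i"
      and gint: "\<And>w. w \<in> borel_measurable borel \<Longrightarrow> (\<integral>x. G x $ i * w x \<partial>M) = (\<integral>x. g x * w x \<partial>lborel)"
      by (rule L2_zero_extension[OF weak_grad_L2[OF G, of i] U_borel]) blast
    have eq: "partial_deriv i (F n) x = conv g (?\<rho> n) x" if x: "x \<in> U" for n x
    proof -
      let ?t = "\<lambda>y. ?\<rho> n (x - y)"
      have pt: "partial_deriv i ?t y = - partial_deriv i (?\<rho> n) (x - y)" for y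
        using partial_deriv_affine_comp[where c="-1" and x=y and b=x and i=i, OF Cc_smooth_differentiable[OF \<rho>C[of n]]] by simp
      have "partial_deriv i (F n) x = (\<integral>y. f y * partial_deriv i (?\<rho> n) (x - y) \<partial>lborel)"
        unfolding F_def partial_deriv_conv[OF f(1) \<rho>C] conv_def ..
      also have "\<dots> = (\<integral>y. u y * partial_deriv i (?\<rho> n) (x - y) \<partial>M)"
        by (rule fint[symmetric, OF Cc_smooth_measurable[OF Cc_smooth_reflect[OF Cc_smooth_partial_deriv[OF \<rho>C]]]])
      also have "\<dots> = - (\<integral>y. u y * partial_deriv i ?t y \<partial>M)" by (simp add: pt)
      also have "\<dots> = (\<integral>y. G y $ i * ?t y \<partial>M)" using G test[OF x, of n] unfolding is_weak_grad_def by simp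
      also have "\<dots> = conv g (?\<rho> n) x" unfolding conv_def by (rule gint[OF Cc_smooth_measurable[OF test[OF x]]])
      finally show ?thesis .
    qed
    have gL: "conv g (?\<rho> n) \<in> L2 M" by (rule L2_lborel_imp_lebesgue_on(1)[OF conv_L2[OF g(1) moll] U_borel])
    have "partial_deriv i (F n) \<in> L2 M"
    proof (rule L2_normsq_cong_AE(1)[OF gL])
      have "C_k 0 (partial_deriv i (F n))" using C_k_conv[OF f(1) \<rho>C[of n], of "Suc 0"] unfolding F_def by simp
      then show "partial_deriv i (F n) \<in> borel_measurable M"
        by (intro borel_imp_lebesgue_on borel_measurable_continuous_onI) simp
      show "AE x in M. conv g (?\<rho> n) x = partial_deriv i (F n) x" by (intro AE_I2) (simp add: eq space_restrict_space)
    qed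
    moreover have "(\<lambda>n. L2_normsq M (\<lambda>x. partial_deriv i (F n) x - G x $ i)) = (\<lambda>n. L2_normsq M (\<lambda>x. conv g (?\<rho> n) x - G x $ i))"
      unfolding L2_normsq_def by (intro ext Bochner_Integration.integral_cong) (auto simp: eq space_restrict_space)
    ultimately show ?thesis using approx[OF g weak_grad_L2[OF G]] by simp
  qed
  have FL: "F n \<in> L2 M" for n unfolding F_def by (rule L2_lborel_imp_lebesgue_on(1)[OF conv_L2[OF f(1) moll] U_borel])
  have Fk: "C_k k (F n)" for k n unfolding F_def by (rule C_k_conv[OF f(1) \<rho>C])
  have Fl: "(\<lambda>n. L2_normsq M (\<lambda>x. F n x - u x)) \<longlonglongrightarrow> 0" unfolding F_def by (rule approx[OF f uL])
  show ?thesis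
  proof (rule that)
    show "(\<lambda>x. cutoff n x * F n x) \<in> Cc_smooth UNIV" for n by (rule cutoff_mult(1)[OF Fk])
    show "(\<lambda>n. H1_normsq U (\<lambda>x. cutoff n x * F n x - u x)) \<longlonglongrightarrow> 0"
      by (rule cutoff_H1_tendsto[OF uL G Fk FL _ Fl]) (use part in auto)
  qed
qed

end

context acute_sector
begin

section \<open>Boundary traces\<close>

text \<open>Green's formula for \<open>|\<phi>|\<^sup>2\<close> in the direction of the axis, whose scalar product with the outer normal is
  \<open>- sin \<alpha>\<close> on both edges.\<close>
lemma trace_inequality:
  assumes \<phi>: "\<phi> \<in> Cc_smooth UNIV"
  shows "sin \<alpha> * L2_normsq S \<phi> \<le> H1_normsq U \<phi>"
proof -
  define h where "h x = cnj (\<phi> x) * \<phi> x" for x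
  have hC: "h \<in> Cc_smooth UNIV"
    unfolding h_def by (intro Cc_smooth_mult \<phi> C_k_cnj Cc_smooth_C_k[OF \<phi>])
  have heq: "h x = complex_of_real ((cmod (\<phi> x))\<^sup>2)" for x
    unfolding h_def complex_norm_square by (simp add: mult.commute)
  have hS: "(\<integral>x. h x \<partial>S) = complex_of_real (L2_normsq S \<phi>)"
    unfolding heq L2_normsq_def by (rule integral_complex_of_real)
  have P: "partial_deriv 1 \<phi> \<in> L2 M" by (rule Cc_smooth_L2_M[OF Cc_smooth_partial_deriv[OF \<phi>]])
  have \<phi>L: "\<phi> \<in> L2 M" by (rule Cc_smooth_L2_M[OF \<phi>])
  have "(\<integral>x. partial_deriv 1 h x \<partial>M) = - complex_of_real (sin \<alpha>) * (\<integral>x. h x \<partial>S)"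
    using directional_Green[OF hC, of 0] bdry_integral_Cc_smooth(2)[OF hC] by (simp add: algebra_simps)
  then have "sin \<alpha> * L2_normsq S \<phi> = cmod (\<integral>x. partial_deriv 1 h x \<partial>M)"
    using sin_pos L2_normsq_nonneg[of S \<phi>] by (simp add: hS norm_mult)
  also have "\<dots> \<le> (\<integral>x. cmod (partial_deriv 1 h x) \<partial>M)" by (rule integral_norm_bound)
  also have "\<dots> \<le> (\<integral>x. (cmod (partial_deriv 1 \<phi> x))\<^sup>2 + (cmod (\<phi> x))\<^sup>2 \<partial>M)"
  proof (rule Bochner_Integration.integral_mono)
    show "integrable M (\<lambda>x. cmod (partial_deriv 1 h x))"
      by (intro integrable_norm Cc_smooth_integrable_M[OF Cc_smooth_partial_deriv[OF hC]])
    show "integrable M (\<lambda>x. (cmod (partial_deriv 1 \<phi> x))\<^sup>2 + (cmod (\<phi> x))\<^sup>2)"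
      using L2_integrable_sq[OF P] L2_integrable_sq[OF \<phi>L] by (rule Bochner_Integration.integrable_add)
    fix x
    note d = Cc_smooth_differentiable[OF \<phi>, of x]
    have "cmod (partial_deriv 1 h x) \<le> cmod (cnj (partial_deriv 1 \<phi> x) * \<phi> x) + cmod (cnj (\<phi> x) * partial_deriv 1 \<phi> x)"
      unfolding h_def partial_deriv_mult[OF partial_deriv_cnj(2)[OF d] d] partial_deriv_cnj(1)[OF d]
      by (rule norm_triangle_ineq)
    also have "\<dots> = 2 * (cmod (partial_deriv 1 \<phi> x) * cmod (\<phi> x))" by (simp add: norm_mult)
    also have "\<dots> \<le> (cmod (partial_deriv 1 \<phi> x))\<^sup>2 + (cmod (\<phi> x))\<^sup>2"
      using zero_le_power2[of "cmod (partial_deriv 1 \<phi> x) - cmod (\<phi> x)"] by (simp add: power2_eq_square algebra_simps)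
    finally show "cmod (partial_deriv 1 h x) \<le> (cmod (partial_deriv 1 \<phi> x))\<^sup>2 + (cmod (\<phi> x))\<^sup>2" .
  qed
  also have "\<dots> = L2_normsq M (partial_deriv 1 \<phi>) + L2_normsq M \<phi>"
    using L2_integrable_sq[OF P] L2_integrable_sq[OF \<phi>L] by (simp add: L2_normsq_def)
  also have "\<dots> \<le> H1_normsq U \<phi>"
    using L2_normsq_nonneg[of M "partial_deriv 2 \<phi>"] by (simp add: H1_normsq_eq[OF Cc_smooth_weak_grad[OF \<phi>]] sum_2)
  finally show ?thesis .
qed

lemma trace_difference_le:
  assumes \<phi>: "\<phi> \<in> Cc_smooth UNIV" and \<psi>: "\<psi> \<in> Cc_smooth UNIV" and u: "u \<in> H1 U"
  shows "L2_normsq S (\<lambda>x. \<phi> x - \<psi> x) \<le> (2 * H1_normsq U (\<lambda>x. \<phi> x - u x) + 2 * H1_normsq U (\<lambda>x. \<psi> x - u x)) / sin \<alpha>"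
proof -
  have "sin \<alpha> * L2_normsq S (\<lambda>x. \<phi> x - \<psi> x) \<le> H1_normsq U (\<lambda>x. \<phi> x - \<psi> x)"
    by (rule trace_inequality[OF Cc_smooth_diff[OF \<phi> \<psi>]])
  also have "\<dots> \<le> 2 * H1_normsq U (\<lambda>x. \<phi> x - u x) + 2 * H1_normsq U (\<lambda>x. \<psi> x - u x)"
    using H1_normsq_diff_triangle[OF Cc_smooth_H1[OF \<phi>] u Cc_smooth_H1[OF \<psi>]]
      H1_normsq_minus_commute[OF u Cc_smooth_H1[OF \<psi>]] by simp
  finally show ?thesis using sin_pos by (simp add: pos_le_divide_eq mult.commute)
qed

text \<open>By the trace inequality the restrictions to the boundary of an approximating sequence form a Cauchy
  sequence.\<close>
lemma trace_exists:
  assumes u: "u \<in> H1 U" shows "\<exists>g. is_trace U u g"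
proof -
  obtain \<phi> where \<phi>: "\<And>n::nat. \<phi> n \<in> Cc_smooth UNIV" and lim: "(\<lambda>n. H1_normsq U (\<lambda>x. \<phi> n x - u x)) \<longlonglongrightarrow> 0"
    by (rule Cc_smooth_dense_H1[OF u]) blast
  have "\<exists>g\<in>L2 S. (\<lambda>n. L2_normsq S (\<lambda>x. \<phi> n x - g x)) \<longlonglongrightarrow> 0"
  proof (rule L2_complete[OF Cc_smooth_L2_S[OF \<phi>]])
    fix e :: real assume e: "e > 0"
    then have "e * sin \<alpha> / 4 > 0" using sin_pos by simp
    from order_tendstoD(2)[OF lim this]
    obtain N where N: "\<And>n. n \<ge> N \<Longrightarrow> H1_normsq U (\<lambda>x. \<phi> n x - u x) < e * sin \<alpha> / 4"
      unfolding eventually_sequentially by blast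
    have "L2_normsq S (\<lambda>x. \<phi> m x - \<phi> n x) < e" if "m \<ge> N" "n \<ge> N" for m n
    proof -
      have "L2_normsq S (\<lambda>x. \<phi> m x - \<phi> n x) \<le> (2 * H1_normsq U (\<lambda>x. \<phi> m x - u x) + 2 * H1_normsq U (\<lambda>x. \<phi> n x - u x)) / sin \<alpha>"
        by (rule trace_difference_le[OF \<phi> \<phi> u])
      also have "\<dots> < e * sin \<alpha> / sin \<alpha>" using N[OF that(1)] N[OF that(2)] sin_pos by (intro divide_strict_right_mono) linarith+
      finally show ?thesis using sin_pos by simp
    qed
    then show "\<exists>N. \<forall>m\<ge>N. \<forall>n\<ge>N. L2_normsq S (\<lambda>x. \<phi> m x - \<phi> n x) < e" by blast
  qed
  then show ?thesis using \<phi> lim unfolding is_trace_def by blast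
qed

lemma trace_unique:
  assumes u: "u \<in> H1 U" and g: "is_trace U u g" and g': "is_trace U u g'"
  shows "AE x in S. g x = g' x"
proof -
  obtain \<phi> where gL: "g \<in> L2 S" and \<phi>: "\<And>n::nat. \<phi> n \<in> Cc_smooth UNIV"
    and l: "(\<lambda>n. H1_normsq U (\<lambda>x. \<phi> n x - u x)) \<longlonglongrightarrow> 0" "(\<lambda>n. L2_normsq S (\<lambda>x. \<phi> n x - g x)) \<longlonglongrightarrow> 0"
    using g unfolding is_trace_def by blast
  obtain \<psi> where gL': "g' \<in> L2 S" and \<psi>: "\<And>n::nat. \<psi> n \<in> Cc_smooth UNIV"
    and l': "(\<lambda>n. H1_normsq U (\<lambda>x. \<psi> n x - u x)) \<longlonglongrightarrow> 0" "(\<lambda>n. L2_normsq S (\<lambda>x. \<psi> n x - g' x)) \<longlonglongrightarrow> 0"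
    using g' unfolding is_trace_def by blast
  define D where "D n = (2 * H1_normsq U (\<lambda>x. \<phi> n x - u x) + 2 * H1_normsq U (\<lambda>x. \<psi> n x - u x)) / sin \<alpha>" for n
  have tD: "L2_normsq S (\<lambda>x. \<phi> n x - \<psi> n x) \<le> D n" for n
    unfolding D_def by (rule trace_difference_le[OF \<phi> \<psi> u])
  have D0: "D \<longlonglongrightarrow> (2 * 0 + 2 * 0) / sin \<alpha>"
    unfolding D_def using sin_pos by (intro tendsto_intros l l') simp
  let ?b = "\<lambda>n. 2 * L2_normsq S (\<lambda>x. \<phi> n x - g x) + 2 * (2 * D n + 2 * L2_normsq S (\<lambda>x. \<psi> n x - g' x))"
  have "L2_normsq S (\<lambda>x. g x - g' x) \<le> ?b n" for n
  proof -
    have "L2_normsq S (\<lambda>x. \<phi> n x - g' x) \<le> 2 * L2_normsq S (\<lambda>x. \<phi> n x - \<psi> n x) + 2 * L2_normsq S (\<lambda>x. \<psi> n x - g' x)"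
      by (rule L2_normsq_diff_triangle[OF Cc_smooth_L2_S[OF \<phi>[of n]] Cc_smooth_L2_S[OF \<psi>[of n]] gL'])
    also have "\<dots> \<le> 2 * D n + 2 * L2_normsq S (\<lambda>x. \<psi> n x - g' x)" using tD[of n] by simp
    finally have 1: "L2_normsq S (\<lambda>x. \<phi> n x - g' x) \<le> 2 * D n + 2 * L2_normsq S (\<lambda>x. \<psi> n x - g' x)" .
    have "L2_normsq S (\<lambda>x. g x - g' x) \<le> 2 * L2_normsq S (\<lambda>x. g x - \<phi> n x) + 2 * L2_normsq S (\<lambda>x. \<phi> n x - g' x)"
      by (rule L2_normsq_diff_triangle[OF gL Cc_smooth_L2_S[OF \<phi>[of n]] gL'])
    also have "\<dots> \<le> 2 * L2_normsq S (\<lambda>x. g x - \<phi> n x) + 2 * (2 * D n + 2 * L2_normsq S (\<lambda>x. \<psi> n x - g' x))"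
      by (intro add_left_mono mult_left_mono 1) simp
    also have "L2_normsq S (\<lambda>x. g x - \<phi> n x) = L2_normsq S (\<lambda>x. \<phi> n x - g x)" by (rule L2_normsq_minus_commute)
    finally show ?thesis .
  qed
  moreover have "?b \<longlonglongrightarrow> 2 * 0 + 2 * (2 * ((2 * 0 + 2 * 0) / sin \<alpha>) + 2 * 0)"
    by (intro tendsto_intros l l' D0)
  ultimately have "L2_normsq S (\<lambda>x. g x - g' x) \<le> 0" using LIMSEQ_le_const by fastforce
  then have "AE x in S. g x - g' x = 0"
    using L2_normsq_eq_0[OF L2_diff[OF gL gL']] L2_normsq_nonneg[of S "\<lambda>x. g x - g' x"] by simp
  then show ?thesis by simp
qed

lemma trace_of_smooth:
  assumes w: "\<And>k. C_k k w" and L: "w \<in> L2 M" "\<And>i. partial_deriv i w \<in> L2 M" "w \<in> L2 S"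
  shows "is_trace U w w"
  unfolding is_trace_def
proof (intro conjI exI allI)
  have G: "is_weak_grad U w (grad w)" by (rule smooth_weak_grad[OF w L(2)])
  show "w \<in> L2 S" by fact
  show "(\<lambda>x. cutoff n x * w x) \<in> Cc_smooth UNIV" for n by (rule cutoff_mult(1)[OF w])
  show "(\<lambda>n. H1_normsq U (\<lambda>x. cutoff n x * w x - w x)) \<longlonglongrightarrow> 0"
    by (rule cutoff_H1_tendsto[OF L(1) G w L(1,2)]) (simp_all add: L2_normsq_def)
  show "(\<lambda>n. L2_normsq S (\<lambda>x. cutoff n x * w x - w x)) \<longlonglongrightarrow> 0"
    by (rule cutoff_L2_tendsto[OF L(3) borel_measurable_bdry[OF Cc_smooth_measurable[OF cutoff_Cc_smooth]]])
qed

section \<open>Eigenfunctions\<close>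

text \<open>Every \<open>v \<in> H\<^sup>1(U)\<close> and its trace are limits of smooth functions of compact support, so it suffices to verify the eigenvalue equation of a smooth
  function against these.\<close>
lemma smooth_eigenfunction:
  assumes w: "\<And>k. C_k k w" and L: "w \<in> L2 M" "\<And>i. partial_deriv i w \<in> L2 M" "w \<in> L2 S"
    and eq: "\<And>\<psi>. \<psi> \<in> Cc_smooth UNIV \<Longrightarrow>
      (\<integral>x. partial_deriv 1 w x * partial_deriv 1 \<psi> x + partial_deriv 2 w x * partial_deriv 2 \<psi> x \<partial>M)
        - (\<integral>x. w x * \<psi> x \<partial>S) = complex_of_real \<mu> * (\<integral>x. w x * \<psi> x \<partial>M)"
  shows "w \<in> eigenspace (T_op \<alpha>) \<mu>"
proof -
  have G: "is_weak_grad U w (grad w)" by (rule smooth_weak_grad[OF w L(2)])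
  have wH: "w \<in> H1 U" using L(1) G by (auto simp: H1_def)
  have tr: "is_trace U v (trace_bd U v)" if "v \<in> H1 U" for v
    unfolding trace_bd_def using trace_exists[OF that] by (rule someI_ex)
  have trw: "AE x in S. trace_bd U w x = w x"
    by (rule trace_unique[OF wH tr[OF wH] trace_of_smooth[OF w L]])
  have "robin_form U w v = L2_inner M (\<lambda>x. complex_of_real \<mu> * w x) v" if v: "v \<in> H1 U" for v
  proof -
    obtain H where vL: "v \<in> L2 M" and H: "is_weak_grad U v H" using v by (auto simp: H1_def)
    define K where "K = weak_grad U v"
    have K: "is_weak_grad U v K" unfolding K_def by (rule weak_grad_AE(1)[OF H])
    define g where "g = trace_bd U v"
    obtain \<phi> where gL: "g \<in> L2 S" and \<phi>: "\<And>n::nat. \<phi> n \<in> Cc_smooth UNIV"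
      and l: "(\<lambda>n. H1_normsq U (\<lambda>x. \<phi> n x - v x)) \<longlonglongrightarrow> 0" "(\<lambda>n. L2_normsq S (\<lambda>x. \<phi> n x - g x)) \<longlonglongrightarrow> 0"
      using tr[OF v] unfolding is_trace_def g_def by blast
    have H1: "H1_normsq U (\<lambda>x. \<phi> n x - v x) = L2_normsq M (\<lambda>x. \<phi> n x - v x) + L2_normsq M (\<lambda>x. partial_deriv 1 (\<phi> n) x - K x $ 1)
        + L2_normsq M (\<lambda>x. partial_deriv 2 (\<phi> n) x - K x $ 2)" for n
      by (simp add: H1_normsq_eq[OF weak_grad_diff[OF Cc_smooth_L2_M[OF \<phi>] Cc_smooth_weak_grad[OF \<phi>] vL K]] sum_2)
    have sub: "X \<longlonglongrightarrow> 0" if "\<And>n. 0 \<le> X n" "\<And>n. X n \<le> H1_normsq U (\<lambda>x. \<phi> n x - v x)" for X :: "nat \<Rightarrow> real"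
      by (rule tendsto_sandwich[OF _ _ tendsto_const l(1)]) (use that in auto)
    have l0: "(\<lambda>n. L2_normsq M (\<lambda>x. \<phi> n x - v x)) \<longlonglongrightarrow> 0"
      and l1: "(\<lambda>n. L2_normsq M (\<lambda>x. partial_deriv 1 (\<phi> n) x - K x $ 1)) \<longlonglongrightarrow> 0"
      and l2: "(\<lambda>n. L2_normsq M (\<lambda>x. partial_deriv 2 (\<phi> n) x - K x $ 2)) \<longlonglongrightarrow> 0"
      by (rule sub; simp add: H1 L2_normsq_nonneg)+
    have lim: "(\<lambda>n. \<integral>x. p x * cnj (f n x) \<partial>N) \<longlonglongrightarrow> (\<integral>x. p x * cnj (f' x) \<partial>N)"
      if "\<And>n. f n \<in> L2 N" "f' \<in> L2 N" "p \<in> L2 N" "(\<lambda>n. L2_normsq N (\<lambda>x. f n x - f' x)) \<longlonglongrightarrow> 0"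
      for p f f' and N :: "(real^2) measure"
    proof (rule L2_tendsto_mult_integral[of "\<lambda>n x. cnj (f n x)"])
      have "L2_normsq N (\<lambda>x. cnj (f n x) - cnj (f' x)) = L2_normsq N (\<lambda>x. f n x - f' x)" for n
        by (simp add: L2_normsq_def flip: complex_cnj_diff)
      then show "(\<lambda>n. L2_normsq N (\<lambda>x. cnj (f n x) - cnj (f' x))) \<longlonglongrightarrow> 0" using that(4) by simp
    qed (use that in \<open>auto intro: L2_cnj\<close>)
    have P: "partial_deriv i (\<phi> n) \<in> L2 M" for i n by (rule Cc_smooth_L2_M[OF Cc_smooth_partial_deriv[OF \<phi>]])
    have eqn: "(\<integral>x. partial_deriv 1 w x * cnj (partial_deriv 1 (\<phi> n) x) \<partial>M) + (\<integral>x. partial_deriv 2 w x * cnj (partial_deriv 2 (\<phi> n) x) \<partial>M)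
        - (\<integral>x. w x * cnj (\<phi> n x) \<partial>S) = complex_of_real \<mu> * (\<integral>x. w x * cnj (\<phi> n x) \<partial>M)" for n
      using eq[OF Cc_smooth_cnj[OF \<phi>[of n]]]
        L2_mult_integrable[OF L(2)[of 1] L2_cnj[OF P[of 1 n]]] L2_mult_integrable[OF L(2)[of 2] L2_cnj[OF P[of 2 n]]]
      by (simp add: partial_deriv_cnj(1)[OF Cc_smooth_differentiable[OF \<phi>]])
    have "(\<lambda>n. (\<integral>x. partial_deriv 1 w x * cnj (partial_deriv 1 (\<phi> n) x) \<partial>M) + (\<integral>x. partial_deriv 2 w x * cnj (partial_deriv 2 (\<phi> n) x) \<partial>M)
        - (\<integral>x. w x * cnj (\<phi> n x) \<partial>S))
      \<longlonglongrightarrow> (\<integral>x. partial_deriv 1 w x * cnj (K x $ 1) \<partial>M) + (\<integral>x. partial_deriv 2 w x * cnj (K x $ 2) \<partial>M) - (\<integral>x. w x * cnj (g x) \<partial>S)"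
      by (intro tendsto_add tendsto_diff lim P L weak_grad_L2[OF K] Cc_smooth_L2_S[OF \<phi>] gL l1 l2 l(2))
    moreover have "(\<lambda>n. complex_of_real \<mu> * (\<integral>x. w x * cnj (\<phi> n x) \<partial>M)) \<longlonglongrightarrow> complex_of_real \<mu> * (\<integral>x. w x * cnj (v x) \<partial>M)"
      by (intro tendsto_mult_left lim Cc_smooth_L2_M[OF \<phi>] vL L l0)
    ultimately have fin: "(\<integral>x. partial_deriv 1 w x * cnj (K x $ 1) \<partial>M) + (\<integral>x. partial_deriv 2 w x * cnj (K x $ 2) \<partial>M) - (\<integral>x. w x * cnj (g x) \<partial>S)
      = complex_of_real \<mu> * (\<integral>x. w x * cnj (v x) \<partial>M)"
      unfolding eqn by (rule LIMSEQ_unique)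
    have "(\<integral>x. (\<Sum>i\<in>UNIV. weak_grad U w x $ i * cnj (weak_grad U v x $ i)) \<partial>M)
       = (\<integral>x. partial_deriv 1 w x * cnj (K x $ 1) + partial_deriv 2 w x * cnj (K x $ 2) \<partial>M)"
    proof (rule integral_cong_AE)
      have m: "(\<lambda>x. weak_grad U w x $ i) \<in> borel_measurable M" "(\<lambda>x. cnj (weak_grad U v x $ i)) \<in> borel_measurable M"
        "partial_deriv i w \<in> borel_measurable M" for i
        by (intro L2_measurable L2_cnj weak_grad_L2[OF weak_grad_AE(1)[OF G]] weak_grad_L2[OF weak_grad_AE(1)[OF H]] L(2))+
      show "(\<lambda>x. \<Sum>i\<in>UNIV. weak_grad U w x $ i * cnj (weak_grad U v x $ i)) \<in> borel_measurable M"
        "(\<lambda>x. partial_deriv 1 w x * cnj (K x $ 1) + partial_deriv 2 w x * cnj (K x $ 2)) \<in> borel_measurable M"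
        unfolding sum_2 K_def by (intro borel_measurable_add borel_measurable_times m)+
      show "AE x in M. (\<Sum>i\<in>UNIV. weak_grad U w x $ i * cnj (weak_grad U v x $ i))
          = partial_deriv 1 w x * cnj (K x $ 1) + partial_deriv 2 w x * cnj (K x $ 2)"
        using weak_grad_AE(2)[OF G, of 1] weak_grad_AE(2)[OF G, of 2] by eventually_elim (simp add: sum_2 K_def)
    qed
    also have "\<dots> = (\<integral>x. partial_deriv 1 w x * cnj (K x $ 1) \<partial>M) + (\<integral>x. partial_deriv 2 w x * cnj (K x $ 2) \<partial>M)"
      by (intro Bochner_Integration.integral_add L2_mult_integrable L L2_cnj weak_grad_L2[OF K])
    finally have A: "(\<integral>x. (\<Sum>i\<in>UNIV. weak_grad U w x $ i * cnj (weak_grad U v x $ i)) \<partial>M)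
       = (\<integral>x. partial_deriv 1 w x * cnj (K x $ 1) \<partial>M) + (\<integral>x. partial_deriv 2 w x * cnj (K x $ 2) \<partial>M)" .
    have B: "(\<integral>x. trace_bd U w x * cnj (trace_bd U v x) \<partial>S) = (\<integral>x. w x * cnj (g x) \<partial>S)"
    proof (rule integral_cong_AE)
      have "trace_bd U w \<in> L2 S" using tr[OF wH] by (simp add: is_trace_def)
      then show "(\<lambda>x. trace_bd U w x * cnj (trace_bd U v x)) \<in> borel_measurable S" "(\<lambda>x. w x * cnj (g x)) \<in> borel_measurable S"
        unfolding g_def[symmetric] using L(3) gL by (intro borel_measurable_times; blast intro: L2_measurable L2_cnj)+
      show "AE x in S. trace_bd U w x * cnj (trace_bd U v x) = w x * cnj (g x)"
        using trw by eventually_elim (simp add: g_def)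
    qed
    show ?thesis unfolding robin_form_def A B fin L2_inner_def by (simp add: mult.assoc)
  qed
  then show ?thesis
    using wH L2_cmult[OF L(1)] by (simp add: eigenspace_def T_op_def form_operator_def)
qed

end

definition plane_wave :: "real \<Rightarrow> real \<Rightarrow> real^2 \<Rightarrow> complex" where
  "plane_wave k \<theta> x = complex_of_real (exp (- k * (cos \<theta> * x$1 + sin \<theta> * x$2)))"

lemma plane_wave_has_derivative:
  "(plane_wave k \<theta> has_derivative (\<lambda>h. complex_of_real (- k * (cos \<theta> * h$1 + sin \<theta> * h$2)) * plane_wave k \<theta> x)) (at x)"
proof -
  have c: "((\<lambda>x::real^2. x $ i) has_derivative (\<lambda>h. h $ i)) (at x)" for i
    by (rule bounded_linear_imp_has_derivative, rule bounded_linear_vec_nth)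
  have "((\<lambda>x. exp (- k * (cos \<theta> * x$1 + sin \<theta> * x$2))) has_derivative
     (\<lambda>h. exp (- k * (cos \<theta> * x$1 + sin \<theta> * x$2)) * (- k * (cos \<theta> * h$1 + sin \<theta> * h$2)))) (at x)"
    by (auto intro!: derivative_eq_intros c)
  then have "((\<lambda>x. complex_of_real (exp (- k * (cos \<theta> * x$1 + sin \<theta> * x$2)))) has_derivative
     (\<lambda>h. complex_of_real (exp (- k * (cos \<theta> * x$1 + sin \<theta> * x$2)) * (- k * (cos \<theta> * h$1 + sin \<theta> * h$2))))) (at x)"
    by (rule has_derivative_of_real)
  then show ?thesis
    unfolding plane_wave_def[abs_def] by (simp add: mult.commute)
qed

lemma plane_wave_differentiable: "plane_wave k \<theta> differentiable at x"
  unfolding differentiable_def using plane_wave_has_derivative by blast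

lemma partial_deriv_plane_wave:
  "partial_deriv 1 (plane_wave k \<theta>) x = complex_of_real (- k * cos \<theta>) * plane_wave k \<theta> x"
  "partial_deriv 2 (plane_wave k \<theta>) x = complex_of_real (- k * sin \<theta>) * plane_wave k \<theta> x"
  by (simp_all add: partial_deriv_eqI[OF plane_wave_has_derivative] axis_def)

lemma C_k_plane_wave: "C_k m (plane_wave k \<theta>)"
proof (induction m)
  case 0
  show ?case using plane_wave_has_derivative
    by (auto intro!: continuous_at_imp_continuous_on has_derivative_continuous)
next
  case (Suc m)
  have "C_k m (partial_deriv i (plane_wave k \<theta>))" for i
  proof -
    have "partial_deriv 1 (plane_wave k \<theta>) = (\<lambda>x. complex_of_real (- k * cos \<theta>) * plane_wave k \<theta> x)"
      "partial_deriv 2 (plane_wave k \<theta>) = (\<lambda>x. complex_of_real (- k * sin \<theta>) * plane_wave k \<theta> x)"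
      by (intro ext partial_deriv_plane_wave)+
    then have "C_k m (partial_deriv 1 (plane_wave k \<theta>))" "C_k m (partial_deriv 2 (plane_wave k \<theta>))"
      by (simp_all only: C_k_mult[OF C_k_const Suc])
    then show ?thesis using exhaust_2[of i] by auto
  qed
  then show ?case using plane_wave_differentiable by simp
qed

lemma plane_wave_edge:
  "plane_wave k \<theta> (s *\<^sub>R dir \<alpha> + t *\<^sub>R dir (- \<alpha>)) = complex_of_real (exp (- (k * cos (\<theta> - \<alpha>)) * s) * exp (- (k * cos (\<theta> + \<alpha>)) * t))"
  unfolding plane_wave_def exp_add[symmetric]
  by (simp add: cos_add cos_diff algebra_simps)

lemma nn_integral_exp_half_line:
  assumes "a > 0" shows "(\<integral>\<^sup>+s. indicator {0<..} s * ennreal (exp (- a * s)) \<partial>lborel) < \<infinity>"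
proof -
  have "(\<integral>\<^sup>+s. ennreal (exp (- a * s)) * indicator {0..} s \<partial>lborel) = ennreal (0 - (- exp (- a * 0) / a))"
  proof (rule nn_integral_FTC_atLeast)
    show "DERIV (\<lambda>s. - exp (- a * s) / a) s :> exp (- a * s)" for s
      using assms by (auto intro!: derivative_eq_intros)
    have "((\<lambda>s. exp (- (a * s))) \<longlongrightarrow> 0) at_top"
      using assms by (intro filterlim_compose[OF exp_at_bot] filterlim_uminus_at_bot[THEN iffD1]
          filterlim_tendsto_pos_mult_at_top[OF tendsto_const] filterlim_ident) 
         (auto simp: filterlim_uminus_at_bot intro!: filterlim_tendsto_pos_mult_at_top[OF tendsto_const] filterlim_ident)
    then show "((\<lambda>s. - exp (- a * s) / a) \<longlongrightarrow> 0) at_top"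
      using tendsto_divide[OF tendsto_minus tendsto_const[of a]] assms by fastforce
  qed auto
  moreover have "(\<integral>\<^sup>+s. indicator {0<..} s * ennreal (exp (- a * s)) \<partial>lborel) \<le> (\<integral>\<^sup>+s. ennreal (exp (- a * s)) * indicator {0..} s \<partial>lborel)"
    by (intro nn_integral_mono) (auto simp: indicator_def)
  ultimately show ?thesis by (simp add: le_less_trans)
qed

context acute_sector
begin

lemma plane_wave_L2:
  assumes k: "k > 0" and \<theta>: "cos (\<theta> - \<alpha>) > 0" "cos (\<theta> + \<alpha>) > 0"
  shows "plane_wave k \<theta> \<in> L2 M" "plane_wave k \<theta> \<in> L2 S"
proof -
  define a b where "a = 2 * (k * cos (\<theta> - \<alpha>))" and "b = 2 * (k * cos (\<theta> + \<alpha>))"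
  have ab: "a > 0" "b > 0" using k \<theta> by (auto simp: a_def b_def)
  have wm: "plane_wave k \<theta> \<in> borel_measurable borel"
    by (rule borel_measurable_continuous_onI[OF C_k_imp_continuous[OF C_k_plane_wave]])
  have sm: "(\<lambda>x. (cmod (plane_wave k \<theta> x))\<^sup>2) \<in> borel_measurable borel" using wm by measurable
  have sq: "(cmod (plane_wave k \<theta> (s *\<^sub>R dir \<alpha> + t *\<^sub>R dir (- \<alpha>))))\<^sup>2 = exp (- a * s) * exp (- b * t)" for s t
    unfolding plane_wave_edge a_def b_def by (simp add: exp_add[symmetric] exp_double[symmetric] power_mult_distrib)
  let ?F = "\<lambda>x. indicator U x * ennreal ((cmod (plane_wave k \<theta> x))\<^sup>2)"
  let ?A = "\<integral>\<^sup>+s. indicator {0<..} s * ennreal (exp (- a * s)) \<partial>lborel"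
  let ?B = "\<integral>\<^sup>+t. indicator {0<..} t * ennreal (exp (- b * t)) \<partial>lborel"
  have F: "?F (edge_coords \<alpha> (s, t)) = (indicator {0<..} s * ennreal (exp (- a * s))) * (indicator {0<..} t * ennreal (exp (- b * t)))" for s t
    using sq[of s t] sector_combo_iff[OF \<alpha>, of s t] by (simp add: edge_coords_def indicator_def ennreal_mult)
  have Fm: "?F \<in> borel_measurable borel" using U_borel sm by measurable
  have "(\<integral>\<^sup>+x. ?F x \<partial>lborel) = ennreal \<bar>sin (2*\<alpha>)\<bar> * (\<integral>\<^sup>+z. ?F (edge_coords \<alpha> z) \<partial>lborel)"
    using sin_pos cos_pos by (intro nn_integral_edge_coords Fm) auto
  also have "(\<integral>\<^sup>+z. ?F (edge_coords \<alpha> z) \<partial>lborel) =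
    (\<integral>\<^sup>+z. (case z of (s, t) \<Rightarrow> (indicator {0<..} s * ennreal (exp (- a * s))) * (indicator {0<..} t * ennreal (exp (- b * t)))) \<partial>(lborel \<Otimes>\<^sub>M lborel))"
    unfolding lborel_prod by (intro nn_integral_cong) (auto simp: F)
  also have "\<dots> = (\<integral>\<^sup>+s. \<integral>\<^sup>+t. (indicator {0<..} s * ennreal (exp (- a * s))) * (indicator {0<..} t * ennreal (exp (- b * t))) \<partial>lborel \<partial>lborel)"
    by (subst lborel.nn_integral_fst[symmetric]) (auto simp: case_prod_unfold)
  also have "\<dots> = ?A * ?B"
    by (simp add: nn_integral_cmult nn_integral_multc)
  finally have "(\<integral>\<^sup>+x. ?F x \<partial>lborel) < \<infinity>"
    using nn_integral_exp_half_line[OF ab(1)] nn_integral_exp_half_line[OF ab(2)] by (simp add: ennreal_mult_less_top)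
  moreover have "ennreal (norm (indicator U x *\<^sub>R (cmod (plane_wave k \<theta> x))\<^sup>2)) = ?F x" for x
    by (auto simp: indicator_def)
  moreover have "(\<lambda>x. indicator U x *\<^sub>R (cmod (plane_wave k \<theta> x))\<^sup>2) \<in> borel_measurable lborel"
    using U_borel sm by measurable
  ultimately have "integrable lborel (\<lambda>x. indicator U x *\<^sub>R (cmod (plane_wave k \<theta> x))\<^sup>2)"
    by (simp add: integrable_iff_bounded)
  then show "plane_wave k \<theta> \<in> L2 M"
    using integral_lebesgue_on(2)[OF U_borel sm] borel_imp_lebesgue_on[OF wm] by (simp add: L2_def)
  let ?g = "\<lambda>s. (cmod (plane_wave k \<theta> (boundary_param \<alpha> s)))\<^sup>2"
  have gm: "?g \<in> borel_measurable lborel" using measurable_compose[OF boundary_param_measurable sm] by simp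
  let ?a = "\<lambda>s. indicator {0<..} s * ennreal (exp (- a * s))" and ?b = "\<lambda>t. indicator {0<..} t * ennreal (exp (- b * t))"
  have "(\<integral>\<^sup>+s. ennreal (?g s) \<partial>lborel) \<le> (\<integral>\<^sup>+s. ?a s + ?b (0 + (-1) * s) \<partial>lborel)"
  proof (rule nn_integral_mono_AE)
    show "AE s in lborel. ennreal (?g s) \<le> ?a s + ?b (0 + (-1) * s)"
      using AE_lborel_singleton[of 0]
    proof eventually_elim
      fix s :: real assume "s \<noteq> 0"
      then show "ennreal (?g s) \<le> ?a s + ?b (0 + (-1) * s)"
        using sq[of s 0] sq[of 0 "- s"] by (cases "s > 0") (auto simp: boundary_param_def)
    qed
  qed
  also have "\<dots> = (\<integral>\<^sup>+s. ?a s \<partial>lborel) + (\<integral>\<^sup>+s. ?b (0 + (-1) * s) \<partial>lborel)"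
    by (rule nn_integral_add) auto
  also have "(\<integral>\<^sup>+s. ?b (0 + (-1) * s) \<partial>lborel) = ?B"
    using nn_integral_real_affine[of ?b "-1" 0] by simp
  also have "?A + ?B < \<infinity>"
    using nn_integral_exp_half_line[OF ab(1)] nn_integral_exp_half_line[OF ab(2)] by simp
  finally have "integrable lborel ?g" using gm by (simp add: integrable_iff_bounded)
  then show "plane_wave k \<theta> \<in> L2 S"
    using integral_bdry(2)[OF \<alpha> sm] borel_measurable_bdry[OF wm] by (simp add: L2_def)
qed

text \<open>A plane wave satisfies \<open>\<Delta>E = k\<^sup>2E\<close>, so that only its defect in the Robin condition on the two edges
  remains on the right.\<close>
lemma plane_wave_weak:
  fixes k \<theta> :: real
  assumes \<psi>: "\<psi> \<in> Cc_smooth UNIV"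
  defines "h \<equiv> \<lambda>x. plane_wave k \<theta> x * \<psi> x"
  shows "(\<integral>x. partial_deriv 1 (plane_wave k \<theta>) x * partial_deriv 1 \<psi> x + partial_deriv 2 (plane_wave k \<theta>) x * partial_deriv 2 \<psi> x \<partial>M)
     - (\<integral>x. h x \<partial>S) + complex_of_real (k\<^sup>2) * (\<integral>x. h x \<partial>M)
     = complex_of_real (- k * sin (\<theta> - \<alpha>) - 1) * edge_integral \<alpha> h
     + complex_of_real (k * sin (\<theta> + \<alpha>) - 1) * edge_integral (- \<alpha>) h"
proof -
  have hC: "h \<in> Cc_smooth UNIV" unfolding h_def by (intro Cc_smooth_mult \<psi> C_k_plane_wave)
  note d = plane_wave_differentiable
  let ?D = "\<lambda>x. complex_of_real (cos \<theta>) * partial_deriv 1 h x + complex_of_real (sin \<theta>) * partial_deriv 2 h x"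
  have Di: "integrable M ?D"
    by (intro Bochner_Integration.integrable_add integrable_mult_right Cc_smooth_integrable_M[OF Cc_smooth_partial_deriv[OF hC]])
  have hi: "integrable M h" by (rule Cc_smooth_integrable_M[OF hC])
  have cs: "complex_of_real (cos \<theta>) * complex_of_real (cos \<theta>) + complex_of_real (sin \<theta>) * complex_of_real (sin \<theta>) = 1"
    by (simp add: sin_cos_squared_add3 flip: of_real_mult of_real_add)
  have pt: "partial_deriv 1 (plane_wave k \<theta>) x * partial_deriv 1 \<psi> x + partial_deriv 2 (plane_wave k \<theta>) x * partial_deriv 2 \<psi> x
     = - complex_of_real k * ?D x - complex_of_real (k\<^sup>2) * h x" for x
  proof -
    have Dx: "?D x = complex_of_real (cos \<theta>) * plane_wave k \<theta> x * partial_deriv 1 \<psi> x + complex_of_real (sin \<theta>) * plane_wave k \<theta> x * partial_deriv 2 \<psi> x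
       - complex_of_real k * (complex_of_real (cos \<theta>) * complex_of_real (cos \<theta>) + complex_of_real (sin \<theta>) * complex_of_real (sin \<theta>)) * h x"
      unfolding h_def partial_deriv_mult[OF d Cc_smooth_differentiable[OF \<psi>]] partial_deriv_plane_wave
      by (simp add: algebra_simps)
    show ?thesis unfolding Dx unfolding cs partial_deriv_plane_wave h_def by (simp add: algebra_simps power2_eq_square)
  qed
  have "(\<integral>x. partial_deriv 1 (plane_wave k \<theta>) x * partial_deriv 1 \<psi> x + partial_deriv 2 (plane_wave k \<theta>) x * partial_deriv 2 \<psi> x \<partial>M)
    = - complex_of_real k * (\<integral>x. ?D x \<partial>M) - complex_of_real (k\<^sup>2) * (\<integral>x. h x \<partial>M)"
    unfolding pt using Di hi by (simp add: Bochner_Integration.integral_diff del: of_real_power)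
  then show ?thesis
    unfolding directional_Green[OF hC] bdry_integral_Cc_smooth(2)[OF hC] by (simp add: algebra_simps)
qed

text \<open>On the ray in direction \<open>\<beta>\<close> the wave \<open>E\<^sub>\<theta>\<close> depends on \<open>\<theta>\<close> only through \<open>cos (\<theta> - \<beta>)\<close>.\<close>
lemma edge_integral_plane_wave_even:
  "edge_integral \<alpha> (\<lambda>x. plane_wave k (\<alpha> + \<eta>) x * \<psi> x) = edge_integral \<alpha> (\<lambda>x. plane_wave k (\<alpha> - \<eta>) x * \<psi> x)"
  "edge_integral (- \<alpha>) (\<lambda>x. plane_wave k (- \<alpha> + \<eta>) x * \<psi> x) = edge_integral (- \<alpha>) (\<lambda>x. plane_wave k (- \<alpha> - \<eta>) x * \<psi> x)"
proof -
  have "plane_wave k (\<beta> + \<eta>) (t *\<^sub>R dir \<beta>) = plane_wave k (\<beta> - \<eta>) (t *\<^sub>R dir \<beta>)" for t \<beta>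
    using plane_wave_edge[of k "\<beta> + \<eta>" t \<beta> 0] plane_wave_edge[of k "\<beta> - \<eta>" t \<beta> 0] by simp
  then have "edge_integral \<beta> (\<lambda>x. plane_wave k (\<beta> + \<eta>) x * \<psi> x) = edge_integral \<beta> (\<lambda>x. plane_wave k (\<beta> - \<eta>) x * \<psi> x)" for \<beta>
    unfolding edge_integral_def by (simp only:)
  then show "edge_integral \<alpha> (\<lambda>x. plane_wave k (\<alpha> + \<eta>) x * \<psi> x) = edge_integral \<alpha> (\<lambda>x. plane_wave k (\<alpha> - \<eta>) x * \<psi> x)"
    "edge_integral (- \<alpha>) (\<lambda>x. plane_wave k (- \<alpha> + \<eta>) x * \<psi> x) = edge_integral (- \<alpha>) (\<lambda>x. plane_wave k (- \<alpha> - \<eta>) x * \<psi> x)"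
    by blast+
qed

end

text \<open>The recursion makes the Robin defects of the directions \<open>2(j+1)\<alpha>\<close> and \<open>-2j\<alpha>\<close>, which are mirror images
  in the upper edge, cancel.\<close>
primrec edge_coeff :: "real \<Rightarrow> real \<Rightarrow> nat \<Rightarrow> real" where
  "edge_coeff k \<alpha> 0 = 1"
| "edge_coeff k \<alpha> (Suc j) = edge_coeff k \<alpha> j * (k * sin ((2 * real j + 1) * \<alpha>) - 1) / (k * sin ((2 * real j + 1) * \<alpha>) + 1)"

text \<open>Robin defect on one edge of the sum over \<open>|j| \<le> m\<close>, where \<open>J \<eta>\<close> stands for the edge integral of the
  wave that makes the angle \<open>\<eta>\<close> with the edge. Raising \<open>m\<close> by one adds the direction \<open>2(m+1)\<alpha>\<close>, which
  cancels the old remainder, and the direction \<open>-2(m+1)\<alpha>\<close>, which is the new one.\<close>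
lemma edge_coeff_telescope:
  fixes J :: "real \<Rightarrow> complex"
  assumes J: "\<And>x. J (- x) = J x" and nz: "\<And>j. j < m \<Longrightarrow> k * sin ((2 * real j + 1) * \<alpha>) + 1 \<noteq> 0"
  shows "(\<Sum>j\<in>{- int m..int m}. complex_of_real (edge_coeff k \<alpha> (nat \<bar>j\<bar>) * (- k * sin ((2 * real_of_int j - 1) * \<alpha>) - 1)) * J ((2 * real_of_int j - 1) * \<alpha>))
    = complex_of_real (edge_coeff k \<alpha> m * (k * sin ((2 * real m + 1) * \<alpha>) - 1)) * J ((2 * real m + 1) * \<alpha>)"
    (is "(\<Sum>j\<in>_. ?f j) = ?T m")
  using nz
proof (induction m)
  case 0
  show ?case using J[of \<alpha>] by simp
next
  case (Suc m)
  have "{- int (Suc m)..int (Suc m)} = insert (int (Suc m)) (insert (- int (Suc m)) {- int m..int m})" by auto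
  then have "(\<Sum>j\<in>{- int (Suc m)..int (Suc m)}. ?f j) = ?f (int (Suc m)) + (?f (- int (Suc m)) + (\<Sum>j\<in>{- int m..int m}. ?f j))"
    by simp
  also have "(\<Sum>j\<in>{- int m..int m}. ?f j) = ?T m" using Suc by simp
  also have "?f (int (Suc m)) = - ?T m"
  proof -
    have e: "(2 * real_of_int (int (Suc m)) - 1) * \<alpha> = (2 * real m + 1) * \<alpha>" by simp
    have n: "nat \<bar>int (Suc m)\<bar> = Suc m" by simp
    have "edge_coeff k \<alpha> (Suc m) * (- k * sin ((2 * real m + 1) * \<alpha>) - 1) = - (edge_coeff k \<alpha> m * (k * sin ((2 * real m + 1) * \<alpha>) - 1))"
      using Suc.prems[of m] by (simp add: field_simps)
    then show ?thesis unfolding e n by simp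
  qed
  also have "?f (- int (Suc m)) = ?T (Suc m)"
  proof -
    have e: "(2 * real_of_int (- int (Suc m)) - 1) * \<alpha> = - ((2 * real (Suc m) + 1) * \<alpha>)" by (simp add: algebra_simps)
    have n: "nat \<bar>- int (Suc m)\<bar> = Suc m" by simp
    show ?thesis unfolding e n J by simp
  qed
  finally show ?case by simp
qed

text \<open>Ursell's edge wave of order \<open>n\<close>, extended evenly across the axis. For \<open>n = 0\<close> it is the ground state
  \<open>exp (- x\<^sub>1 / sin \<alpha>)\<close>.\<close>
definition edge_wave :: "nat \<Rightarrow> real \<Rightarrow> real^2 \<Rightarrow> complex" where
  "edge_wave n \<alpha> x = (let k = 1 / sin ((2 * real n + 1) * \<alpha>) in
     \<Sum>j\<in>{- int n..int n}. complex_of_real (edge_coeff k \<alpha> (nat \<bar>j\<bar>)) * plane_wave k (2 * real_of_int j * \<alpha>) x)"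

context acute_sector
begin

context
  fixes n :: nat and k :: real
  assumes n: "(2 * real n + 1) * \<alpha> < pi / 2"
  defines "k \<equiv> 1 / sin ((2 * real n + 1) * \<alpha>)"
begin

lemma sin_odd_pos: "j \<le> n \<Longrightarrow> sin ((2 * real j + 1) * \<alpha>) > 0"
proof (rule sin_gt_zero)
  assume "j \<le> n"
  then have "(2 * real j + 1) * \<alpha> \<le> (2 * real n + 1) * \<alpha>" using \<alpha> by (intro mult_right_mono) auto
  then show "(2 * real j + 1) * \<alpha> < pi" using n pi_gt_zero by linarith
qed (use \<alpha> in auto)

lemma k_pos: "k > 0" using sin_odd_pos[of n] by (simp add: k_def)

lemma cos_wave_pos:
  assumes "j \<in> {- int n..int n}"
  shows "cos (2 * real_of_int j * \<alpha> - \<alpha>) > 0" "cos (2 * real_of_int j * \<alpha> + \<alpha>) > 0"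
proof -
  have j: "\<bar>real_of_int j\<bar> \<le> real n" using assms by auto
  have "\<bar>2 * real_of_int j * \<alpha>\<bar> \<le> 2 * real n * \<alpha>"
    unfolding abs_mult using j \<alpha> by (intro mult_mono) auto
  moreover have "2 * real n * \<alpha> + \<alpha> < pi / 2" using n by (simp add: distrib_right)
  ultimately have "\<bar>2 * real_of_int j * \<alpha>\<bar> + \<bar>\<alpha>\<bar> < pi / 2" using \<alpha> by linarith
  then have "\<bar>2 * real_of_int j * \<alpha> - \<alpha>\<bar> < pi / 2" "\<bar>2 * real_of_int j * \<alpha> + \<alpha>\<bar> < pi / 2"
    using abs_triangle_ineq4[of "2 * real_of_int j * \<alpha>" \<alpha>] abs_triangle_ineq[of "2 * real_of_int j * \<alpha>" \<alpha>]
    by (blast intro: le_less_trans)+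
  moreover have "cos z > 0" if "\<bar>z\<bar> < pi / 2" for z
    using that by (intro cos_gt_zero_pi) linarith+
  ultimately show "cos (2 * real_of_int j * \<alpha> - \<alpha>) > 0" "cos (2 * real_of_int j * \<alpha> + \<alpha>) > 0"
    by blast+
qed

lemma edge_wave_sum: "edge_wave n \<alpha> = (\<lambda>x. \<Sum>j\<in>{- int n..int n}. complex_of_real (edge_coeff k \<alpha> (nat \<bar>j\<bar>)) * plane_wave k (2 * real_of_int j * \<alpha>) x)"
  by (simp add: edge_wave_def[abs_def] k_def Let_def)

lemma C_k_edge_wave: "C_k m (edge_wave n \<alpha>)"
  unfolding edge_wave_sum by (intro C_k_sum C_k_mult C_k_const C_k_plane_wave)

lemma partial_deriv_edge_wave:
  "partial_deriv i (edge_wave n \<alpha>) x = (\<Sum>j\<in>{- int n..int n}. complex_of_real (edge_coeff k \<alpha> (nat \<bar>j\<bar>)) * partial_deriv i (plane_wave k (2 * real_of_int j * \<alpha>)) x)"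
proof -
  have "(edge_wave n \<alpha> has_derivative (\<lambda>h. \<Sum>j\<in>{- int n..int n}. complex_of_real (edge_coeff k \<alpha> (nat \<bar>j\<bar>)) *
      frechet_derivative (plane_wave k (2 * real_of_int j * \<alpha>)) (at x) h)) (at x)"
    unfolding edge_wave_sum
    by (intro has_derivative_sum has_derivative_mult_right has_derivative_frechet)
       (rule plane_wave_differentiable)
  from partial_deriv_eqI[OF this] show ?thesis by (simp add: partial_deriv_def)
qed

lemma edge_wave_L2: "edge_wave n \<alpha> \<in> L2 M" "edge_wave n \<alpha> \<in> L2 S" "partial_deriv i (edge_wave n \<alpha>) \<in> L2 M"
proof -
  show "edge_wave n \<alpha> \<in> L2 M" "edge_wave n \<alpha> \<in> L2 S"
    unfolding edge_wave_sum
    by (intro L2_sum L2_cmult plane_wave_L2(1) k_pos cos_wave_pos, assumption+)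
       (intro L2_sum L2_cmult plane_wave_L2(2) k_pos cos_wave_pos, assumption+)
  have p: "partial_deriv i (plane_wave k (2 * real_of_int j * \<alpha>)) \<in> L2 M" if "j \<in> {- int n..int n}" for j
  proof -
    have L: "plane_wave k (2 * real_of_int j * \<alpha>) \<in> L2 M" using that by (intro plane_wave_L2 k_pos cos_wave_pos)
    have "partial_deriv 1 (plane_wave k (2 * real_of_int j * \<alpha>)) \<in> L2 M" "partial_deriv 2 (plane_wave k (2 * real_of_int j * \<alpha>)) \<in> L2 M"
      unfolding partial_deriv_plane_wave[abs_def] by (rule L2_cmult[OF L])+
    then show ?thesis using exhaust_2[of i] by auto
  qed
  have "(\<lambda>x. \<Sum>j\<in>{- int n..int n}. complex_of_real (edge_coeff k \<alpha> (nat \<bar>j\<bar>)) * partial_deriv i (plane_wave k (2 * real_of_int j * \<alpha>)) x) \<in> L2 M"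
    using p by (intro L2_sum L2_cmult)
  also have "(\<lambda>x. \<Sum>j\<in>{- int n..int n}. complex_of_real (edge_coeff k \<alpha> (nat \<bar>j\<bar>)) * partial_deriv i (plane_wave k (2 * real_of_int j * \<alpha>)) x)
     = partial_deriv i (edge_wave n \<alpha>)"
    by (simp add: partial_deriv_edge_wave[abs_def])
  finally show "partial_deriv i (edge_wave n \<alpha>) \<in> L2 M" .
qed

lemma edge_wave_eigenfunction: "edge_wave n \<alpha> \<in> eigenspace (T_op \<alpha>) (- k\<^sup>2)"
proof (rule smooth_eigenfunction[OF C_k_edge_wave edge_wave_L2(1,3,2)])
  fix \<psi> assume \<psi>: "\<psi> \<in> Cc_smooth UNIV"
  let ?I = "{- int n..int n}"
  let ?c = "\<lambda>j. complex_of_real (edge_coeff k \<alpha> (nat \<bar>j\<bar>))"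
  let ?E = "\<lambda>j. plane_wave k (2 * real_of_int j * \<alpha>)"
  let ?h = "\<lambda>j x. ?E j x * \<psi> x"
  have hC: "?h j \<in> Cc_smooth UNIV" for j by (intro Cc_smooth_mult \<psi> C_k_plane_wave)
  have Ed: "(\<lambda>x. partial_deriv i (?E j) x * partial_deriv i \<psi> x) \<in> Cc_smooth UNIV" for i j
    using C_k_plane_wave[of "Suc _"] by (intro Cc_smooth_mult Cc_smooth_partial_deriv \<psi>) simp
  have i1: "integrable M (\<lambda>x. partial_deriv 1 (?E j) x * partial_deriv 1 \<psi> x + partial_deriv 2 (?E j) x * partial_deriv 2 \<psi> x)" for j
    by (intro Bochner_Integration.integrable_add Cc_smooth_integrable_M[OF Ed])
  have A: "(\<integral>x. partial_deriv 1 (edge_wave n \<alpha>) x * partial_deriv 1 \<psi> x + partial_deriv 2 (edge_wave n \<alpha>) x * partial_deriv 2 \<psi> x \<partial>M)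
    = (\<Sum>j\<in>?I. ?c j * (\<integral>x. partial_deriv 1 (?E j) x * partial_deriv 1 \<psi> x + partial_deriv 2 (?E j) x * partial_deriv 2 \<psi> x \<partial>M))"
  proof -
    have "partial_deriv 1 (edge_wave n \<alpha>) x * partial_deriv 1 \<psi> x + partial_deriv 2 (edge_wave n \<alpha>) x * partial_deriv 2 \<psi> x
      = (\<Sum>j\<in>?I. ?c j * (partial_deriv 1 (?E j) x * partial_deriv 1 \<psi> x + partial_deriv 2 (?E j) x * partial_deriv 2 \<psi> x))" for x
      unfolding partial_deriv_edge_wave sum_distrib_right sum.distrib[symmetric] by (intro sum.cong) (simp_all add: algebra_simps)
    then show ?thesis using i1 by (simp add: Bochner_Integration.integral_sum)
  qed
  have ws: "edge_wave n \<alpha> x * \<psi> x = (\<Sum>j\<in>?I. ?c j * ?h j x)" for x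
    unfolding edge_wave_sum sum_distrib_right by (simp add: mult.assoc)
  have B: "(\<integral>x. edge_wave n \<alpha> x * \<psi> x \<partial>M) = (\<Sum>j\<in>?I. ?c j * (\<integral>x. ?h j x \<partial>M))"
    unfolding ws using Cc_smooth_integrable_M[OF hC] by (simp add: Bochner_Integration.integral_sum)
  have C: "(\<integral>x. edge_wave n \<alpha> x * \<psi> x \<partial>S) = (\<Sum>j\<in>?I. ?c j * (\<integral>x. ?h j x \<partial>S))"
    unfolding ws using bdry_integral_Cc_smooth(1)[OF hC] by (simp add: Bochner_Integration.integral_sum)
  define J1 where "J1 \<eta> = edge_integral \<alpha> (\<lambda>x. plane_wave k (\<alpha> + \<eta>) x * \<psi> x)" for \<eta>
  define J2 where "J2 \<eta> = edge_integral (- \<alpha>) (\<lambda>x. plane_wave k (- \<alpha> + \<eta>) x * \<psi> x)" for \<eta>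
  have J: "J1 (- \<eta>) = J1 \<eta>" "J2 (- \<eta>) = J2 \<eta>" for \<eta>
    using edge_integral_plane_wave_even[of k \<eta> \<psi>] by (simp_all add: J1_def J2_def)
  have nz: "k * sin ((2 * real j + 1) * \<alpha>) + 1 \<noteq> 0" if "j < n" for j
    using mult_pos_pos[OF k_pos sin_odd_pos[of j]] that by simp
  have last: "k * sin ((2 * real n + 1) * \<alpha>) - 1 = 0" using sin_odd_pos[of n] by (simp add: k_def)
  have z1: "(\<Sum>j\<in>?I. ?c j * (complex_of_real (- k * sin (2 * real_of_int j * \<alpha> - \<alpha>) - 1) * edge_integral \<alpha> (?h j))) = 0"
  proof -
    have "(\<Sum>j\<in>?I. ?c j * (complex_of_real (- k * sin (2 * real_of_int j * \<alpha> - \<alpha>) - 1) * edge_integral \<alpha> (?h j)))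
      = (\<Sum>j\<in>?I. complex_of_real (edge_coeff k \<alpha> (nat \<bar>j\<bar>) * (- k * sin ((2 * real_of_int j - 1) * \<alpha>) - 1)) * J1 ((2 * real_of_int j - 1) * \<alpha>))"
      by (intro sum.cong) (simp_all add: J1_def algebra_simps)
    also have "\<dots> = complex_of_real (edge_coeff k \<alpha> n * (k * sin ((2 * real n + 1) * \<alpha>) - 1)) * J1 ((2 * real n + 1) * \<alpha>)"
      by (rule edge_coeff_telescope[where J=J1 and m=n, OF J(1) nz])
    also have "\<dots> = 0" unfolding last by simp
    finally show ?thesis .
  qed
  have z2: "(\<Sum>j\<in>?I. ?c j * (complex_of_real (k * sin (2 * real_of_int j * \<alpha> + \<alpha>) - 1) * edge_integral (- \<alpha>) (?h j))) = 0"
  proof -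
    have "(\<Sum>j\<in>?I. ?c j * (complex_of_real (k * sin (2 * real_of_int j * \<alpha> + \<alpha>) - 1) * edge_integral (- \<alpha>) (?h j)))
      = (\<Sum>j\<in>?I. complex_of_real (edge_coeff k \<alpha> (nat \<bar>j\<bar>) * (k * sin ((2 * real_of_int j + 1) * \<alpha>) - 1)) * J2 ((2 * real_of_int j + 1) * \<alpha>))"
      by (intro sum.cong) (simp_all add: J2_def algebra_simps)
    \<comment> \<open>The reflection in the axis exchanges the edges and the directions \<open>2j\<alpha>\<close> and \<open>-2j\<alpha>\<close>.\<close>
    also have "\<dots> = (\<Sum>j\<in>?I. complex_of_real (edge_coeff k \<alpha> (nat \<bar>j\<bar>) * (- k * sin ((2 * real_of_int j - 1) * \<alpha>) - 1)) * J2 ((2 * real_of_int j - 1) * \<alpha>))"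
    proof (rule sum.reindex_bij_witness[of _ uminus uminus])
      fix j :: int
      have e: "(2 * real_of_int (- j) - 1) * \<alpha> = - ((2 * real_of_int j + 1) * \<alpha>)" by (simp add: algebra_simps)
      show "complex_of_real (edge_coeff k \<alpha> (nat \<bar>- j\<bar>) * (- k * sin ((2 * real_of_int (- j) - 1) * \<alpha>) - 1)) * J2 ((2 * real_of_int (- j) - 1) * \<alpha>)
        = complex_of_real (edge_coeff k \<alpha> (nat \<bar>j\<bar>) * (k * sin ((2 * real_of_int j + 1) * \<alpha>) - 1)) * J2 ((2 * real_of_int j + 1) * \<alpha>)"
        unfolding e J by simp
    qed auto
    also have "\<dots> = complex_of_real (edge_coeff k \<alpha> n * (k * sin ((2 * real n + 1) * \<alpha>) - 1)) * J2 ((2 * real n + 1) * \<alpha>)"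
      by (rule edge_coeff_telescope[where J=J2 and m=n, OF J(2) nz])
    also have "\<dots> = 0" unfolding last by simp
    finally show ?thesis .
  qed
  have "(\<Sum>j\<in>?I. ?c j * ((\<integral>x. partial_deriv 1 (?E j) x * partial_deriv 1 \<psi> x + partial_deriv 2 (?E j) x * partial_deriv 2 \<psi> x \<partial>M)
      - (\<integral>x. ?h j x \<partial>S) + complex_of_real (k\<^sup>2) * (\<integral>x. ?h j x \<partial>M))) = 0"
    unfolding plane_wave_weak[OF \<psi>] distrib_left sum.distrib z1 z2 by simp
  then have "(\<Sum>j\<in>?I. ?c j * (\<integral>x. partial_deriv 1 (?E j) x * partial_deriv 1 \<psi> x + partial_deriv 2 (?E j) x * partial_deriv 2 \<psi> x \<partial>M))
      - (\<Sum>j\<in>?I. ?c j * (\<integral>x. ?h j x \<partial>S)) + complex_of_real (k\<^sup>2) * (\<Sum>j\<in>?I. ?c j * (\<integral>x. ?h j x \<partial>M)) = 0"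
    by (simp add: right_diff_distrib distrib_left sum.distrib sum_subtractf sum_distrib_left mult.left_commute)
  then show "(\<integral>x. partial_deriv 1 (edge_wave n \<alpha>) x * partial_deriv 1 \<psi> x + partial_deriv 2 (edge_wave n \<alpha>) x * partial_deriv 2 \<psi> x \<partial>M)
      - (\<integral>x. edge_wave n \<alpha> x * \<psi> x \<partial>S) = complex_of_real (- k\<^sup>2) * (\<integral>x. edge_wave n \<alpha> x * \<psi> x \<partial>M)"
    unfolding A B C by (simp add: eq_neg_iff_add_eq_0)
qed

lemma sin_odd_less: "j < n \<Longrightarrow> sin ((2 * real j + 1) * \<alpha>) < sin ((2 * real n + 1) * \<alpha>)"
proof (rule sin_monotone_2pi)
  assume "j < n"
  then show "(2 * real j + 1) * \<alpha> < (2 * real n + 1) * \<alpha>" using \<alpha> by (intro mult_strict_right_mono) auto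
  have "0 \<le> (2 * real j + 1) * \<alpha>" using \<alpha> by simp
  then show "- (pi / 2) \<le> (2 * real j + 1) * \<alpha>" using pi_gt_zero by linarith
qed (use n in auto)

lemma edge_coeff_nonzero: "j \<le> n \<Longrightarrow> edge_coeff k \<alpha> j \<noteq> 0"
proof (induction j)
  case (Suc j)
  have s: "sin ((2 * real j + 1) * \<alpha>) > 0" "sin ((2 * real j + 1) * \<alpha>) < sin ((2 * real n + 1) * \<alpha>)"
    using sin_odd_pos[of j] sin_odd_less[of j] Suc.prems by auto
  then have "k * sin ((2 * real j + 1) * \<alpha>) < 1" by (simp add: k_def)
  moreover have "k * sin ((2 * real j + 1) * \<alpha>) > 0" using s k_pos by simp
  ultimately show ?case using Suc by simp
qed simp

text \<open>Along the axis the two outermost plane waves decay most slowly.\<close>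
lemma edge_wave_not_null: "\<not> (AE x in M. edge_wave n \<alpha> x = 0)"
proof
  assume ae: "AE x in M. edge_wave n \<alpha> x = 0"
  let ?w = "edge_wave n \<alpha>" and ?I = "{- int n..int n}"
  have wc: "continuous_on UNIV ?w" by (rule C_k_imp_continuous[OF C_k_edge_wave])
  have zero: "?w x = 0" if x: "x \<in> U" for x
  proof (rule ccontr)
    assume nz: "?w x \<noteq> 0"
    have op: "open (U \<inter> {x. ?w x \<noteq> 0})"
      using wc by (intro open_Int open_sector[OF \<alpha>] open_Collect_neq continuous_on_const)
    have "AE x in lebesgue. x \<in> U \<longrightarrow> ?w x = 0"
      using ae U_borel by (subst (asm) AE_restrict_space_iff) auto
    then have "AE x in lebesgue. x \<notin> U \<inter> {x. ?w x \<noteq> 0}" by eventually_elim auto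
    then have "U \<inter> {x. ?w x \<noteq> 0} \<in> null_sets lebesgue"
      using op by (subst (asm) AE_iff_null_sets[symmetric]) auto
    then have "negligible (U \<inter> {x. ?w x \<noteq> 0})" by (simp add: negligible_iff_null_sets)
    then show False using open_not_negligible[OF op] x nz by blast
  qed
  have axis: "t *\<^sub>R dir 0 \<in> U" if "t > 0" for t
    using that sin_pos unfolding sector_eq[OF \<alpha>] by (simp add: edge_dist_def)
  let ?d = "\<lambda>j. cos (2 * real_of_int j * \<alpha>) - cos (2 * real n * \<alpha>)"
  have vanish: "(\<Sum>j\<in>?I. edge_coeff k \<alpha> (nat \<bar>j\<bar>) * exp (- (k * ?d j) * t)) = 0" if "t > 0" for t
  proof -
    have "0 = Re (?w (t *\<^sub>R dir 0)) * exp (k * cos (2 * real n * \<alpha>) * t)" using zero[OF axis[OF that]] by simp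
    also have "\<dots> = (\<Sum>j\<in>?I. edge_coeff k \<alpha> (nat \<bar>j\<bar>) * (exp (- k * (cos (2 * real_of_int j * \<alpha>) * t)) * exp (k * cos (2 * real n * \<alpha>) * t)))"
      by (simp add: edge_wave_sum plane_wave_def sum_distrib_right mult.assoc)
    also have "\<dots> = (\<Sum>j\<in>?I. edge_coeff k \<alpha> (nat \<bar>j\<bar>) * exp (- (k * ?d j) * t))"
      by (simp add: exp_add[symmetric] algebra_simps)
    finally show ?thesis by simp
  qed
  let ?L = "\<lambda>j. if \<bar>j\<bar> = int n then edge_coeff k \<alpha> n else 0"
  have "((\<lambda>t. \<Sum>j\<in>?I. edge_coeff k \<alpha> (nat \<bar>j\<bar>) * exp (- (k * ?d j) * t)) \<longlongrightarrow> (\<Sum>j\<in>?I. ?L j)) at_top"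
  proof (rule tendsto_sum)
    fix j assume j: "j \<in> ?I"
    show "((\<lambda>t. edge_coeff k \<alpha> (nat \<bar>j\<bar>) * exp (- (k * ?d j) * t)) \<longlongrightarrow> ?L j) at_top"
    proof (cases "\<bar>j\<bar> = int n")
      case True
      then have "real_of_int j = real n \<or> real_of_int j = - real n" by (auto simp: abs_if split: if_splits)
      then have "?d j = 0" by auto
      then show ?thesis using True by simp
    next
      case False
      then have lt: "\<bar>real_of_int j\<bar> < real n" using j by auto
      have "cos (2 * real n * \<alpha>) < cos \<bar>2 * real_of_int j * \<alpha>\<bar>"
      proof (rule cos_monotone_0_pi)
        show "\<bar>2 * real_of_int j * \<alpha>\<bar> < 2 * real n * \<alpha>"
          unfolding abs_mult using lt \<alpha> by (auto intro!: mult_strict_right_mono)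
        show "2 * real n * \<alpha> \<le> pi" using n \<alpha> by (simp add: distrib_right)
      qed simp
      then have "k * ?d j > 0" using k_pos by (simp add: cos_abs_real)
      then have "filterlim (\<lambda>t. (k * ?d j) * t) at_top at_top"
        by (intro filterlim_tendsto_pos_mult_at_top[OF tendsto_const] filterlim_ident)
      then have "((\<lambda>t. exp (- ((k * ?d j) * t))) \<longlongrightarrow> 0) at_top"
        by (intro filterlim_compose[OF exp_at_bot]) (simp add: filterlim_uminus_at_bot)
      from tendsto_mult[OF tendsto_const[of "edge_coeff k \<alpha> (nat \<bar>j\<bar>)"] this] show ?thesis
        using False by simp
    qed
  qed
  moreover have "((\<lambda>t. \<Sum>j\<in>?I. edge_coeff k \<alpha> (nat \<bar>j\<bar>) * exp (- (k * ?d j) * t)) \<longlongrightarrow> 0) at_top"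
    by (rule tendsto_eventually, rule eventually_mono[OF eventually_gt_at_top[of 0]]) (rule vanish)
  ultimately have "(\<Sum>j\<in>?I. ?L j) = 0" using tendsto_unique[OF trivial_limit_at_top_linorder] by blast
  moreover have "(\<Sum>j\<in>?I. ?L j) = of_nat (card {j \<in> ?I. \<bar>j\<bar> = int n}) * edge_coeff k \<alpha> n"
    by (simp add: sum.inter_filter[symmetric])
  moreover have "card {int n} \<le> card {j \<in> ?I. \<bar>j\<bar> = int n}"
    by (rule card_mono) (rule finite_subset[of _ ?I], auto)
  ultimately show False using edge_coeff_nonzero[of n] by simp
qed

lemma eigenspace_dim: "1 \<le> ae_dim M (eigenspace (T_op \<alpha>) (- k\<^sup>2))"
proof -
  have ind: "ae_independent M 1 (\<lambda>_. edge_wave n \<alpha>)"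
    unfolding ae_independent_def
  proof (intro allI impI)
    fix c :: "nat \<Rightarrow> complex" and i :: nat
    assume "AE x in M. (\<Sum>i<1. c i * edge_wave n \<alpha> x) = 0" "i < 1"
    moreover have "c 0 = 0"
    proof (rule ccontr)
      assume "c 0 \<noteq> 0"
      with calculation(1) have "AE x in M. edge_wave n \<alpha> x = 0" by simp
      with edge_wave_not_null show False by simp
    qed
    ultimately show "c i = 0" by simp
  qed
  have "\<exists>u. (\<forall>i<1. u i \<in> eigenspace (T_op \<alpha>) (- k\<^sup>2)) \<and> ae_independent M 1 u"
    by (rule exI[of _ "\<lambda>_. edge_wave n \<alpha>"]) (simp only: edge_wave_eigenfunction ind simp_thms)
  then have "enat 1 \<in> {enat n | n. \<exists>u. (\<forall>i<n. u i \<in> eigenspace (T_op \<alpha>) (- k\<^sup>2)) \<and> ae_independent M n u}"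
    unfolding mem_Collect_eq by (intro exI[of _ "1::nat"] conjI refl)
  then show ?thesis unfolding ae_dim_def one_enat_def by (rule Sup_upper)
qed

end

section \<open>Counting eigenvalues\<close>

lemma N_op_ge:
  assumes N: "2 * real N * \<alpha> \<le> 1"
  shows "enat N \<le> N_op \<alpha> (-1)"
proof -
  define \<mu> where "\<mu> n = - (1 / sin ((2 * real n + 1) * \<alpha>))\<^sup>2" for n :: nat
  \<comment> \<open>\<open>n < N\<close> gives \<open>2n + 1 \<le> 2N\<close>, and \<open>1 < \<pi>/2\<close>.\<close>
  have small: "(2 * real n + 1) * \<alpha> < pi / 2" if "n < N" for n
  proof -
    have "(2 * real n + 1) * \<alpha> \<le> (2 * real N) * \<alpha>" using that \<alpha> by (intro mult_right_mono) auto
    then show ?thesis using N pi_gt3 by linarith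
  qed
  have neg: "\<mu> n < -1" if "n < N" for n
  proof -
    have s: "sin ((2 * real n + 1) * \<alpha>) > 0" using sin_odd_pos[OF small[OF that], of n] by simp
    have "sin ((2 * real n + 1) * \<alpha>) < sin (pi / 2)"
      by (rule sin_monotone_2pi) (use small[OF that] \<alpha> pi_gt_zero in \<open>auto intro: order_trans[of _ 0]\<close>)
    then have "1 < 1 / sin ((2 * real n + 1) * \<alpha>)" using s by simp
    then have "1 < (1 / sin ((2 * real n + 1) * \<alpha>))\<^sup>2" by (intro one_less_power) auto
    then show ?thesis by (simp add: \<mu>_def)
  qed
  have inj: "inj_on \<mu> {..<N}"
  proof (rule linorder_inj_onI)
    fix i j assume ij: "i < j" "i \<in> {..<N}" "j \<in> {..<N}"
    have "0 < sin ((2 * real i + 1) * \<alpha>)" "sin ((2 * real i + 1) * \<alpha>) < sin ((2 * real j + 1) * \<alpha>)"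
      using sin_odd_pos[OF small, of j i] sin_odd_less[OF small, of j i] ij by auto
    then have "1 / sin ((2 * real j + 1) * \<alpha>) < 1 / sin ((2 * real i + 1) * \<alpha>)" "0 < 1 / sin ((2 * real j + 1) * \<alpha>)"
      by (auto intro!: divide_strict_left_mono)
    then have "(1 / sin ((2 * real j + 1) * \<alpha>))\<^sup>2 < (1 / sin ((2 * real i + 1) * \<alpha>))\<^sup>2"
      by (intro power_strict_mono) auto
    then show "\<mu> i \<noteq> \<mu> j" by (simp add: \<mu>_def)
  qed auto
  let ?F = "\<mu> ` {..<N}"
  have F: "finite ?F" "?F \<subseteq> {..< -1}" using neg by auto
  have "enat N = of_nat (card ?F)" using inj by (simp add: card_image of_nat_eq_enat)
  also have "\<dots> = (\<Sum>m\<in>?F. 1)" by simp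
  also have "\<dots> \<le> (\<Sum>m\<in>?F. ae_dim M (eigenspace (T_op \<alpha>) m))"
  proof (rule sum_mono)
    fix m assume "m \<in> ?F"
    then obtain n where "n < N" "m = \<mu> n" by auto
    then show "1 \<le> ae_dim M (eigenspace (T_op \<alpha>) m)" using eigenspace_dim[OF small] by (simp add: \<mu>_def)
  qed
  also have "\<dots> \<le> (SUP F\<in>{F. finite F \<and> F \<subseteq> {..< -1}}. \<Sum>m\<in>F. ae_dim M (eigenspace (T_op \<alpha>) m))"
    using F by (intro SUP_upper) simp
  also have "\<dots> = (\<Sum>\<^sub>\<infinity>m\<in>{..< -1}. ae_dim M (eigenspace (T_op \<alpha>) m))"
    by (rule nonneg_infsum_complete[symmetric]) simp
  finally show ?thesis by (simp add: N_op_def eigenvalue_count_def)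
qed

end

theorem corollary4p2:
  shows "(\<exists>\<kappa>::real. \<kappa> > 0 \<and>
            (\<forall>\<^sub>F \<alpha> in at_right (0::real). ereal (\<kappa> / \<alpha>) \<le> ereal_of_enat (N_op \<alpha> (-1))))
         \<and> ((\<lambda>\<alpha>. N_op \<alpha> (-1)) \<longlongrightarrow> \<infinity>) (at_right 0)"
proof -
  have bound: "\<exists>N. enat N \<le> N_op \<alpha> (-1) \<and> (1/4) / \<alpha> \<le> real N" if a: "0 < \<alpha>" "\<alpha> < 1/4" for \<alpha> :: real
  proof -
    interpret acute_sector \<alpha> by unfold_locales (use a pi_gt3 in auto)
    \<comment> \<open>The largest number allowed by \<open>N_op_ge\<close>. Rounding down loses at most 1, which for \<open>\<alpha> < 1/4\<close> is
      less than \<open>1/(4\<alpha>)\<close>, half of \<open>1/(2\<alpha>)\<close>.\<close>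
    define N where "N = nat \<lfloor>1 / (2 * \<alpha>)\<rfloor>"
    have "0 \<le> 1 / (2 * \<alpha>)" using a by simp
    then have N: "real N \<le> 1 / (2 * \<alpha>)" "1 / (2 * \<alpha>) - 1 \<le> real N" unfolding N_def by linarith+
    have "2 * real N * \<alpha> \<le> 1" using N(1) a by (simp add: field_simps)
    moreover have "(1/4) / \<alpha> \<le> 1 / (2 * \<alpha>) - 1" using a by (simp add: field_simps)
    ultimately show ?thesis using N_op_ge[of N] N(2) by (intro exI[of _ N]) simp
  qed
  have small: "\<forall>\<^sub>F \<alpha> in at_right (0::real). 0 < \<alpha> \<and> \<alpha> < 1/4"
    by (rule eventually_at_rightI[of 0 "1/4"]) auto
  have "\<forall>\<^sub>F \<alpha> in at_right (0::real). ereal ((1/4) / \<alpha>) \<le> ereal_of_enat (N_op \<alpha> (-1))"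
    using small
  proof eventually_elim
    fix \<alpha> :: real assume "0 < \<alpha> \<and> \<alpha> < 1/4"
    then obtain N where N: "enat N \<le> N_op \<alpha> (-1)" "(1/4) / \<alpha> \<le> real N" using bound by blast
    have "ereal ((1/4) / \<alpha>) \<le> ereal (real N)" using N(2) by simp
    also have "\<dots> = ereal_of_enat (enat N)" by simp
    also have "\<dots> \<le> ereal_of_enat (N_op \<alpha> (-1))" using N(1) by (simp only: ereal_of_enat_le_iff)
    finally show "ereal ((1/4) / \<alpha>) \<le> ereal_of_enat (N_op \<alpha> (-1))" .
  qed
  moreover have "((\<lambda>\<alpha>. N_op \<alpha> (-1)) \<longlongrightarrow> \<infinity>) (at_right 0)"
  proof (rule order_tendstoI)
    fix l :: enat assume "l < \<infinity>"
    then obtain m where m: "l = enat m" by (cases l) auto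
    have "\<forall>\<^sub>F \<alpha> in at_right (0::real). 0 < \<alpha> \<and> \<alpha> < 1 / (4 * (real m + 1))"
      by (rule eventually_at_rightI[of 0 "1 / (4 * (real m + 1))"]) auto
    then show "\<forall>\<^sub>F \<alpha> in at_right (0::real). l < N_op \<alpha> (-1)"
      using small
    proof eventually_elim
      fix \<alpha> :: real assume a: "0 < \<alpha> \<and> \<alpha> < 1 / (4 * (real m + 1))" "0 < \<alpha> \<and> \<alpha> < 1/4"
      then obtain N where N: "enat N \<le> N_op \<alpha> (-1)" "(1/4) / \<alpha> \<le> real N" using bound by blast
      have "real m + 1 < (1/4) / \<alpha>" using a(1) by (simp add: field_simps)
      then have "m < N" using N(2) by linarith
      then have "l < enat N" by (simp add: m)
      then show "l < N_op \<alpha> (-1)" using N(1) by (rule less_le_trans)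
    qed
  qed simp
  ultimately show ?thesis by (intro conjI exI[of _ "1/4"]) auto
qed

end
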